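(* Let $\alpha,\varepsilon>0$ and let $W\in C^2(\mathbb{R})$, $W:\mathbb{R}\to[0,\infty)$, be a function which grows at most quadratically at infinity and such that $W(u)=0$ if and only if $u\in\{0,1\}$. Assume that $u\in C^2([0,\infty)\times\Omega)$ solves the PDE $$(\partial_{tt}+\alpha\,\partial_t)u=\Delta u-\frac1{\varepsilon^2}\,W'(u)$$ in a domain $\Omega$ and that either $\partial_tu(t,x)\equiv0$ for all $t>0$ and $x\in\partial\Omega$, or $\partial_\nu u(t,x)\equiv0$ for all $t>0$ and $x\in\partial\Omega$, or $\partial\Omega=\emptyset$. Let $(\bar t,\bar x)\in(0,\infty)\times\Omega$ be such that the initial condition $u_0=u(0,\cdot)$ satisfies $u_0\equiv0$ on $B_{\bar t}(\bar x)\cap\Omega$ and the initial condition $\partial_tu(0,\cdot)$ for $\partial_tu$ vanishes on $B_{\bar t}(\bar x)\cap\Omega$. Then $u(\bar t,\bar x)=0$.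
   Context: $B_r(x)$ denotes the ball of radius $r$ around $x$. $\Delta$ acts in the space variable $x$ and $\partial_\nu$ denotes the normal derivative on $\partial\Omega$. The three boundary cases correspond to time-independent Dirichlet, homogeneous Neumann, and periodic boundary conditions, respectively.
   Formalization: Since the boundary conditions use derivatives of u on ∂Ω, where u ∈ C²([0,∞)×Ω) gives no values, u is additionally assumed to be C¹ up to ∂Ω; in the Neumann case ∂Ω is assumed to be C¹, so that the normal exists at every boundary point. *)

theory Defs
  imports "HOL-Analysis.Analysis" "HOL-Library.Landau_Symbols"
begin

section \<open>The ambient space and its domains\<close>

text \<open>
  Domains live in a flat space \<open>\<real>\<^sup>n / \<Lambda>\<close>, where \<open>\<Lambda>\<close> is the lattice spanned by a linearly
  independent set \<open>B\<close> of periods. For \<open>B = {}\<close> this is Euclidean space; if \<open>B\<close> is a basis it is a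
  flat torus, the setting of periodic boundary conditions. A subset of \<open>\<real>\<^sup>n / \<Lambda>\<close> is represented by
  its preimage in \<open>\<real>\<^sup>n\<close>, and a function on it by the corresponding periodic function. Taking
  preimages commutes with interior, closure and frontier.
\<close>

definition period_lattice :: "'a::euclidean_space set \<Rightarrow> 'a set" where
  "period_lattice B = range (\<lambda>c::'a \<Rightarrow> int. \<Sum>b\<in>B. real_of_int (c b) *\<^sub>R b)"

definition flat_ball :: "'a::euclidean_space set \<Rightarrow> 'a \<Rightarrow> real \<Rightarrow> 'a set" where
  "flat_ball B x r = (\<Union>p\<in>period_lattice B. ball (x + p) r)"

text \<open>The last conjunct says that the image of \<open>\<Omega>\<close> in the quotient is connected; \<open>\<Omega>\<close> itself
  need not be.\<close>

definition flat_domain :: "'a::euclidean_space set \<Rightarrow> 'a set \<Rightarrow> bool" where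
  "flat_domain B \<Omega> \<longleftrightarrow> open \<Omega> \<and> \<Omega> \<noteq> {} \<and> (\<forall>b\<in>B. (+) b ` \<Omega> = \<Omega>) \<and>
     (\<forall>x\<in>\<Omega>. \<forall>y\<in>\<Omega>. \<exists>p\<in>period_lattice B. connected_component \<Omega> x (y + p))"

lemma period_lattice_empty [simp]: "period_lattice {} = {0}"
  by (auto simp: period_lattice_def)

lemma flat_ball_empty [simp]: "flat_ball {} x r = ball x r"
  by (simp add: flat_ball_def)

lemma flat_domain_empty: "flat_domain {} \<Omega> \<longleftrightarrow> open \<Omega> \<and> connected \<Omega> \<and> \<Omega> \<noteq> {}"
  by (auto simp: flat_domain_def connected_iff_connected_component)


section \<open>Differentiability classes\<close>

text \<open>
  These are used for sets \<open>S\<close> such as \<open>[0,\<infinity>) \<times> \<Omega>\<close> with \<open>\<Omega>\<close> open, where derivatives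
  within \<open>S\<close> are unique (and one-sided in time at \<open>t = 0\<close>).
\<close>

definition C1_on :: "'a::real_normed_vector set \<Rightarrow> ('a \<Rightarrow> 'b::real_normed_vector) \<Rightarrow> bool" where
  "C1_on S f \<longleftrightarrow> (\<exists>f'. continuous_on S f' \<and>
     (\<forall>z\<in>S. (f has_derivative blinfun_apply (f' z)) (at z within S)))"

definition C2_on :: "'a::real_normed_vector set \<Rightarrow> ('a \<Rightarrow> 'b::real_normed_vector) \<Rightarrow> bool" where
  "C2_on S f \<longleftrightarrow> (\<exists>f'. C1_on S f' \<and>
     (\<forall>z\<in>S. (f has_derivative blinfun_apply (f' z)) (at z within S)))"

text \<open>\<open>f\<close> is continuous up to the boundary of \<open>S\<close>, and its derivative on \<open>S\<close> extends continuously
  to the closure.\<close>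

definition C1_up_to_closure ::
    "'a::real_normed_vector set \<Rightarrow> ('a \<Rightarrow> 'b::real_normed_vector) \<Rightarrow> bool" where
  "C1_up_to_closure S f \<longleftrightarrow> continuous_on (closure S) f \<and>
     (\<exists>f'. continuous_on (closure S) f' \<and>
       (\<forall>z\<in>S. (f has_derivative blinfun_apply (f' z)) (at z within S)))"

definition laplacian :: "('a::euclidean_space \<Rightarrow> real) \<Rightarrow> 'a \<Rightarrow> real" where
  "laplacian f x = (\<Sum>b\<in>Basis. (deriv ^^ 2) (\<lambda>s. f (x + s *\<^sub>R b)) 0)"


section \<open>Boundary conditions\<close>

text \<open>\<open>\<Omega>\<close> coincides near \<open>x\<close> with the sublevel set \<open>{g < 0}\<close> of a \<open>C\<^sup>1\<close> function with nonvanishing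
  gradient \<open>G\<close>.\<close>

definition local_defining_function ::
    "'a::euclidean_space set \<Rightarrow> 'a \<Rightarrow> ('a \<Rightarrow> real) \<Rightarrow> ('a \<Rightarrow> 'a) \<Rightarrow> bool" where
  "local_defining_function \<Omega> x g G \<longleftrightarrow>
     (\<exists>U. open U \<and> x \<in> U \<and> \<Omega> \<inter> U = {y \<in> U. g y < 0} \<and> continuous_on U G \<and>
        (\<forall>y\<in>U. GDERIV g y :> G y \<and> G y \<noteq> 0))"

definition C1_boundary :: "'a::euclidean_space set \<Rightarrow> bool" where
  "C1_boundary \<Omega> \<longleftrightarrow> (\<forall>x\<in>frontier \<Omega>. \<exists>g G. local_defining_function \<Omega> x g G)"

definition outer_unit_normal :: "'a::euclidean_space set \<Rightarrow> 'a \<Rightarrow> 'a \<Rightarrow> bool" where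
  "outer_unit_normal \<Omega> x \<nu> \<longleftrightarrow> (\<exists>g G. local_defining_function \<Omega> x g G \<and> \<nu> = sgn (G x))"

text \<open>The normal derivative at a boundary point is one-sided, as \<open>x + s *\<^sub>R \<nu>\<close> lies in \<open>\<Omega>\<close> only for
  small negative \<open>s\<close>.\<close>

definition has_normal_derivative ::
    "'a::euclidean_space set \<Rightarrow> ('a \<Rightarrow> real) \<Rightarrow> 'a \<Rightarrow> real \<Rightarrow> bool" where
  "has_normal_derivative \<Omega> f x D \<longleftrightarrow>
     (\<forall>\<nu>. outer_unit_normal \<Omega> x \<nu> \<longrightarrow>
        ((\<lambda>s. f (x + s *\<^sub>R \<nu>)) has_real_derivative D) (at 0 within {..0}))"

definition static_dirichlet :: "'a::euclidean_space set \<Rightarrow> (real \<Rightarrow> 'a \<Rightarrow> real) \<Rightarrow> bool" where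
  "static_dirichlet \<Omega> u \<longleftrightarrow>
     (\<forall>t>0. \<forall>x\<in>frontier \<Omega>. ((\<lambda>s. u s x) has_real_derivative 0) (at t))"

text \<open>Boundary regularity is assumed only here, where a normal is needed.\<close>

definition homogeneous_neumann :: "'a::euclidean_space set \<Rightarrow> (real \<Rightarrow> 'a \<Rightarrow> real) \<Rightarrow> bool" where
  "homogeneous_neumann \<Omega> u \<longleftrightarrow>
     C1_boundary \<Omega> \<and> (\<forall>t>0. \<forall>x\<in>frontier \<Omega>. has_normal_derivative \<Omega> (u t) x 0)"

end

theory Submission
  imports Defs
begin

text \<open>
  The proof is the energy method for finite speed of propagation, in the backward light cone with
  apex \<open>(t\<^sub>0, x\<^sub>0)\<close>. A solution of \<open>u\<^sub>t\<^sub>t + \<alpha> u\<^sub>t = \<Delta> u - W'(u) / \<epsilon>\<^sup>2\<close> satisfies, for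
  \<open>e = (u\<^sub>t\<^sup>2 + |\<nabla>u|\<^sup>2) / 2 + W(u) / \<epsilon>\<^sup>2\<close>, the identity
  \<open>\<partial>\<^sub>t e = div (u\<^sub>t \<nabla>u) - \<alpha> u\<^sub>t\<^sup>2\<close>. It is integrated over \<open>\<Omega>\<close> against the \<open>C\<^sup>1\<close> weight
  \<open>\<phi>(t, x) = (max 0 ((t\<^sub>0 - t)\<^sup>2 - |x - x\<^sub>0|\<^sup>2))\<^sup>2\<close>, which lives in the cone and satisfies
  \<open>|\<nabla>\<phi>| \<le> - \<partial>\<^sub>t \<phi>\<close>. The flux term \<open>u\<^sub>t \<nabla>\<phi> \<bullet> \<nabla>u\<close> is then absorbed by \<open>\<partial>\<^sub>t \<phi> e\<close>, damping only
  lowers the energy, and the boundary flux \<open>\<phi> u\<^sub>t \<partial>\<^sub>\<nu>u\<close> vanishes in each of the boundary cases. So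
  \<open>\<integral> \<phi> e\<close> does not increase. It starts at \<open>0\<close> because \<open>u\<close> and \<open>u\<^sub>t\<close> vanish on the base of the cone
  and \<open>W(0) = 0\<close>, and \<open>W \<ge> 0\<close> makes it nonnegative; hence \<open>u\<^sub>t = 0\<close> on the axis of the cone, and \<open>u\<close>
  keeps its initial value \<open>0\<close> up to the apex. In the periodic setting the argument takes place in the
  covering space, where \<open>ball x\<^sub>0 t\<^sub>0\<close> is one of the balls that make up \<open>flat_ball B x\<^sub>0 t\<^sub>0\<close>.

  Two points need care. The second derivatives of \<open>u\<close> are not controlled near \<open>\<partial>\<Omega>\<close>, so that
  \<open>\<Delta>u\<close> and \<open>\<nabla>u\<^sub>t\<close> need not be integrable over \<open>\<Omega>\<close>; and under Dirichlet conditions \<open>\<partial>\<Omega>\<close> may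
  be so rough that no classical divergence theorem holds on \<open>\<Omega>\<close>.

  The first point is met by averaging in time. Let \<open>\<langle>v\<rangle>\<close> be the mean of \<open>v\<close> over \<open>[t, t + h]\<close>.
  Integrating the equation over this window expresses \<open>\<Delta>\<langle>u\<rangle>\<close> through \<open>u\<close> and \<open>u\<^sub>t\<close> alone, which are
  continuous up to \<open>\<partial>\<Omega>\<close>, and \<open>\<partial>\<^sub>t\<langle>u\<rangle> = (u(t + h) - u(t)) / h\<close> is \<open>C\<^sup>1\<close> up to \<open>\<partial>\<Omega>\<close> in space. The
  energy inequality is proved for the means (\<open>window_energy_inequality\<close>), and \<open>h\<close> then tends to \<open>0\<close>
  (\<open>energy_inequality\<close>).

  For the second point, the averaged equation is put in weak form
  \<open>\<integral> P \<bullet> \<nabla>\<psi> + q \<psi> = 0\<close> with \<open>P = \<nabla>\<langle>u\<rangle>\<close>, first for \<open>\<psi>\<close> with compact support in \<open>\<Omega>\<close>. There it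
  follows from the translation invariance of Lebesgue measure
  (\<open>integral_directional_derivative_eq_0\<close>). It is then extended to \<open>\<psi> = \<phi> \<partial>\<^sub>t\<langle>u\<rangle>\<close> by multiplying
  \<open>\<psi>\<close> with a cutoff that vanishes near \<open>\<partial>\<Omega>\<close>. Under Dirichlet conditions \<open>\<psi>\<close> vanishes on
  \<open>\<partial>\<Omega>\<close> and small values of \<open>\<psi>\<close> are cut off; the error disappears because \<open>\<nabla>\<psi> = 0\<close> almost
  everywhere on \<open>{\<psi> = 0}\<close> (\<open>weak_form_dirichlet\<close>). Under Neumann conditions the cutoff is a function
  of a local defining function \<open>g\<close> of \<open>\<Omega>\<close>; its gradient is of order \<open>1 / \<delta>\<close> on a layer of volume
  \<open>O(\<delta>)\<close>, on which \<open>P \<bullet> \<nabla>g\<close> tends to \<open>0\<close> uniformly (\<open>weak_form_neumann\<close>).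
\<close>

section \<open>Cutoff functions and extension by zero\<close>

definition pos_sq :: "real \<Rightarrow> real" where "pos_sq s = (max 0 s)\<^sup>2"

lemma pos_sq_DERIV: "(pos_sq has_real_derivative 2 * max 0 s) (at s)"
proof -
  consider "s > 0" | "s < 0" | "s = 0" by linarith
  then show ?thesis
  proof cases
    case 1
    have "((\<lambda>s. s\<^sup>2) has_real_derivative 2 * max 0 s) (at s)"
      using 1 by (auto intro!: derivative_eq_intros)
    then show ?thesis
      by (rule has_field_derivative_transform_within_open[of _ _ _ "{0<..}"]) (use 1 in \<open>auto simp: pos_sq_def\<close>)
  next
    case 2
    have "((\<lambda>s. 0) has_real_derivative 2 * max 0 s) (at s)"
      using 2 by (auto intro!: derivative_eq_intros)
    then show ?thesis
      by (rule has_field_derivative_transform_within_open[of _ _ _ "{..<0}"]) (use 2 in \<open>auto simp: pos_sq_def\<close>)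
  next
    case 3
    have "(\<lambda>h. pos_sq h / h) \<midarrow>0\<rightarrow> 0"
    proof (rule Lim_null_comparison)
      show "\<forall>\<^sub>F h in at 0. norm (pos_sq h / h) \<le> \<bar>h\<bar>"
        by (rule always_eventually) (auto simp: pos_sq_def max_def power2_eq_square)
      show "(\<lambda>h. \<bar>h\<bar>) \<midarrow>0\<rightarrow> (0::real)" by (rule tendsto_eq_intros | simp)+
    qed
    then show ?thesis using 3 by (simp add: DERIV_def pos_sq_def)
  qed
qed

lemma pos_sq_simps: "s \<le> 0 \<Longrightarrow> pos_sq s = 0" "s \<ge> 0 \<Longrightarrow> pos_sq s = s\<^sup>2" "pos_sq s \<ge> 0"
  by (auto simp: pos_sq_def)

text \<open>A \<open>C\<^sup>1\<close> transition from \<open>0\<close> (for \<open>s \<le> 0\<close>) to \<open>1\<close> (for \<open>s \<ge> 1\<close>). It is the quotient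
  familiar from smooth partitions of unity, with \<open>pos_sq s\<close> in the place of \<open>exp (- 1 / s)\<close>.\<close>

definition smooth_step :: "real \<Rightarrow> real" where
  "smooth_step s = pos_sq s / (pos_sq s + pos_sq (1 - s))"

definition smooth_step' :: "real \<Rightarrow> real" where
  "smooth_step' s = 2 * (max 0 s * pos_sq (1 - s) + pos_sq s * max 0 (1 - s)) / (pos_sq s + pos_sq (1 - s))\<^sup>2"

lemma smooth_step_denom: "pos_sq s + pos_sq (1 - s) > 0"
  by (cases "s > 0") (auto simp: pos_sq_def add_pos_nonneg add_nonneg_pos)

lemma smooth_step_DERIV: "(smooth_step has_real_derivative smooth_step' s) (at s)"
proof -
  have 1: "((\<lambda>s. pos_sq (1 - s)) has_real_derivative (2 * max 0 (1 - s)) * (-1)) (at s)"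
    by (rule DERIV_chain'[OF _ pos_sq_DERIV]) (auto intro!: derivative_eq_intros)
  show ?thesis unfolding smooth_step_def[abs_def] smooth_step'_def using smooth_step_denom[of s]
    by (auto intro!: derivative_eq_intros pos_sq_DERIV 1 simp: field_simps power2_eq_square)
qed

lemma continuous_pos_sq [continuous_intros]: "continuous_on S f \<Longrightarrow> continuous_on S (\<lambda>x. pos_sq (f x))"
  unfolding pos_sq_def by (intro continuous_intros)

lemma continuous_smooth_step' [continuous_intros]: "continuous_on S f \<Longrightarrow> continuous_on S (\<lambda>x. smooth_step' (f x))"
  unfolding smooth_step'_def using smooth_step_denom by (intro continuous_intros) (auto simp: less_imp_neq[symmetric] less_imp_neq)

lemma continuous_smooth_step [continuous_intros]: "continuous_on S f \<Longrightarrow> continuous_on S (\<lambda>x. smooth_step (f x))"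
  unfolding smooth_step_def using smooth_step_denom by (intro continuous_intros) (auto simp: less_imp_neq[symmetric] less_imp_neq)

lemma smooth_step_simps: "s \<le> 0 \<Longrightarrow> smooth_step s = 0" "s \<ge> 1 \<Longrightarrow> smooth_step s = 1" "0 \<le> smooth_step s" "smooth_step s \<le> 1"
  "s \<le> 0 \<Longrightarrow> smooth_step' s = 0" "s \<ge> 1 \<Longrightarrow> smooth_step' s = 0" "0 \<le> smooth_step' s" "smooth_step' (1/2) = 2"
  using smooth_step_denom[of s]
  by (auto simp: smooth_step_def smooth_step'_def pos_sq_simps divide_simps)

lemma smooth_step'_bounded: obtains M where "M > 0" "\<And>s. smooth_step' s \<le> M"
proof -
  have "compact (smooth_step' ` {0..1})" by (intro compact_continuous_image continuous_intros) auto
  then have "bounded (smooth_step' ` {0..1})" by (rule compact_imp_bounded)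
  then obtain M where M: "\<forall>s\<in>{0..1}. norm (smooth_step' s) \<le> M"
    unfolding bounded_iff by blast
  have "smooth_step' s \<le> max M 1" for s
    using bspec[OF M, of s] smooth_step_simps(5,6)[of s] by (cases "s \<in> {0..1}") auto
  then show ?thesis by (intro that[of "max M 1"]) auto
qed

text \<open>A product with a factor that vanishes off \<open>C\<close> is regular on the whole space even if the
  other factors are arbitrary off \<open>U\<close>; this and the next lemma make extension by zero implicit.\<close>

lemma continuous_on_extend_0:
  fixes f :: "'a::topological_space \<Rightarrow> 'b::real_normed_vector"
  assumes "open U" "closed C" "C \<subseteq> U" "continuous_on U f" "\<And>x. x \<notin> C \<Longrightarrow> f x = 0"
  shows "continuous_on UNIV f"
proof -
  have "continuous_on (- C) f" using assms(5) by (subst continuous_on_cong[of _ "- C" _ "\<lambda>_. 0"]) auto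
  then have "continuous_on (U \<union> - C) f" using assms by (intro continuous_on_open_Un) auto
  moreover have "U \<union> - C = UNIV" using assms by auto
  ultimately show ?thesis by simp
qed

lemma GDERIV_extend_0:
  assumes "closed C" "\<And>x. x \<in> C \<Longrightarrow> GDERIV f x :> f' x"
    "\<And>x. x \<notin> C \<Longrightarrow> f x = 0" "\<And>x. x \<notin> C \<Longrightarrow> f' x = 0"
  shows "GDERIV f x :> f' x"
proof (cases "x \<in> C")
  case False
  have "((\<lambda>_. 0) has_derivative (\<lambda>h. h \<bullet> f' x)) (at x)" using assms(4)[OF False] by simp
  then have "(f has_derivative (\<lambda>h. h \<bullet> f' x)) (at x)"
    by (rule has_derivative_transform_within_open[of _ _ _ _ "- C"]) (use False assms in auto)
  then show ?thesis by (simp add: gderiv_def)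
qed (use assms in auto)

lemma GDERIV_transform_open:
  assumes "GDERIV f x :> D" "open U" "x \<in> U" "\<And>y. y \<in> U \<Longrightarrow> f y = g y"
  shows "GDERIV g x :> D"
  using assms has_derivative_transform_within_open[of f _ x UNIV U g] by (auto simp: gderiv_def)

lemma GDERIV_imp_isCont: "GDERIV f x :> D \<Longrightarrow> isCont f x"
  unfolding gderiv_def by (rule has_derivative_continuous)

lemma GDERIV_imp_continuous_on: "(\<And>x. x \<in> S \<Longrightarrow> GDERIV f x :> f' x) \<Longrightarrow> continuous_on S f"
  by (meson GDERIV_imp_isCont continuous_at_imp_continuous_on)

lemma GDERIV_imp_directional:
  assumes "GDERIV f (x + t *\<^sub>R e) :> D"
  shows "((\<lambda>s. f (x + s *\<^sub>R e)) has_real_derivative D \<bullet> e) (at t)"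
proof -
  have 1: "((\<lambda>s. x + s *\<^sub>R e) has_derivative (\<lambda>s. s *\<^sub>R e)) (at t)"
    by (auto intro!: derivative_eq_intros)
  have "((\<lambda>s. f (x + s *\<^sub>R e)) has_derivative (\<lambda>s. (s *\<^sub>R e) \<bullet> D)) (at t)"
    using has_derivative_compose[OF 1, of f "\<lambda>h. h \<bullet> D"] assms by (simp add: gderiv_def)
  then show ?thesis by (simp add: has_field_derivative_def inner_commute mult_commute_abs)
qed

text \<open>Equal to \<open>1\<close> on \<open>cball z r\<close> and to \<open>0\<close> off \<open>ball z R\<close>; the squared norm avoids the
  singularity of the norm at \<open>z\<close>.\<close>

definition bump :: "'a::euclidean_space \<Rightarrow> real \<Rightarrow> real \<Rightarrow> 'a \<Rightarrow> real" where
  "bump z r R y = smooth_step ((R\<^sup>2 - (y - z) \<bullet> (y - z)) / (R\<^sup>2 - r\<^sup>2))"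

definition bump' :: "'a::euclidean_space \<Rightarrow> real \<Rightarrow> real \<Rightarrow> 'a \<Rightarrow> 'a" where
  "bump' z r R y = (smooth_step' ((R\<^sup>2 - (y - z) \<bullet> (y - z)) / (R\<^sup>2 - r\<^sup>2)) * (- 2 / (R\<^sup>2 - r\<^sup>2))) *\<^sub>R (y - z)"

lemma bump_GDERIV: "GDERIV (bump z r R) y :> bump' z r R y"
proof -
  have "GDERIV (\<lambda>y. (R\<^sup>2 - (y - z) \<bullet> (y - z)) / (R\<^sup>2 - r\<^sup>2)) y :> (- 2 / (R\<^sup>2 - r\<^sup>2)) *\<^sub>R (y - z)"
    unfolding gderiv_def
    by (auto intro!: derivative_eq_intros simp: inner_commute divide_inverse algebra_simps)
  from GDERIV_DERIV_compose[OF this smooth_step_DERIV] show ?thesis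
    unfolding bump_def[abs_def] bump'_def by simp
qed

lemma bump'_continuous [continuous_intros]: "continuous_on S (bump' z r R)"
  unfolding bump'_def[abs_def] by (auto intro!: continuous_intros simp: divide_inverse)

lemma bump_continuous [continuous_intros]: "continuous_on S (bump z r R)"
  using GDERIV_imp_continuous_on bump_GDERIV by blast

lemma bump_outside:
  assumes "0 < r" "r < R" "y \<notin> ball z R" shows "bump z r R y = 0" "bump' z r R y = 0"
proof -
  have "R\<^sup>2 \<le> (norm (y - z))\<^sup>2" using assms by (intro power_mono) (auto simp: dist_norm norm_minus_commute)
  moreover have "R\<^sup>2 - r\<^sup>2 > 0" using assms by (simp add: power_strict_mono)
  ultimately have "(R\<^sup>2 - (y - z) \<bullet> (y - z)) / (R\<^sup>2 - r\<^sup>2) \<le> 0"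
    by (simp add: divide_nonpos_pos flip: power2_norm_eq_inner)
  then show "bump z r R y = 0" "bump' z r R y = 0" by (auto simp: bump_def bump'_def smooth_step_simps)
qed

lemma bump_inside:
  assumes "0 < r" "r < R" "y \<in> cball z r" shows "bump z r R y = 1" "bump' z r R y = 0"
proof -
  have "(norm (y - z))\<^sup>2 \<le> r\<^sup>2" using assms by (intro power_mono) (auto simp: dist_norm norm_minus_commute)
  moreover have "R\<^sup>2 - r\<^sup>2 > 0" using assms by (simp add: power_strict_mono)
  ultimately have "(R\<^sup>2 - (y - z) \<bullet> (y - z)) / (R\<^sup>2 - r\<^sup>2) \<ge> 1"
    by (simp add: flip: power2_norm_eq_inner)
  then show "bump z r R y = 1" "bump' z r R y = 0" by (auto simp: bump_def bump'_def smooth_step_simps)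
qed

lemma bump_range: "0 \<le> bump z r R y" "bump z r R y \<le> 1"
  by (simp_all add: bump_def smooth_step_simps)

section \<open>Integration over bounded sets\<close>

lemma bounded_on_compact:
  fixes f :: "'a::topological_space \<Rightarrow> real"
  assumes "compact K" "continuous_on K f"
  obtains B where "B \<ge> 0" "\<And>x. x \<in> K \<Longrightarrow> \<bar>f x\<bar> \<le> B"
proof -
  have "bounded (f ` K)" using assms by (meson compact_continuous_image compact_imp_bounded)
  then obtain B where B: "\<forall>x\<in>K. \<bar>f x\<bar> \<le> B" unfolding bounded_iff by auto
  show ?thesis by (rule that[of "max B 0"]) (use B in force)+
qed

lemma has_integral_restrict_support:
  fixes f :: "'a::euclidean_space \<Rightarrow> real"
  assumes "\<And>x. x \<in> S - M \<Longrightarrow> f x = 0"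
  shows "(f has_integral y) (S \<inter> M) \<longleftrightarrow> (f has_integral y) S"
  using has_integral_restrict[of "S \<inter> M" S f y]
    has_integral_cong[of S "\<lambda>x. if x \<in> S \<inter> M then f x else 0" f y] assms
  by auto

lemma integrable_on_subset_of_compact:
  fixes f :: "'a::euclidean_space \<Rightarrow> 'b::euclidean_space"
  assumes "compact K" "S \<in> sets borel" "S \<subseteq> K" "continuous_on K f"
  shows "set_integrable lborel S f" "f integrable_on S"
proof -
  have "set_integrable lborel K f" unfolding set_integrable_def
    using assms by (intro borel_integrable_compact)
  then show "set_integrable lborel S f" using assms by (auto intro: set_integrable_subset)
  then show "f integrable_on S" by (rule set_borel_integral_eq_integral)
qed

text \<open>Fubini's theorem in the form needed for space-time integrals: \<open>S\<close> stands for a bounded piece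
  of a domain and \<open>K\<close> for a compact set on which the integrand remains continuous.\<close>

lemma integral_Times_swap:
  fixes G :: "real \<times> 'a::euclidean_space \<Rightarrow> real"
  assumes K: "compact K" "S \<in> sets borel" "S \<subseteq> K" and G: "continuous_on ({a..b} \<times> K) G"
  shows "(\<lambda>x. integral {a..b} (\<lambda>t. G (t, x))) integrable_on S"
    and "(\<lambda>t. integral S (\<lambda>x. G (t, x))) integrable_on {a..b}"
    and "integral S (\<lambda>x. integral {a..b} (\<lambda>t. G (t, x))) = integral {a..b} (\<lambda>t. integral S (\<lambda>x. G (t, x)))"
    and "integral ({a..b} \<times> S) G = integral {a..b} (\<lambda>t. integral S (\<lambda>x. G (t, x)))"
proof -
  define H where "H = (\<lambda>z. indicator ({a..b} \<times> S) z *\<^sub>R G z)"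
  have B: "{a..b} \<times> S \<in> sets borel" using K(2)
    by (metis atLeastAtMost_borel borel_Times)
  have I: "set_integrable lborel ({a..b} \<times> S) G"
    by (rule integrable_on_subset_of_compact[of "{a..b} \<times> K"]) (use K B G in \<open>auto intro: compact_Times\<close>)
  then have int: "integrable (lborel \<Otimes>\<^sub>M lborel) H"
    unfolding lborel_prod H_def set_integrable_def .
  have t: "integral S (\<lambda>x. G (t, x)) = (LINT x:S|lborel. G (t, x))" if "t \<in> {a..b}" for t
    by (rule set_borel_integral_eq_integral(2)[symmetric], rule integrable_on_subset_of_compact[OF K])
      (use that in \<open>auto intro!: continuous_intros continuous_on_compose2[OF G]\<close>)
  have x: "integral {a..b} (\<lambda>t. G (t, x)) = (LINT t:{a..b}|lborel. G (t, x))" if "x \<in> S" for x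
    by (rule set_borel_integral_eq_integral(2)[symmetric], rule integrable_on_subset_of_compact[OF compact_Icc])
      (use that K in \<open>auto intro!: continuous_intros continuous_on_compose2[OF G]\<close>)
  have Ht: "(\<integral>x. H (t, x) \<partial>lborel) = indicator {a..b} t *\<^sub>R integral S (\<lambda>x. G (t, x))" for t
    by (cases "t \<in> {a..b}") (auto simp: t H_def set_lebesgue_integral_def indicator_def intro!: Bochner_Integration.integral_cong)
  have Hx: "(\<integral>t. H (t, x) \<partial>lborel) = indicator S x *\<^sub>R integral {a..b} (\<lambda>t. G (t, x))" for x
    by (cases "x \<in> S") (auto simp: x H_def set_lebesgue_integral_def indicator_def intro!: Bochner_Integration.integral_cong)
  have i1: "set_integrable lborel {a..b} (\<lambda>t. integral S (\<lambda>x. G (t, x)))"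
    using lborel_pair.integrable_fst'[OF int] unfolding Ht set_integrable_def .
  have i2: "set_integrable lborel S (\<lambda>x. integral {a..b} (\<lambda>t. G (t, x)))"
    using lborel_pair.integrable_snd[of "\<lambda>t x. H (t, x)"] int unfolding Hx set_integrable_def by simp
  show "(\<lambda>x. integral {a..b} (\<lambda>t. G (t, x))) integrable_on S"
     "(\<lambda>t. integral S (\<lambda>x. G (t, x))) integrable_on {a..b}"
    using i1 i2 set_borel_integral_eq_integral by auto
  have e0: "integral ({a..b} \<times> S) G = integral\<^sup>L (lborel \<Otimes>\<^sub>M lborel) H"
    using set_borel_integral_eq_integral(2)[OF I] by (simp add: lborel_prod H_def set_lebesgue_integral_def)
  have e1: "integral {a..b} (\<lambda>t. integral S (\<lambda>x. G (t, x))) = integral\<^sup>L (lborel \<Otimes>\<^sub>M lborel) H"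
    using set_borel_integral_eq_integral(2)[OF i1] lborel_pair.integral_fst'[OF int]
    unfolding Ht set_lebesgue_integral_def by simp
  have e2: "integral S (\<lambda>x. integral {a..b} (\<lambda>t. G (t, x))) = integral\<^sup>L (lborel \<Otimes>\<^sub>M lborel) H"
    using set_borel_integral_eq_integral(2)[OF i2] lborel_pair.integral_snd[of "\<lambda>t x. H (t, x)"] int
    unfolding Hx set_lebesgue_integral_def by simp
  show "integral S (\<lambda>x. integral {a..b} (\<lambda>t. G (t, x))) = integral {a..b} (\<lambda>t. integral S (\<lambda>x. G (t, x)))"
    "integral ({a..b} \<times> S) G = integral {a..b} (\<lambda>t. integral S (\<lambda>x. G (t, x)))"
    using e0 e1 e2 by simp_all
qed

lemma integral_shift_UNIV:
  fixes f :: "'a::euclidean_space \<Rightarrow> real"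
  assumes "integrable lborel f"
  shows "integrable lborel (\<lambda>x. f (x + c))" "(\<integral>x. f (x + c) \<partial>lborel) = (\<integral>x. f x \<partial>lborel)"
proof -
  have m: "f \<in> borel_measurable borel" using assms by auto
  have "integrable (distr lborel borel ((+) c)) f" using assms by (simp add: lborel_distr_plus)
  then show "integrable lborel (\<lambda>x. f (x + c))"
    by (subst (asm) integrable_distr_eq) (use m in \<open>auto simp: add.commute\<close>)
  have "(\<integral>x. f x \<partial>lborel) = (\<integral>x. f x \<partial>distr lborel borel ((+) c))" by (simp add: lborel_distr_plus)
  also have "\<dots> = (\<integral>x. f (x + c) \<partial>lborel)"
    by (subst integral_distr) (use m in \<open>auto simp: add.commute\<close>)
  finally show "(\<integral>x. f (x + c) \<partial>lborel) = (\<integral>x. f x \<partial>lborel)" by simp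
qed

text \<open>The divergence theorem for compactly supported functions. By translation invariance the
  difference quotients \<open>(f (x + h e) - f x) / h\<close> have integral \<open>0\<close>; they are bounded by the supremum
  of \<open>f'\<close> and converge to it, so dominated convergence applies.\<close>

lemma integral_directional_derivative_eq_0:
  fixes f f' :: "'a::euclidean_space \<Rightarrow> real"
  assumes C: "compact C" and f0: "\<And>x. x \<notin> C \<Longrightarrow> f x = 0"
    and D: "\<And>x. ((\<lambda>s. f (x + s *\<^sub>R e)) has_real_derivative f' x) (at 0)"
    and cf: "continuous_on UNIV f" and cf': "continuous_on UNIV f'"
  shows "(f' has_integral 0) UNIV"
proof -
  have cC: "closed C" using C by (rule compact_imp_closed)
  have f'0: "f' x = 0" if "x \<notin> C" for x
  proof -
    have "((\<lambda>s. x + s *\<^sub>R e) \<longlongrightarrow> x + 0 *\<^sub>R e) (at 0)" by (intro tendsto_intros)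
    then have "((\<lambda>s. x + s *\<^sub>R e) \<longlongrightarrow> x) (at 0)" by simp
    from topological_tendstoD[OF this, of "- C"] have "\<forall>\<^sub>F s in at 0. x + s *\<^sub>R e \<notin> C"
      using cC that by auto
    then have "\<forall>\<^sub>F s in nhds 0. x + s *\<^sub>R e \<notin> C" using that by (simp add: eventually_nhds_conv_at)
    then have "\<forall>\<^sub>F s in nhds 0. f (x + s *\<^sub>R e) = 0" by eventually_elim (rule f0)
    then have "((\<lambda>s. f (x + s *\<^sub>R e)) has_real_derivative 0) (at 0)"
      by (subst DERIV_cong_ev[of _ 0 _ "\<lambda>_. 0"]) auto
    then show ?thesis using D DERIV_unique by blast
  qed
  have Dl: "((\<lambda>s. f (x + s *\<^sub>R e)) has_real_derivative f' (x + t *\<^sub>R e)) (at t)" for x t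
    using D[of "x + t *\<^sub>R e"] DERIV_shift[of "\<lambda>s. f (x + s *\<^sub>R e)" _ 0 t] by (simp add: algebra_simps)
  obtain M where M: "\<And>x. norm (f' x) \<le> M"
  proof -
    have "bounded (f' ` C)" using C cf' by (meson compact_continuous_image compact_imp_bounded continuous_on_subset subset_UNIV)
    then obtain M where M: "\<And>x. x \<in> C \<Longrightarrow> norm (f' x) \<le> M" unfolding bounded_iff by auto
    have "norm (f' x) \<le> max M 0" for x using M[of x] f'0[of x] by (cases "x \<in> C") auto
    then show ?thesis using that by blast
  qed
  have M0: "M \<ge> 0" using M[of 0] norm_ge_zero order_trans by blast
  define h where "h n = 1 / (real n + 1)" for n
  have h: "0 < h n" "h n \<le> 1" for n unfolding h_def by (auto simp: field_simps)
  define k where "k n x = (f (x + h n *\<^sub>R e) - f x) / h n" for n x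
  \<comment> \<open>All difference quotients with step at most \<open>1\<close> are supported in \<open>C'\<close>.\<close>
  define C' where "C' = (\<lambda>(c, s). c + s *\<^sub>R e) ` (C \<times> {-1..0})"
  have C': "compact C'" unfolding C'_def
    by (intro compact_continuous_image compact_Times C compact_Icc) (auto simp: case_prod_beta intro!: continuous_intros)
  have in1: "x \<in> C'" if "x \<in> C" for x using that unfolding C'_def by (force intro: image_eqI[of _ _ "(x, 0)"])
  have in2: "x \<in> C'" if "x + s *\<^sub>R e \<in> C" "0 \<le> s" "s \<le> 1" for x s
    using that unfolding C'_def by (intro image_eqI[of _ _ "(x + s *\<^sub>R e, -s)"]) auto
  have ki: "norm (k n x) \<le> indicator C' x * M" for n x
  proof (cases "x \<in> C'")
    case True
    obtain z where "f (x + h n *\<^sub>R e) - f (x + 0 *\<^sub>R e) = (h n - 0) * f' (x + z *\<^sub>R e)"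
      using MVT2[OF h(1)[of n], of "\<lambda>s. f (x + s *\<^sub>R e)" "\<lambda>s. f' (x + s *\<^sub>R e)"] Dl by blast
    then have "k n x = f' (x + z *\<^sub>R e)" unfolding k_def using h[of n] by simp
    then show ?thesis using M True by simp
  next
    case False
    then have "x \<notin> C" "x + h n *\<^sub>R e \<notin> C" using in1 in2[of x "h n"] h[of n] by auto
    then show ?thesis using f0 M0 unfolding k_def by simp
  qed
  have icont: "integrable lborel g" if "continuous_on UNIV g" "\<And>x. x \<notin> C \<Longrightarrow> g x = 0" for g :: "'a \<Rightarrow> real"
  proof -
    have "integrable lborel (\<lambda>x. indicator C x *\<^sub>R g x)"
      using C that(1) by (intro borel_integrable_compact) (auto intro: continuous_on_subset)
    moreover have "indicator C x *\<^sub>R g x = g x" for x using that(2)[of x] by (cases "x \<in> C") auto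
    ultimately show ?thesis by (simp only:)
  qed
  note intf = icont[OF cf f0]
  note intf' = icont[OF cf' f'0]
  have zero: "(\<integral>x. k n x \<partial>lborel) = 0" for n
    unfolding k_def using integral_shift_UNIV[OF intf, of "h n *\<^sub>R e"] intf by simp
  have "(\<lambda>n. \<integral>x. k n x \<partial>lborel) \<longlonglongrightarrow> (\<integral>x. f' x \<partial>lborel)"
  proof (rule integral_dominated_convergence[where w = "\<lambda>x. indicator C' x * M"])
    show "f' \<in> borel_measurable lborel" using intf' by auto
    show "k n \<in> borel_measurable lborel" for n
      unfolding k_def using intf integral_shift_UNIV[OF intf, of "h n *\<^sub>R e"] by auto
    show "integrable lborel (\<lambda>x. indicator C' x * M)"
      using borel_integrable_compact[OF C', of "\<lambda>_. M"] by simp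
    show "AE x in lborel. norm (k n x) \<le> indicator C' x * M" for n using ki by auto
    have "(\<lambda>n. k n x) \<longlonglongrightarrow> f' x" for x
    proof -
      have "(\<lambda>s. (f (x + s *\<^sub>R e) - f x) / s) \<midarrow>0\<rightarrow> f' x" using D[of x] by (simp add: DERIV_def)
      moreover have "filterlim h (at 0) sequentially"
        unfolding filterlim_at
      proof
        show "h \<longlonglongrightarrow> 0" unfolding h_def using LIMSEQ_inverse_real_of_nat by (simp add: inverse_eq_divide add.commute)
      qed (use h in \<open>auto simp: less_imp_neq[symmetric]\<close>)
      ultimately show ?thesis unfolding k_def by (rule filterlim_compose)
    qed
    then show "AE x in lborel. (\<lambda>n. k n x) \<longlonglongrightarrow> f' x" by auto
  qed
  then have "(\<integral>x. f' x \<partial>lborel) = 0" unfolding zero by (simp add: LIMSEQ_const_iff)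
  then show ?thesis using has_integral_integral_lborel[OF intf'] by simp
qed

lemma integrable_on_UNIV_compact_support:
  fixes f :: "'a::euclidean_space \<Rightarrow> real"
  assumes "compact C" "continuous_on UNIV f" "\<And>x. x \<notin> C \<Longrightarrow> f x = 0"
  shows "f integrable_on UNIV"
proof -
  have "f integrable_on C"
    using integrable_on_subset_of_compact(2)[of C C f] assms
    by (meson borel_compact continuous_on_subset order_refl subset_UNIV)
  then show ?thesis by (rule integrable_on_superset) (use assms in auto)
qed

section \<open>Thin layers around level sets\<close>

text \<open>The layer \<open>{\<kappa> < g < \<kappa> + \<delta>}\<close> has volume \<open>O(\<delta>)\<close> where \<open>g\<close> increases at least with slope \<open>c\<close> in
  the direction \<open>e\<close>. Here \<open>smooth_step' ((g - \<kappa>) / \<delta>)\<close> replaces the indicator of the layer: up to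
  the factor \<open>G \<bullet> e / \<delta> \<ge> c / \<delta>\<close> it is the derivative along \<open>e\<close> of a function with values in
  \<open>[0, 1]\<close>, and integration by parts against a bump moves this derivative to the bump. The constant
  is therefore independent of \<open>\<kappa>\<close> and \<open>\<delta>\<close>.\<close>

lemma strip_estimate:
  fixes g :: "'a::euclidean_space \<Rightarrow> real"
  assumes U: "open U" "cball z R \<subseteq> U" and r: "0 < r" "r < R" and c: "c > 0"
    and g: "\<And>y. y \<in> U \<Longrightarrow> GDERIV g y :> G y" and G: "continuous_on U G"
    and Ge: "\<And>y. y \<in> cball z R \<Longrightarrow> c \<le> G y \<bullet> e"
  obtains C where "\<And>\<kappa> \<delta>. \<delta> > 0 \<Longrightarrow> integral (cball z r) (\<lambda>y. smooth_step' ((g y - \<kappa>) / \<delta>)) \<le> C * \<delta>"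
proof -
  \<comment> \<open>The mass of the term in which the derivative has moved to the bump.\<close>
  define C where "C = integral UNIV (\<lambda>y. \<bar>bump' z r R y \<bullet> e\<bar>)"
  have cg: "continuous_on U g" using g by (rule GDERIV_imp_continuous_on)
  have off: "bump z r R y = 0" "bump' z r R y = 0" if "y \<notin> cball z R" for y
    using bump_outside[OF r, of y z] that by auto
  have "integral (cball z r) (\<lambda>y. smooth_step' ((g y - \<kappa>) / \<delta>)) \<le> (C / c) * \<delta>" if \<delta>: "\<delta> > 0" for \<kappa> \<delta>
  proof -
    \<comment> \<open>The two terms of the derivative along \<open>e\<close> of \<open>bump \<cdot> smooth_step ((g - \<kappa>) / \<delta>)\<close>.\<close>
    define a where "a y = smooth_step ((g y - \<kappa>) / \<delta>) * (bump' z r R y \<bullet> e)" for y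
    define b where "b y = bump z r R y * smooth_step' ((g y - \<kappa>) / \<delta>) * (G y \<bullet> e) / \<delta>" for y
    have ca: "continuous_on UNIV a"
      by (rule continuous_on_extend_0[of U "cball z R"])
        (use U \<delta> off in \<open>auto simp: a_def[abs_def] divide_inverse intro!: continuous_intros cg\<close>)
    have cb: "continuous_on UNIV b"
      by (rule continuous_on_extend_0[of U "cball z R"])
        (use U \<delta> off in \<open>auto simp: b_def[abs_def] divide_inverse intro!: continuous_intros cg G\<close>)
    have cf: "continuous_on UNIV (\<lambda>y. bump z r R y * smooth_step ((g y - \<kappa>) / \<delta>))"
      by (rule continuous_on_extend_0[of U "cball z R"])
        (use U \<delta> off in \<open>auto simp: divide_inverse intro!: continuous_intros cg\<close>)
    have ia: "a integrable_on UNIV"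
      by (rule integrable_on_UNIV_compact_support[OF compact_cball[of z R] ca]) (simp add: a_def off)
    have ib: "b integrable_on UNIV"
      by (rule integrable_on_UNIV_compact_support[OF compact_cball[of z R] cb]) (simp add: b_def off)
    have D: "((\<lambda>s. bump z r R (y + s *\<^sub>R e) * smooth_step ((g (y + s *\<^sub>R e) - \<kappa>) / \<delta>)) has_real_derivative a y + b y) (at 0)" for y
    proof -
      have "GDERIV (\<lambda>y. bump z r R y * smooth_step ((g y - \<kappa>) / \<delta>)) y :>
        smooth_step ((g y - \<kappa>) / \<delta>) *\<^sub>R bump' z r R y + (bump z r R y * smooth_step' ((g y - \<kappa>) / \<delta>) / \<delta>) *\<^sub>R G y"
      proof (rule GDERIV_extend_0[of "cball z R"])
        fix y assume "y \<in> cball z R"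
        then have "y \<in> U" using U by auto
        have "GDERIV (\<lambda>y. smooth_step ((g y - \<kappa>) / \<delta>)) y :> (smooth_step' ((g y - \<kappa>) / \<delta>) * (1 / \<delta>)) *\<^sub>R G y"
          by (rule GDERIV_DERIV_compose[OF g[OF \<open>y \<in> U\<close>], of "\<lambda>s. smooth_step ((s - \<kappa>) / \<delta>)"],
            rule DERIV_chain'[OF _ smooth_step_DERIV])
            (use \<delta> in \<open>auto intro!: derivative_eq_intros\<close>)
        from GDERIV_mult[OF bump_GDERIV this]
        show "GDERIV (\<lambda>y. bump z r R y * smooth_step ((g y - \<kappa>) / \<delta>)) y :>
          smooth_step ((g y - \<kappa>) / \<delta>) *\<^sub>R bump' z r R y + (bump z r R y * smooth_step' ((g y - \<kappa>) / \<delta>) / \<delta>) *\<^sub>R G y"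
          by (simp add: algebra_simps)
      qed (use off in auto)
      then have "((\<lambda>s. bump z r R (y + s *\<^sub>R e) * smooth_step ((g (y + s *\<^sub>R e) - \<kappa>) / \<delta>)) has_real_derivative
        (smooth_step ((g y - \<kappa>) / \<delta>) *\<^sub>R bump' z r R y + (bump z r R y * smooth_step' ((g y - \<kappa>) / \<delta>) / \<delta>) *\<^sub>R G y) \<bullet> e) (at 0)"
        using GDERIV_imp_directional[of "\<lambda>y. bump z r R y * smooth_step ((g y - \<kappa>) / \<delta>)" y 0 e] by simp
      then show ?thesis by (simp add: a_def b_def inner_add_left)
    qed
    have "((\<lambda>y. a y + b y) has_integral 0) UNIV"
      by (rule integral_directional_derivative_eq_0[OF compact_cball[of z R] _ D cf])
        (use off ca cb in \<open>auto intro!: continuous_intros\<close>)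
    then have ab: "integral UNIV a + integral UNIV b = 0"
      using integral_add[OF ia ib] by (simp add: integral_unique)
    have "c * integral (cball z r) (\<lambda>y. smooth_step' ((g y - \<kappa>) / \<delta>)) / \<delta>
       = integral (cball z r) (\<lambda>y. c / \<delta> * smooth_step' ((g y - \<kappa>) / \<delta>))" by simp
    also have "\<dots> \<le> integral (cball z r) b"
    proof (rule integral_le)
      have "continuous_on (cball z r) g" using cg U r by (rule_tac continuous_on_subset[OF cg]) auto
      then show "(\<lambda>y. c / \<delta> * smooth_step' ((g y - \<kappa>) / \<delta>)) integrable_on cball z r"
        by (intro integrable_on_subset_of_compact(2)[OF compact_cball[of z r]])
          (use \<delta> in \<open>auto simp: divide_inverse intro!: continuous_intros\<close>)
      show "b integrable_on cball z r"
        by (intro integrable_on_subset_of_compact(2)[OF compact_cball[of z r]])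
          (use cb in \<open>auto intro: continuous_on_subset\<close>)
      fix y assume y: "y \<in> cball z r"
      then have "c \<le> G y \<bullet> e" using r by (intro Ge) auto
      then have "c * smooth_step' ((g y - \<kappa>) / \<delta>) \<le> (G y \<bullet> e) * smooth_step' ((g y - \<kappa>) / \<delta>)"
        using smooth_step_simps(7) by (rule mult_right_mono)
      then show "c / \<delta> * smooth_step' ((g y - \<kappa>) / \<delta>) \<le> b y"
        using \<delta> bump_inside[OF r y] by (simp add: b_def field_simps)
    qed
    also have "\<dots> \<le> integral UNIV b"
    proof (rule integral_subset_le)
      show "b integrable_on cball z r"
        by (intro integrable_on_subset_of_compact(2)[OF compact_cball[of z r]])
          (use cb in \<open>auto intro: continuous_on_subset\<close>)
      have "0 \<le> b y" for y
      proof (cases "y \<in> cball z R")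
        case True
        then have "0 \<le> G y \<bullet> e" using Ge[OF True] c by linarith
        then show ?thesis using \<delta> bump_range[of z r R y] smooth_step_simps(7) by (simp add: b_def)
      qed (simp add: b_def off)
      then show "\<forall>y\<in>UNIV. 0 \<le> b y" by blast
    qed (use ib in auto)
    also have "\<dots> = integral UNIV (\<lambda>y. - a y)" using ab ia by simp
    also have "\<dots> \<le> C" unfolding C_def
    proof (rule integral_le)
      show "(\<lambda>y. \<bar>bump' z r R y \<bullet> e\<bar>) integrable_on UNIV"
        by (rule integrable_on_UNIV_compact_support[OF compact_cball[of z R]])
         (use off in \<open>auto intro!: continuous_intros\<close>)
      fix y
      have "\<bar>a y\<bar> \<le> 1 * \<bar>bump' z r R y \<bullet> e\<bar>" unfolding a_def abs_mult
        using smooth_step_simps(3,4)[of "(g y - \<kappa>) / \<delta>"] by (intro mult_right_mono) auto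
      then show "- a y \<le> \<bar>bump' z r R y \<bullet> e\<bar>" by linarith
    qed (rule integrable_neg[OF ia])
    finally show ?thesis using c \<delta> by (simp add: field_simps)
  qed
  then show ?thesis by (rule that)
qed

text \<open>Near a zero with nonzero gradient the zero set lies in layers \<open>{|\<psi>| < \<delta> / 2}\<close> of volume
  \<open>O(\<delta>)\<close> for every \<open>\<delta>\<close>, so it is locally, hence globally, negligible.\<close>

lemma negligible_zeros_with_nonzero_gradient:
  fixes \<psi> :: "'a::euclidean_space \<Rightarrow> real"
  assumes \<Omega>: "open \<Omega>" and \<psi>: "\<And>y. y \<in> \<Omega> \<Longrightarrow> GDERIV \<psi> y :> X y" and X: "continuous_on \<Omega> X"
  shows "negligible {y \<in> \<Omega>. \<psi> y = 0 \<and> X y \<noteq> 0}" (is "negligible ?Z")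
proof (subst locally_negligible_alt, intro ballI)
  fix x assume x: "x \<in> ?Z"
  define e where "e = X x"
  define c where "c = (e \<bullet> e) / 2"
  have c: "c > 0" using x by (simp add: c_def e_def)
  have "isCont (\<lambda>y. X y \<bullet> e) x"
    using X x \<Omega> by (intro continuous_intros) (auto simp: continuous_on_eq_continuous_at)
  then have lim: "((\<lambda>y. X y \<bullet> e) \<longlongrightarrow> X x \<bullet> e) (nhds x)"
    unfolding continuous_at by (rule iffD1[OF tendsto_at_iff_tendsto_nhds[of "\<lambda>y. X y \<bullet> e" x]])
  have "X x \<bullet> e > c" using c by (simp add: c_def e_def)
  with lim have "\<forall>\<^sub>F y in nhds x. X y \<bullet> e > c" by (rule order_tendstoD(1))
  moreover have "\<forall>\<^sub>F y in nhds x. y \<in> \<Omega>" using x \<Omega> by (intro eventually_nhds_in_open) auto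
  ultimately have "\<forall>\<^sub>F y in nhds x. X y \<bullet> e > c \<and> y \<in> \<Omega>" by (rule eventually_conj)
  then obtain R' where R': "R' > 0" "\<And>y. dist y x < R' \<Longrightarrow> X y \<bullet> e > c \<and> y \<in> \<Omega>"
    unfolding eventually_nhds_metric by auto
  define R where "R = R' / 2"
  define r where "r = R / 2"
  have r: "0 < r" "r < R" using R' by (auto simp: r_def R_def)
  have R: "y \<in> \<Omega>" "c \<le> X y \<bullet> e" if "y \<in> cball x R" for y
    using R'(2)[of y] R'(1) that by (auto simp: R_def dist_commute)
  obtain C where C: "\<And>\<kappa> \<delta>. \<delta> > 0 \<Longrightarrow> integral (cball x r) (\<lambda>y. smooth_step' ((\<psi> y - \<kappa>) / \<delta>)) \<le> C * \<delta>"
    using strip_estimate[OF \<Omega> _ r c \<psi> X, of x e] R by (metis subsetI)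
  define T where "T = {y \<in> cball x r. \<psi> y = 0}"
  have sub: "cball x r \<subseteq> \<Omega>" using R r by auto
  have c\<psi>: "continuous_on (cball x r) \<psi>"
    using GDERIV_imp_continuous_on[of \<Omega> \<psi> X] \<psi> sub continuous_on_subset by blast
  have cT: "closed T" unfolding T_def using c\<psi>
    by (metis closed_cball continuous_closed_preimage_constant)
  have T: "T \<in> lmeasurable" using cT
    by (intro lmeasurable_compact) (auto simp: compact_eq_bounded_closed T_def intro: bounded_subset[OF bounded_cball])
  have m: "2 * measure lebesgue T \<le> C * \<delta>" if "\<delta> > 0" for \<delta>
  proof -
    have "integral T (\<lambda>_. 2 * 1) = 2 * integral T (\<lambda>_. 1::real)" by (rule integral_mult_right)
    then have "2 * measure lebesgue T = integral T (\<lambda>_. 2)"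
      unfolding lmeasure_integral[OF T] by (simp only: mult_1_right)
    \<comment> \<open>With \<open>\<kappa> = - \<delta> / 2\<close> the zeros of \<open>\<psi>\<close> sit at the midpoint of the step, where its slope is \<open>2\<close>.\<close>
    also have "\<dots> = integral T (\<lambda>y. smooth_step' ((\<psi> y - (- \<delta> / 2)) / \<delta>))"
    proof (rule integral_cong)
      fix y assume "y \<in> T"
      then have "(\<psi> y - (- \<delta> / 2)) / \<delta> = 1 / 2" using that by (simp add: T_def)
      then show "2 = smooth_step' ((\<psi> y - (- \<delta> / 2)) / \<delta>)" by (simp only: smooth_step_simps(8))
    qed
    also have "\<dots> \<le> integral (cball x r) (\<lambda>y. smooth_step' ((\<psi> y - (- \<delta> / 2)) / \<delta>))"
    proof (rule integral_subset_le)
      have "continuous_on (cball x r) (\<lambda>y. smooth_step' ((\<psi> y - (- \<delta> / 2)) / \<delta>))"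
        using that by (intro continuous_intros c\<psi>) auto
      note int = integrable_on_subset_of_compact(2)[OF compact_cball _ _ this]
      show "(\<lambda>y. smooth_step' ((\<psi> y - (- \<delta> / 2)) / \<delta>)) integrable_on T"
        by (rule int) (use cT in \<open>auto simp: T_def intro: borel_closed\<close>)
      show "(\<lambda>y. smooth_step' ((\<psi> y - (- \<delta> / 2)) / \<delta>)) integrable_on cball x r"
        by (rule int) auto
      show "\<forall>y\<in>cball x r. 0 \<le> smooth_step' ((\<psi> y - (- \<delta> / 2)) / \<delta>)"
        using smooth_step_simps(7) by blast
    qed (auto simp: T_def)
    also have "\<dots> \<le> C * \<delta>" using that by (rule C)
    finally show ?thesis .
  qed
  have "measure lebesgue T \<le> 0"
  proof (rule ccontr)
    assume "\<not> ?thesis"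
    then have p: "measure lebesgue T > 0" by simp
    have "C / (\<bar>C\<bar> + 1) * measure lebesgue T \<le> 1 * measure lebesgue T"
      using p by (intro mult_right_mono) auto
    then show False using m[of "measure lebesgue T / (\<bar>C\<bar> + 1)"] p by simp
  qed
  then have "negligible T" using T by (simp add: negligible_iff_measure measure_le_0_iff)
  then have "negligible (?Z \<inter> ball x r)" by (rule negligible_subset) (auto simp: T_def)
  moreover have "openin (top_of_set ?Z) (?Z \<inter> ball x r)" by (simp add: openin_open_Int)
  ultimately show "\<exists>U. openin (top_of_set ?Z) U \<and> x \<in> U \<and> negligible U"
    using x r by (intro exI[of _ "?Z \<inter> ball x r"]) auto
qed

section \<open>The weak form and its extension up to the boundary\<close>

text \<open>\<open>Y\<close> is the gradient of \<open>\<eta>\<close>. The compact set that carries both is a parameter, so that it can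
  be required to lie in a domain.\<close>

definition test_function :: "'a::euclidean_space set \<Rightarrow> ('a \<Rightarrow> real) \<Rightarrow> ('a \<Rightarrow> 'a) \<Rightarrow> bool" where
  "test_function C \<eta> Y \<longleftrightarrow> compact C \<and> continuous_on UNIV Y \<and> (\<forall>x. GDERIV \<eta> x :> Y x) \<and>
     (\<forall>x. x \<notin> C \<longrightarrow> \<eta> x = 0 \<and> Y x = 0)"

text \<open>This is \<open>div P = q\<close> in \<open>\<Omega>\<close> tested with \<open>\<psi>\<close>, where \<open>X\<close> is the gradient of \<open>\<psi>\<close>. For \<open>\<psi>\<close> that
  does not vanish on the boundary it also says that the normal component of \<open>P\<close> is zero there.\<close>

definition weak_form :: "'a::euclidean_space set \<Rightarrow> ('a \<Rightarrow> 'a) \<Rightarrow> ('a \<Rightarrow> real) \<Rightarrow> ('a \<Rightarrow> real) \<Rightarrow> ('a \<Rightarrow> 'a) \<Rightarrow> bool" where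
  "weak_form \<Omega> P q \<psi> X \<longleftrightarrow> ((\<lambda>x. P x \<bullet> X x + q x * \<psi> x) has_integral 0) \<Omega>"

text \<open>\<open>\<psi>\<close> is \<open>C\<^sup>1\<close> up to the boundary of \<open>\<Omega>\<close> with gradient \<open>X\<close>; the support \<open>M\<close> may meet the
  boundary.\<close>

definition C1_supported :: "'a::euclidean_space set \<Rightarrow> 'a set \<Rightarrow> ('a \<Rightarrow> real) \<Rightarrow> ('a \<Rightarrow> 'a) \<Rightarrow> bool" where
  "C1_supported \<Omega> M \<psi> X \<longleftrightarrow> continuous_on (closure \<Omega>) \<psi> \<and> continuous_on (closure \<Omega>) X \<and>
     (\<forall>x\<in>\<Omega>. GDERIV \<psi> x :> X x) \<and> (\<forall>x\<in>\<Omega> - M. \<psi> x = 0 \<and> X x = 0)"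

text \<open>The equation \<open>div P = q\<close> in the sense of distributions in the interior of \<open>\<Omega> \<inter> N\<close>, for fields
  \<open>P\<close> and \<open>q\<close> that are continuous up to the boundary of \<open>\<Omega>\<close>.\<close>

locale weak_solution =
  fixes \<Omega> N :: "'a::euclidean_space set" and P :: "'a \<Rightarrow> 'a" and q :: "'a \<Rightarrow> real"
  assumes open_domain: "open \<Omega>" and compact_N: "compact N"
    and P_cont: "continuous_on (closure \<Omega> \<inter> N) P" and q_cont: "continuous_on (closure \<Omega> \<inter> N) q"
    and weak: "\<And>C \<eta> Y. test_function C \<eta> Y \<Longrightarrow> C \<subseteq> \<Omega> \<inter> N \<Longrightarrow> weak_form \<Omega> P q \<eta> Y"
begin

text \<open>The common start of both extensions: if \<open>d \<le> 0\<close> on the boundary, the product of \<open>\<psi>\<close> with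
  \<open>smooth_step (d / \<delta> - 1)\<close> lives on the compact set \<open>{d \<ge> \<delta>}\<close> inside \<open>\<Omega>\<close> and may be used as a
  test function. The second summand comes from the gradient of the cutoff; it must be shown to
  disappear as \<open>\<delta> \<rightarrow> 0\<close>.\<close>

lemma cutoff_identity:
  assumes \<psi>: "C1_supported \<Omega> M \<psi> X" and M: "compact M" "M \<subseteq> N" "M \<subseteq> V" and V: "open V"
    and d: "\<And>x. x \<in> \<Omega> \<inter> V \<Longrightarrow> GDERIV d x :> D x" and D: "continuous_on (\<Omega> \<inter> V) D"
    and cd: "continuous_on (closure \<Omega> \<inter> M) d" and bd: "\<And>x. x \<in> frontier \<Omega> \<inter> M \<Longrightarrow> d x \<le> 0"
    and \<delta>: "\<delta> > 0"
  shows "((\<lambda>x. smooth_step (d x / \<delta> - 1) * (P x \<bullet> X x + q x * \<psi> x) + \<psi> x * smooth_step' (d x / \<delta> - 1) / \<delta> * (P x \<bullet> D x))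
           has_integral 0) \<Omega>"
proof -
  note [simp] = open_domain V
  define C where "C = {x \<in> closure \<Omega> \<inter> M. \<delta> \<le> d x}"
  define \<eta> where "\<eta> x = (if x \<in> C then \<psi> x * smooth_step (d x / \<delta> - 1) else 0)" for x
  define Y where "Y x = (if x \<in> C then smooth_step (d x / \<delta> - 1) *\<^sub>R X x + (\<psi> x * smooth_step' (d x / \<delta> - 1) / \<delta>) *\<^sub>R D x else 0)" for x
  have G: "\<And>x. x \<in> \<Omega> \<Longrightarrow> GDERIV \<psi> x :> X x" "\<And>x. x \<in> \<Omega> - M \<Longrightarrow> \<psi> x = 0 \<and> X x = 0"
    and cX: "continuous_on (closure \<Omega>) X" "continuous_on (closure \<Omega>) \<psi>"
    using \<psi> by (auto simp: C1_supported_def)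
  have clM: "closed M" using M compact_imp_closed by auto
  have "compact (closure \<Omega> \<inter> M)" using M by (metis compact_Int_closed closed_closure Int_commute)
  have "closed C"
  proof -
    have "C = (closure \<Omega> \<inter> M) \<inter> d -` {\<delta>..}" by (auto simp: C_def)
    then show ?thesis using continuous_closed_preimage[OF cd, of "{\<delta>..}"] clM by auto
  qed
  then have C: "compact C" using \<open>compact (closure \<Omega> \<inter> M)\<close>
    by (metis (no_types, lifting) C_def compact_Int_closed inf.absorb_iff2 mem_Collect_eq subsetI)
  have Cs: "C \<subseteq> \<Omega> \<inter> M"
  proof
    fix x assume x: "x \<in> C"
    then have "x \<notin> frontier \<Omega>" using bd[of x] \<delta> by (auto simp: C_def)
    then show "x \<in> \<Omega> \<inter> M" using x by (auto simp: C_def frontier_def interior_open)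
  qed
  have in\<Omega>: "\<eta> x = \<psi> x * smooth_step (d x / \<delta> - 1)"
    "Y x = smooth_step (d x / \<delta> - 1) *\<^sub>R X x + (\<psi> x * smooth_step' (d x / \<delta> - 1) / \<delta>) *\<^sub>R D x" if "x \<in> \<Omega>" for x
  proof -
    have "\<psi> x = 0 \<and> X x = 0 \<or> smooth_step (d x / \<delta> - 1) = 0 \<and> smooth_step' (d x / \<delta> - 1) = 0" if "x \<notin> C"
    proof (cases "x \<in> M")
      case True
      then have "d x < \<delta>" using \<open>x \<in> \<Omega>\<close> that closure_subset by (force simp: C_def)
      then show ?thesis using \<delta> by (simp add: smooth_step_simps)
    qed (use G \<open>x \<in> \<Omega>\<close> in auto)
    then show "\<eta> x = \<psi> x * smooth_step (d x / \<delta> - 1)"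
      "Y x = smooth_step (d x / \<delta> - 1) *\<^sub>R X x + (\<psi> x * smooth_step' (d x / \<delta> - 1) / \<delta>) *\<^sub>R D x"
      by (auto simp: \<eta>_def Y_def)
  qed
  have "test_function C \<eta> Y"
    unfolding test_function_def
  proof (intro conjI allI impI)
    show "GDERIV \<eta> x :> Y x" for x
    proof (rule GDERIV_extend_0[OF \<open>closed C\<close>])
      fix x assume "x \<in> C"
      then have x: "x \<in> \<Omega> \<inter> V" using Cs M by auto
      have st: "GDERIV (\<lambda>y. smooth_step (d y / \<delta> - 1)) x :> (smooth_step' (d x / \<delta> - 1) * (1 / \<delta>)) *\<^sub>R D x"
        by (rule GDERIV_DERIV_compose[OF d[OF x], of "\<lambda>s. smooth_step (s / \<delta> - 1)"],
            rule DERIV_chain'[OF _ smooth_step_DERIV])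
            (use \<delta> in \<open>auto intro!: derivative_eq_intros\<close>)
      then have "GDERIV (\<lambda>y. \<psi> y * smooth_step (d y / \<delta> - 1)) x :> Y x"
        using GDERIV_mult[OF G(1)[of x] st] x in\<Omega>(2)[of x] by (simp add: algebra_simps)
      then show "GDERIV \<eta> x :> Y x"
        by (rule GDERIV_transform_open[of _ _ _ \<Omega>]) (use x in\<Omega> in auto)
    qed (auto simp: \<eta>_def Y_def)
    have c: "continuous_on (\<Omega> \<inter> V) X" "continuous_on (\<Omega> \<inter> V) \<psi>" "continuous_on (\<Omega> \<inter> V) d"
      using cX closure_subset[of \<Omega>] d GDERIV_imp_continuous_on[of "\<Omega> \<inter> V" d D]
      by (auto elim!: continuous_on_subset)
    have "continuous_on (\<Omega> \<inter> V) (\<lambda>x. smooth_step (d x / \<delta> - 1) *\<^sub>R X x + (\<psi> x * smooth_step' (d x / \<delta> - 1) / \<delta>) *\<^sub>R D x)"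
      using \<delta> by (auto simp: divide_inverse intro!: continuous_intros c D)
    then have "continuous_on (\<Omega> \<inter> V) Y"
      by (subst continuous_on_cong[OF refl, of _ _ "\<lambda>x. smooth_step (d x / \<delta> - 1) *\<^sub>R X x + (\<psi> x * smooth_step' (d x / \<delta> - 1) / \<delta>) *\<^sub>R D x"]) (simp add: in\<Omega>)
    then show "continuous_on UNIV Y"
      by (rule continuous_on_extend_0[of "\<Omega> \<inter> V" C, rotated 3]) (use \<open>closed C\<close> Cs M in \<open>auto simp: Y_def open_Int\<close>)
  qed (use C in \<open>auto simp: \<eta>_def Y_def\<close>)
  then have "weak_form \<Omega> P q \<eta> Y" by (rule weak) (use Cs M in auto)
  then show ?thesis unfolding weak_form_def
    by (rule has_integral_eq[rotated]) (simp add: in\<Omega> inner_add_right algebra_simps)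
qed

text \<open>Away from the boundary the constant \<open>d = 1\<close> serves as a cutoff that changes nothing.\<close>

lemma weak_form_interior:
  assumes \<psi>: "C1_supported \<Omega> M \<psi> X" and M: "compact M" "M \<subseteq> N" "M \<inter> frontier \<Omega> = {}"
  shows "weak_form \<Omega> P q \<psi> X"
  using cutoff_identity[OF \<psi> M(1,2) subset_UNIV open_UNIV, of "\<lambda>_. 1" "\<lambda>_. 0" "1/2"] M
  by (auto simp: weak_form_def GDERIV_const smooth_step_simps)

lemma region_facts:
  assumes "compact M" "M \<subseteq> N"
  shows "compact (closure \<Omega> \<inter> M)" "\<Omega> \<inter> M \<in> sets borel" "\<Omega> \<inter> M \<subseteq> closure \<Omega> \<inter> M"
    "continuous_on (closure \<Omega> \<inter> M) P" "continuous_on (closure \<Omega> \<inter> M) q"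
proof -
  show "compact (closure \<Omega> \<inter> M)" using assms by (metis compact_Int_closed closed_closure Int_commute)
  show "\<Omega> \<inter> M \<in> sets borel" using open_domain assms by (auto intro: borel_compact borel_open)
  show "\<Omega> \<inter> M \<subseteq> closure \<Omega> \<inter> M" using closure_subset by auto
  show "continuous_on (closure \<Omega> \<inter> M) P" "continuous_on (closure \<Omega> \<inter> M) q"
    using P_cont q_cont assms by (auto elim!: continuous_on_subset)
qed

text \<open>Here \<open>d = \<psi>\<^sup>2\<close>, so that \<open>\<Omega>\<close> may have an arbitrary boundary. The cutoff term has the size
  \<open>(\<psi>\<^sup>2 / \<delta>) smooth_step' (\<psi>\<^sup>2 / \<delta> - 1)\<close>, which is bounded because \<open>smooth_step'\<close> vanishes once
  \<open>\<psi>\<^sup>2 \<ge> 2 \<delta>\<close>, and tends to \<open>0\<close> at every point. In the limit the integrand is lost only on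
  \<open>{\<psi> = 0}\<close>, where it vanishes almost everywhere.\<close>

lemma weak_form_dirichlet:
  assumes \<psi>: "C1_supported \<Omega> N \<psi> X" and bd: "\<And>x. x \<in> frontier \<Omega> \<inter> N \<Longrightarrow> \<psi> x = 0"
  shows "weak_form \<Omega> P q \<psi> X"
proof -
  note N = region_facts[OF compact_N order_refl]
  have G: "\<And>x. x \<in> \<Omega> \<Longrightarrow> GDERIV \<psi> x :> X x" "\<And>x. x \<in> \<Omega> - N \<Longrightarrow> \<psi> x = 0 \<and> X x = 0"
    and cX: "continuous_on (closure \<Omega>) X" "continuous_on (closure \<Omega>) \<psi>"
    using \<psi> by (auto simp: C1_supported_def)
  have cXN: "continuous_on (closure \<Omega> \<inter> N) X" "continuous_on (closure \<Omega> \<inter> N) \<psi>"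
    using cX by (auto elim!: continuous_on_subset)
  have cX\<Omega>: "continuous_on \<Omega> X" "continuous_on \<Omega> \<psi>"
    using cX closure_subset by (auto elim!: continuous_on_subset)
  obtain B1 where B1: "B1 \<ge> 0" "\<And>x. x \<in> closure \<Omega> \<inter> N \<Longrightarrow> \<bar>P x \<bullet> X x + q x * \<psi> x\<bar> \<le> B1"
    using bounded_on_compact[OF N(1) continuous_on_add[OF continuous_on_inner[OF N(4) cXN(1)] continuous_on_mult[OF N(5) cXN(2)]]]
    by blast
  obtain B2 where B2: "B2 \<ge> 0" "\<And>x. x \<in> closure \<Omega> \<inter> N \<Longrightarrow> \<bar>P x \<bullet> X x\<bar> \<le> B2"
    using bounded_on_compact[OF N(1) continuous_on_inner[OF N(4) cXN(1)]] by blast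
  obtain M where M: "M > 0" "\<And>s. smooth_step' s \<le> M" using smooth_step'_bounded by blast
  define \<delta> where "\<delta> n = 1 / (real n + 1)" for n
  have \<delta>: "\<delta> n > 0" for n by (simp add: \<delta>_def)
  define f where "f n x = smooth_step ((\<psi> x)\<^sup>2 / \<delta> n - 1) * (P x \<bullet> X x + q x * \<psi> x)
       + \<psi> x * smooth_step' ((\<psi> x)\<^sup>2 / \<delta> n - 1) / \<delta> n * (P x \<bullet> ((2 * \<psi> x) *\<^sub>R X x))" for n x
  have f: "(f n has_integral 0) \<Omega>" for n
    unfolding f_def
  proof (rule cutoff_identity[OF \<psi> compact_N order_refl subset_UNIV open_UNIV])
    show "GDERIV (\<lambda>x. (\<psi> x)\<^sup>2) x :> (2 * \<psi> x) *\<^sub>R X x" if "x \<in> \<Omega> \<inter> UNIV" for x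
      by (rule GDERIV_DERIV_compose[OF G(1), of x "\<lambda>s. s\<^sup>2"]) (use that in \<open>auto intro!: derivative_eq_intros\<close>)
  qed (use cX\<Omega> cXN bd \<delta> in \<open>auto intro!: continuous_intros\<close>)
  have "((\<lambda>x. if \<psi> x = 0 then 0 else P x \<bullet> X x + q x * \<psi> x) has_integral 0) (\<Omega> \<inter> N)"
  proof (rule has_integral_dominated_convergence[of f "\<lambda>_. 0"])
    show "(f n has_integral 0) (\<Omega> \<inter> N)" for n
      using f[of n] G(2) by (subst has_integral_restrict_support) (auto simp: f_def)
    show "(\<lambda>x. B1 + 4 * M * B2) integrable_on \<Omega> \<inter> N"
      by (rule integrable_on_subset_of_compact(2)[OF N(1-3)]) auto
    show "\<forall>x\<in>\<Omega> \<inter> N. norm (f n x) \<le> B1 + 4 * M * B2" for n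
    proof
      fix x assume x: "x \<in> \<Omega> \<inter> N"
      define s where "s = (\<psi> x)\<^sup>2 / \<delta> n"
      have "s * smooth_step' (s - 1) \<le> 2 * M"
      proof (cases "s \<le> 2")
        case True
        have "s * smooth_step' (s - 1) \<le> 2 * smooth_step' (s - 1)" using True smooth_step_simps(7) by (rule mult_right_mono)
        then show ?thesis using M(2)[of "s - 1"] by simp
      qed (use M smooth_step_simps(6)[of "s - 1"] in auto)
      moreover have "0 \<le> s * smooth_step' (s - 1)" using \<delta>[of n] smooth_step_simps(7) by (simp add: s_def)
      ultimately have s: "\<bar>s * smooth_step' (s - 1)\<bar> \<le> 2 * M" by simp
      have "f n x = smooth_step (s - 1) * (P x \<bullet> X x + q x * \<psi> x) + 2 * (s * smooth_step' (s - 1)) * (P x \<bullet> X x)"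
        by (simp add: f_def s_def power2_eq_square)
      moreover have "\<bar>smooth_step (s - 1) * (P x \<bullet> X x + q x * \<psi> x)\<bar> \<le> 1 * B1"
        unfolding abs_mult using smooth_step_simps(3,4)[of "s - 1"] B1 x N(3) by (intro mult_mono) auto
      moreover have "\<bar>2 * (s * smooth_step' (s - 1)) * (P x \<bullet> X x)\<bar> \<le> (2 * (2 * M)) * B2"
        unfolding abs_mult[of _ "P x \<bullet> X x"] using s B2 x N(3) by (intro mult_mono) auto
      ultimately show "norm (f n x) \<le> B1 + 4 * M * B2" by simp
    qed
    show "\<forall>x\<in>\<Omega> \<inter> N. (\<lambda>n. f n x) \<longlonglongrightarrow> (if \<psi> x = 0 then 0 else P x \<bullet> X x + q x * \<psi> x)"
    proof
      fix x assume x: "x \<in> \<Omega> \<inter> N"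
      show "(\<lambda>n. f n x) \<longlonglongrightarrow> (if \<psi> x = 0 then 0 else P x \<bullet> X x + q x * \<psi> x)"
      proof (cases "\<psi> x = 0")
        case True
        then have "f n x = 0" for n by (simp add: f_def smooth_step_simps)
        then show ?thesis using True by simp
      next
        case False
        obtain n0 :: nat where n0: "real n0 > 2 / (\<psi> x)\<^sup>2" using reals_Archimedean2 by blast
        have "f n x = P x \<bullet> X x + q x * \<psi> x" if "n \<ge> n0" for n
        proof -
          have "real n + 1 \<ge> 2 / (\<psi> x)\<^sup>2" using n0 that by linarith
          then have "(\<psi> x)\<^sup>2 / \<delta> n - 1 \<ge> 1" using False by (simp add: \<delta>_def field_simps)
          then show ?thesis by (simp add: f_def smooth_step_simps)
        qed
        then have "\<forall>\<^sub>F n in sequentially. f n x = P x \<bullet> X x + q x * \<psi> x"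
          by (auto simp: eventually_sequentially)
        then show ?thesis using False by (simp add: tendsto_eventually)
      qed
    qed
  qed simp
  then have "((\<lambda>x. if \<psi> x = 0 then 0 else P x \<bullet> X x + q x * \<psi> x) has_integral 0) \<Omega>"
    by (subst (asm) has_integral_restrict_support) (use G(2) in auto)
  then show ?thesis unfolding weak_form_def
    by (rule has_integral_spike[OF negligible_zeros_with_nonzero_gradient[OF open_domain G(1) cX\<Omega>(1)], rotated 2])
       auto
qed

text \<open>Here \<open>d = - g\<close> for a local defining function \<open>g\<close> of \<open>\<Omega>\<close> with gradient \<open>G\<close>. The cutoff term
  is \<open>\<psi> (P \<bullet> G) / \<delta>\<close> on the layer \<open>{\<delta> \<le> - g \<le> 2 \<delta>}\<close>, whose volume is \<open>O(\<delta>)\<close>. Since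
  \<open>P \<bullet> G\<close> is continuous and vanishes on the boundary, it tends to \<open>0\<close> uniformly on this layer.\<close>

lemma weak_form_near_boundary:
  assumes bdry: "C1_boundary \<Omega>" and z: "z \<in> frontier \<Omega>"
    and normal: "\<And>x \<nu>. x \<in> frontier \<Omega> \<inter> N \<Longrightarrow> outer_unit_normal \<Omega> x \<nu> \<Longrightarrow> P x \<bullet> \<nu> = 0"
  obtains r where "r > 0" "\<And>\<psi> X. C1_supported \<Omega> (N \<inter> cball z r) \<psi> X \<Longrightarrow> weak_form \<Omega> P q \<psi> X"
proof -
  obtain g G where "local_defining_function \<Omega> z g G" using bdry z unfolding C1_boundary_def by blast
  then obtain U where U: "open U" "z \<in> U" "\<Omega> \<inter> U = {y \<in> U. g y < 0}" "continuous_on U G"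
      "\<And>y. y \<in> U \<Longrightarrow> GDERIV g y :> G y" "\<And>y. y \<in> U \<Longrightarrow> G y \<noteq> 0"
    unfolding local_defining_function_def by blast
  have PG: "P y \<bullet> G y = 0" if "y \<in> frontier \<Omega> \<inter> N" "y \<in> U" for y
  proof -
    have "outer_unit_normal \<Omega> y (sgn (G y))"
      unfolding outer_unit_normal_def local_defining_function_def using U that by blast
    from normal[OF that(1) this] show ?thesis using U(6)[OF that(2)] by (simp add: sgn_div_norm)
  qed
  \<comment> \<open>The inner normal direction at \<open>z\<close>, along which \<open>- g\<close> increases near \<open>z\<close>.\<close>
  define e where "e = - G z"
  define c where "c = (e \<bullet> e) / 2"
  have c: "c > 0" using U by (simp add: c_def e_def)
  have "isCont (\<lambda>y. - G y \<bullet> e) z"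
    using U by (intro continuous_intros) (auto simp: continuous_on_eq_continuous_at)
  then have lim: "((\<lambda>y. - G y \<bullet> e) \<longlongrightarrow> - G z \<bullet> e) (nhds z)"
    unfolding continuous_at by (rule iffD1[OF tendsto_at_iff_tendsto_nhds[of "\<lambda>y. - G y \<bullet> e" z]])
  have "- G z \<bullet> e > c" using c by (simp add: c_def e_def)
  with lim have "\<forall>\<^sub>F y in nhds z. - G y \<bullet> e > c" by (rule order_tendstoD(1))
  moreover have "\<forall>\<^sub>F y in nhds z. y \<in> U" using U by (intro eventually_nhds_in_open) auto
  ultimately have "\<forall>\<^sub>F y in nhds z. - G y \<bullet> e > c \<and> y \<in> U" by (rule eventually_conj)
  then obtain R' where R': "R' > 0" "\<And>y. dist y z < R' \<Longrightarrow> - G y \<bullet> e > c \<and> y \<in> U"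
    unfolding eventually_nhds_metric by auto
  define R where "R = R' / 2"
  define r where "r = R / 2"
  have r: "0 < r" "r < R" using R' by (auto simp: r_def R_def)
  have R: "y \<in> U" "c \<le> - G y \<bullet> e" if "y \<in> cball z R" for y
    using R'(2)[of y] R'(1) that by (auto simp: R_def dist_commute)
  have g': "\<And>y. y \<in> U \<Longrightarrow> GDERIV (\<lambda>y. - g y) y :> - G y" by (intro GDERIV_minus U)
  have G': "continuous_on U (\<lambda>y. - G y)" using U(4) by (intro continuous_intros)
  have cg: "continuous_on U g" using U(5) by (rule GDERIV_imp_continuous_on)
  have RU: "cball z R \<subseteq> U" using R by auto
  obtain C where C: "\<And>\<kappa> \<delta>. \<delta> > 0 \<Longrightarrow> integral (cball z r) (\<lambda>y. smooth_step' ((- g y - \<kappa>) / \<delta>)) \<le> C * \<delta>"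
    using strip_estimate[OF U(1) RU r c g' G' R(2)] by metis
  define M where "M = N \<inter> cball z r"
  have M: "compact M" "M \<subseteq> N" "M \<subseteq> U"
    using compact_N RU r by (auto simp: M_def compact_Int_closed)
  note S = region_facts[OF M(1,2)]
  have cgM: "continuous_on (closure \<Omega> \<inter> M) g" "continuous_on (closure \<Omega> \<inter> M) G"
    using cg U(4) M by (auto elim!: continuous_on_subset)
  have neg: "g x < 0 \<longleftrightarrow> x \<in> \<Omega>" if "x \<in> M" for x using U(3) M that by auto
  \<comment> \<open>Points with \<open>|P \<bullet> G| \<ge> \<epsilon>\<close> form a compact set off the boundary, so \<open>- g\<close> is bounded below on it.\<close>
  have gap: "\<exists>m>0. \<forall>x\<in>\<Omega> \<inter> M. \<epsilon> \<le> \<bar>P x \<bullet> G x\<bar> \<longrightarrow> m \<le> - g x" if "\<epsilon> > 0" for \<epsilon> :: real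
  proof -
    define L where "L = {x \<in> closure \<Omega> \<inter> M. \<epsilon> \<le> \<bar>P x \<bullet> G x\<bar>}"
    have "L = (closure \<Omega> \<inter> M) \<inter> (\<lambda>x. \<bar>P x \<bullet> G x\<bar>) -` {\<epsilon>..}" by (auto simp: L_def)
    moreover have "continuous_on (closure \<Omega> \<inter> M) (\<lambda>x. \<bar>P x \<bullet> G x\<bar>)" by (intro continuous_intros S cgM)
    ultimately have "closed L"
      using continuous_closed_preimage[OF _ compact_imp_closed[OF S(1)], of _ "{\<epsilon>..}"] by auto
    then have L: "compact L" using S(1)
      by (metis (no_types, lifting) L_def compact_Int_closed inf.absorb_iff2 mem_Collect_eq subsetI)
    show ?thesis
    proof (cases "L = {}")
      case True
      then show ?thesis using closure_subset[of \<Omega>] by (intro exI[of _ 1]) (auto simp: L_def)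
    next
      case False
      have "continuous_on L (\<lambda>x. - g x)"
        by (intro continuous_intros continuous_on_subset[OF cgM(1)]) (auto simp: L_def)
      from continuous_attains_inf[OF L False this]
      obtain x0 where x0: "x0 \<in> L" "\<And>x. x \<in> L \<Longrightarrow> - g x0 \<le> - g x" by auto
      have "x0 \<notin> frontier \<Omega>" using PG[of x0] subsetD[OF M(2), of x0] subsetD[OF M(3), of x0] x0(1) that by (auto simp: L_def)
      then have "x0 \<in> \<Omega>" using x0(1) open_domain by (auto simp: L_def frontier_def interior_open)
      then have "- g x0 > 0" using neg[of x0] x0(1) by (simp add: L_def)
      then show ?thesis using x0 closure_subset[of \<Omega>] by (intro exI[of _ "- g x0"]) (auto simp: L_def)
    qed
  qed
  have "weak_form \<Omega> P q \<psi> X" if \<psi>: "C1_supported \<Omega> M \<psi> X" for \<psi> X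
  proof -
    have X: "\<And>x. x \<in> \<Omega> - M \<Longrightarrow> \<psi> x = 0 \<and> X x = 0"
      and cX: "continuous_on (closure \<Omega> \<inter> M) X" "continuous_on (closure \<Omega> \<inter> M) \<psi>"
      using \<psi> by (auto simp: C1_supported_def elim!: continuous_on_subset)
    define \<delta> where "\<delta> n = 1 / (real n + 1)" for n
    have \<delta>: "\<delta> n > 0" for n by (simp add: \<delta>_def)
    define F where "F x = P x \<bullet> X x + q x * \<psi> x" for x
    define A where "A n x = smooth_step (- g x / \<delta> n - 1) * F x" for n x
    define E where "E n x = \<psi> x * smooth_step' (- g x / \<delta> n - 1) / \<delta> n * (P x \<bullet> (- G x))" for n x
    have cF: "continuous_on (closure \<Omega> \<inter> M) F" unfolding F_def[abs_def] by (intro continuous_intros S cX)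
    have intF: "F integrable_on (\<Omega> \<inter> M)" by (rule integrable_on_subset_of_compact(2)[OF S(1-3) cF])
    have intA: "A n integrable_on (\<Omega> \<inter> M)" for n
      unfolding A_def[abs_def] using \<delta>[of n]
      by (intro integrable_on_subset_of_compact(2)[OF S(1-3)] continuous_intros cF cgM) auto
    have intE: "E n integrable_on (\<Omega> \<inter> M)" for n
      unfolding E_def[abs_def] using \<delta>[of n]
      by (intro integrable_on_subset_of_compact(2)[OF S(1-3)] continuous_intros cX S cgM) auto
    have "((\<lambda>x. A n x + E n x) has_integral 0) \<Omega>" for n
      unfolding A_def E_def F_def
      by (rule cutoff_identity[OF \<psi> M U(1)])
        (use g' G' cgM \<delta> neg open_domain in \<open>auto simp: frontier_def interior_open not_less[symmetric] intro: continuous_on_subset continuous_on_minus\<close>)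
    then have hAE: "((\<lambda>x. A n x + E n x) has_integral 0) (\<Omega> \<inter> M)" for n
      by (subst has_integral_restrict_support) (use X in \<open>auto simp: A_def E_def F_def\<close>)
    have AE: "integral (\<Omega> \<inter> M) (A n) = - integral (\<Omega> \<inter> M) (E n)" for n
      using integral_add[OF intA intE, of n n] integral_unique[OF hAE[of n]] by linarith
    obtain B0 where B0: "B0 \<ge> 0" "\<And>x. x \<in> closure \<Omega> \<inter> M \<Longrightarrow> \<bar>F x\<bar> \<le> B0"
      using bounded_on_compact[OF S(1) cF] by blast
    obtain B1 where B1: "B1 \<ge> 0" "\<And>x. x \<in> closure \<Omega> \<inter> M \<Longrightarrow> \<bar>\<psi> x\<bar> \<le> B1"
      using bounded_on_compact[OF S(1) cX(2)] by blast
    have small: "\<exists>n0. \<forall>n\<ge>n0. \<delta> n \<le> m / 2" if "m > 0" for m :: real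
    proof -
      obtain n0 :: nat where "real n0 > 2 / m" using reals_Archimedean2 by blast
      then have "\<delta> n \<le> m / 2" if "n \<ge> n0" for n
      proof -
        have "real n + 1 \<ge> 2 / m" using \<open>real n0 > 2 / m\<close> that by linarith
        then show ?thesis using \<open>m > 0\<close> by (simp add: \<delta>_def field_simps)
      qed
      then show ?thesis by blast
    qed
    have conv: "(\<lambda>n. integral (\<Omega> \<inter> M) (A n)) \<longlonglongrightarrow> integral (\<Omega> \<inter> M) F"
    proof (rule dominated_convergence(2)[where h = "\<lambda>_. B0"])
      show "(\<lambda>_. B0) integrable_on \<Omega> \<inter> M" by (rule integrable_on_subset_of_compact(2)[OF S(1-3)]) auto
      fix x assume x: "x \<in> \<Omega> \<inter> M"
      show "norm (A n x) \<le> B0" for n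
      proof -
        have "\<bar>A n x\<bar> \<le> 1 * B0" unfolding A_def abs_mult using smooth_step_simps(3,4) B0 x S(3)
          by (intro mult_mono) auto
        then show ?thesis by simp
      qed
      have "- g x > 0" using neg[of x] x by auto
      then obtain n0 where n0: "\<forall>n\<ge>n0. \<delta> n \<le> - g x / 2" using small[of "- g x"] by auto
      have "A n x = F x" if "n \<ge> n0" for n
      proof -
        have "2 * \<delta> n \<le> - g x" using n0 that by force
        then have "- g x / \<delta> n \<ge> 2" using pos_le_divide_eq[OF \<delta>[of n], of 2 "- g x"] by blast
        then show ?thesis by (simp add: A_def smooth_step_simps)
      qed
      then show "(\<lambda>n. A n x) \<longlonglongrightarrow> F x"
        by (intro tendsto_eventually) (auto simp: eventually_sequentially)
    qed (rule intA)
    have bound: "\<bar>integral (\<Omega> \<inter> M) F\<bar> \<le> B1 * \<epsilon> * C" if \<epsilon>: "\<epsilon> > 0" for \<epsilon>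
    proof -
      obtain m where m: "m > 0" "\<And>x. x \<in> \<Omega> \<inter> M \<Longrightarrow> \<epsilon> \<le> \<bar>P x \<bullet> G x\<bar> \<Longrightarrow> m \<le> - g x" using gap[OF \<epsilon>] by blast
      obtain n0 where n0: "\<And>n. n \<ge> n0 \<Longrightarrow> \<delta> n \<le> m / 2" using small[OF m(1)] by blast
      have "\<bar>integral (\<Omega> \<inter> M) (A n)\<bar> \<le> B1 * \<epsilon> * C" if n: "n \<ge> n0" for n
      proof -
        define s where "s x = smooth_step' ((- g x - \<delta> n) / \<delta> n)" for x
        have s: "s x = smooth_step' (- g x / \<delta> n - 1)" "0 \<le> s x" for x
          using \<delta>[of n] smooth_step_simps(7) by (auto simp: s_def diff_divide_distrib)
        have cs: "continuous_on (cball z r) s" unfolding s_def[abs_def] using \<delta>[of n] RU r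
          by (intro continuous_intros continuous_on_subset[OF cg]) auto
        have ints: "s integrable_on T" if "T \<subseteq> cball z r" "T \<in> sets borel" for T
          by (rule integrable_on_subset_of_compact(2)[OF compact_cball _ _ cs]) (use that in auto)
        have "norm (integral (\<Omega> \<inter> M) (E n)) \<le> integral (\<Omega> \<inter> M) (\<lambda>x. B1 * \<epsilon> / \<delta> n * s x)"
        proof (rule integral_norm_bound_integral[OF intE])
          show "(\<lambda>x. B1 * \<epsilon> / \<delta> n * s x) integrable_on \<Omega> \<inter> M"
            using S(2) by (intro integrable_on_mult_right ints) (auto simp: M_def)
          fix x assume x: "x \<in> \<Omega> \<inter> M"
          show "norm (E n x) \<le> B1 * \<epsilon> / \<delta> n * s x"
          proof (cases "\<epsilon> \<le> \<bar>P x \<bullet> G x\<bar>")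
            case True
            have "2 * \<delta> n \<le> - g x" using m(2)[OF x True] n0[OF n] by simp
            then have "- g x / \<delta> n \<ge> 2" using pos_le_divide_eq[OF \<delta>[of n], of 2 "- g x"] by blast
            then have "E n x = 0" by (simp add: E_def smooth_step_simps)
            then show ?thesis using B1 \<epsilon> \<delta>[of n] s(2) by simp
          next
            case False
            have "norm (E n x) = \<bar>\<psi> x\<bar> * \<bar>P x \<bullet> G x\<bar> * (s x / \<delta> n)"
              using \<delta>[of n] s(2)[of x] unfolding E_def s(1)[symmetric] by (simp add: abs_mult)
            also have "\<dots> \<le> B1 * \<epsilon> * (s x / \<delta> n)"
              using False B1 x S(3) \<delta>[of n] s(2)[of x] \<epsilon> by (intro mult_right_mono mult_mono) auto
            finally show ?thesis by simp
          qed
        qed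
        also have "\<dots> = B1 * \<epsilon> / \<delta> n * integral (\<Omega> \<inter> M) s" by (rule integral_mult_right)
        also have "\<dots> \<le> B1 * \<epsilon> / \<delta> n * integral (cball z r) s"
        proof (rule mult_left_mono)
          show "integral (\<Omega> \<inter> M) s \<le> integral (cball z r) s"
            by (rule integral_subset_le) (use S(2) s(2) in \<open>auto simp: M_def intro!: ints\<close>)
        qed (use B1 \<epsilon> \<delta>[of n] in auto)
        also have "\<dots> \<le> B1 * \<epsilon> / \<delta> n * (C * \<delta> n)"
          using C[OF \<delta>[of n], of "\<delta> n"] B1 \<epsilon> \<delta>[of n] by (intro mult_left_mono) (auto simp: s_def[abs_def])
        also have "\<dots> = B1 * \<epsilon> * C" using \<delta>[of n] by simp
        finally show ?thesis using AE[of n] by simp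
      qed
      then show ?thesis
        using tendsto_upperbound[OF tendsto_rabs[OF conv], of "B1 * \<epsilon> * C"]
        by (auto simp: eventually_sequentially)
    qed
    have "integral (\<Omega> \<inter> M) F = 0"
    proof (rule ccontr)
      assume nz: "integral (\<Omega> \<inter> M) F \<noteq> 0"
      define a where "a = \<bar>integral (\<Omega> \<inter> M) F\<bar>"
      have a: "a > 0" using nz by (simp add: a_def)
      define b where "b = \<bar>B1 * C\<bar> + 1"
      have b: "b > 0" "B1 * C < b" by (auto simp: b_def)
      have "a \<le> (B1 * C / b) * a" using bound[of "a / b"] a b by (simp add: a_def[symmetric] field_simps)
      also have "\<dots> < 1 * a" using a b by (intro mult_strict_right_mono) auto
      finally show False by simp
    qed
    then have "(F has_integral 0) (\<Omega> \<inter> M)" using intF by (metis integrable_integral)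
    then show ?thesis unfolding weak_form_def F_def by (subst (asm) has_integral_restrict_support) (use X in auto)
  qed
  then show ?thesis using r(1) by (intro that[of r]) (auto simp: M_def)
qed

text \<open>The local statement is globalized along a finite cover of \<open>closure \<Omega> \<inter> N\<close>. In place of a
  partition of unity, the pieces \<open>\<psi> h\<close> are split off one by one for bumps \<open>h\<close>; each remainder
  \<open>\<psi> (1 - h)\<close> vanishes on one more set of the cover, and the last one is \<open>0\<close>.\<close>

lemma weak_form_neumann:
  assumes bdry: "C1_boundary \<Omega>"
    and normal: "\<And>x \<nu>. x \<in> frontier \<Omega> \<inter> N \<Longrightarrow> outer_unit_normal \<Omega> x \<nu> \<Longrightarrow> P x \<bullet> \<nu> = 0"
    and \<psi>: "C1_supported \<Omega> N \<psi> X"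
  shows "weak_form \<Omega> P q \<psi> X"
proof -
  define K where "K = closure \<Omega> \<inter> N"
  have K: "compact K" unfolding K_def by (rule region_facts[OF compact_N order_refl])
  have "\<forall>z\<in>K. \<exists>r>0. \<forall>\<psi> X. C1_supported \<Omega> (N \<inter> cball z r) \<psi> X \<longrightarrow> weak_form \<Omega> P q \<psi> X"
  proof
    fix z assume z: "z \<in> K"
    show "\<exists>r>0. \<forall>\<psi> X. C1_supported \<Omega> (N \<inter> cball z r) \<psi> X \<longrightarrow> weak_form \<Omega> P q \<psi> X"
    proof (cases "z \<in> frontier \<Omega>")
      case True
      then show ?thesis using weak_form_near_boundary[OF bdry True normal] by metis
    next
      case False
      then have "z \<in> \<Omega>" using z open_domain by (auto simp: K_def frontier_def interior_open)
      then obtain r where r: "r > 0" "cball z r \<subseteq> \<Omega>" using open_domain open_contains_cball by blast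
      have "weak_form \<Omega> P q \<psi> X" if "C1_supported \<Omega> (N \<inter> cball z r) \<psi> X" for \<psi> X
        by (rule weak_form_interior[OF that])
          (use r compact_N open_domain in \<open>auto simp: compact_Int_closed frontier_def interior_open\<close>)
      then show ?thesis using r by blast
    qed
  qed
  then obtain r where r: "\<And>z. z \<in> K \<Longrightarrow> r z > 0"
    "\<And>z \<psi> X. z \<in> K \<Longrightarrow> C1_supported \<Omega> (N \<inter> cball z (r z)) \<psi> X \<Longrightarrow> weak_form \<Omega> P q \<psi> X"
    by metis
  obtain Z where Z: "Z \<subseteq> K" "finite Z" "K \<subseteq> (\<Union>z\<in>Z. ball z (r z / 2))"
    by (rule compactE_image[OF K, of K "\<lambda>z. ball z (r z / 2)"]) (use r(1) in force)+
  have "weak_form \<Omega> P q \<psi> X" if "finite Z" "Z \<subseteq> K" "C1_supported \<Omega> (N \<inter> (\<Union>z\<in>Z. cball z (r z / 2))) \<psi> X" for Z \<psi> X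
    using that
  proof (induction Z arbitrary: \<psi> X rule: finite_induct)
    case empty
    then have "((\<lambda>x. P x \<bullet> X x + q x * \<psi> x) has_integral 0) \<Omega>"
      by (intro has_integral_is_0) (auto simp: C1_supported_def)
    then show ?case by (simp add: weak_form_def)
  next
    case (insert z Z)
    note sup = insert.prems(2)[unfolded C1_supported_def]
    have z: "z \<in> K" "0 < r z / 2" "r z / 2 < r z" using insert.prems(1) r(1)[of z] by auto
    define h where "h = bump z (r z / 2) (r z)"
    define h' where "h' = bump' z (r z / 2) (r z)"
    have h: "GDERIV h x :> h' x" for x unfolding h_def h'_def by (rule bump_GDERIV)
    have ch: "continuous_on (closure \<Omega>) h" "continuous_on (closure \<Omega>) h'"
      unfolding h_def h'_def by (intro continuous_intros)+
    have "C1_supported \<Omega> (N \<inter> cball z (r z)) (\<lambda>x. \<psi> x * h x) (\<lambda>x. \<psi> x *\<^sub>R h' x + h x *\<^sub>R X x)"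
      unfolding C1_supported_def
    proof (intro conjI ballI)
      show "GDERIV (\<lambda>x. \<psi> x * h x) x :> \<psi> x *\<^sub>R h' x + h x *\<^sub>R X x" if "x \<in> \<Omega>" for x
        by (rule GDERIV_mult) (use sup h that in auto)
      fix x assume x: "x \<in> \<Omega> - N \<inter> cball z (r z)"
      have "h x = 0 \<and> h' x = 0 \<or> \<psi> x = 0 \<and> X x = 0"
      proof (cases "x \<in> N")
        case True
        then have "x \<notin> ball z (r z)" using x by auto
        then show ?thesis using bump_outside[OF z(2,3)] by (auto simp: h_def h'_def)
      qed (use sup x in auto)
      then show "\<psi> x * h x = 0" "\<psi> x *\<^sub>R h' x + h x *\<^sub>R X x = 0" by auto
    qed (use sup ch in \<open>auto intro!: continuous_intros\<close>)
    then have w1: "weak_form \<Omega> P q (\<lambda>x. \<psi> x * h x) (\<lambda>x. \<psi> x *\<^sub>R h' x + h x *\<^sub>R X x)" by (rule r(2)[OF z(1)])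
    have "C1_supported \<Omega> (N \<inter> (\<Union>z\<in>Z. cball z (r z / 2))) (\<lambda>x. \<psi> x * (1 - h x)) (\<lambda>x. \<psi> x *\<^sub>R (0 - h' x) + (1 - h x) *\<^sub>R X x)"
      unfolding C1_supported_def
    proof (intro conjI ballI)
      show "GDERIV (\<lambda>x. \<psi> x * (1 - h x)) x :> \<psi> x *\<^sub>R (0 - h' x) + (1 - h x) *\<^sub>R X x" if "x \<in> \<Omega>" for x
        by (intro GDERIV_mult GDERIV_diff GDERIV_const h) (use sup that in auto)
      fix x assume x: "x \<in> \<Omega> - N \<inter> (\<Union>z\<in>Z. cball z (r z / 2))"
      have "h x = 1 \<and> h' x = 0 \<or> \<psi> x = 0 \<and> X x = 0"
      proof (cases "x \<in> cball z (r z / 2)")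
        case True
        then show ?thesis using bump_inside[OF z(2,3)] by (auto simp: h_def h'_def)
      qed (use sup x in auto)
      then show "\<psi> x * (1 - h x) = 0" "\<psi> x *\<^sub>R (0 - h' x) + (1 - h x) *\<^sub>R X x = 0" by auto
    qed (use sup ch in \<open>auto intro!: continuous_intros\<close>)
    then have w2: "weak_form \<Omega> P q (\<lambda>x. \<psi> x * (1 - h x)) (\<lambda>x. \<psi> x *\<^sub>R (0 - h' x) + (1 - h x) *\<^sub>R X x)"
      using insert.IH insert.prems by auto
    have "((\<lambda>x. P x \<bullet> X x + q x * \<psi> x) has_integral 0 + 0) \<Omega>"
      by (rule has_integral_eq[OF _ has_integral_add[OF w1[unfolded weak_form_def] w2[unfolded weak_form_def]]])
        (simp add: inner_add_right inner_diff_right algebra_simps)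
    then show ?case by (simp add: weak_form_def)
  qed
  note this[OF Z(2,1)]
  moreover have "C1_supported \<Omega> (N \<inter> (\<Union>z\<in>Z. cball z (r z / 2))) \<psi> X"
    unfolding C1_supported_def
  proof (intro conjI ballI)
    fix x assume x: "x \<in> \<Omega> - N \<inter> (\<Union>z\<in>Z. cball z (r z / 2))"
    have "x \<notin> N"
    proof
      assume "x \<in> N"
      then have "x \<in> K" using x closure_subset by (auto simp: K_def)
      then obtain z where "z \<in> Z" "x \<in> ball z (r z / 2)" using Z(3) by blast
      then have "x \<in> (\<Union>z\<in>Z. cball z (r z / 2))" by force
      then show False using x \<open>x \<in> N\<close> by blast
    qed
    then show "\<psi> x = 0" "X x = 0" using \<psi> x by (auto simp: C1_supported_def)
  qed (use \<psi> in \<open>auto simp: C1_supported_def\<close>)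
  ultimately show ?thesis .
qed

end

section \<open>Means over a short time window\<close>

text \<open>The mean of \<open>G\<close> over \<open>[t, t + h]\<close>, written over the fixed interval \<open>[0, 1]\<close>. In this form it is
  jointly continuous in \<open>h\<close>, \<open>t\<close> and \<open>x\<close> down to \<open>h = 0\<close>, where it is \<open>G t x\<close>; so the limit
  \<open>h \<rightarrow> 0\<close> becomes a matter of continuity.\<close>

definition window_mean :: "real \<Rightarrow> (real \<Rightarrow> 'a \<Rightarrow> 'b::euclidean_space) \<Rightarrow> real \<Rightarrow> 'a \<Rightarrow> 'b" where
  "window_mean h G t x = integral {0..1} (\<lambda>s. G (t + h * s) x)"

lemma window_mean_0: "window_mean 0 G t x = G t x"
  by (simp add: window_mean_def)

lemma continuous_on_slice:
  assumes "continuous_on (A \<times> K) (\<lambda>z. G (fst z) (snd z))" "continuous_on S a" "continuous_on S b"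
    "a ` S \<subseteq> A" "b ` S \<subseteq> K"
  shows "continuous_on S (\<lambda>x. G (a x) (b x))"
  using continuous_on_compose2[OF assms(1) continuous_on_Pair[OF assms(2,3)]] assms(4,5) by auto

lemma window_mean_continuous:
  fixes G :: "real \<Rightarrow> 'a::euclidean_space \<Rightarrow> 'b::euclidean_space"
  assumes G: "continuous_on ({0..} \<times> K) (\<lambda>z. G (fst z) (snd z))"
    and c: "continuous_on S h" "continuous_on S t" "continuous_on S x"
    and r: "\<And>z. z \<in> S \<Longrightarrow> h z \<ge> 0 \<and> t z \<ge> 0 \<and> x z \<in> K"
  shows "continuous_on S (\<lambda>z. window_mean (h z) G (t z) (x z))"
proof -
  have "continuous_on (({0..} \<times> {0..} \<times> K) \<times> {0..1}) (\<lambda>(w, s). G (fst (snd w) + fst w * s) (snd (snd w)))"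
    unfolding case_prod_beta
    by (rule continuous_on_slice[OF G]) (auto intro!: continuous_intros)
  then have "continuous_on ({0..} \<times> {0..} \<times> K) (\<lambda>w. integral (cbox 0 1) (\<lambda>s. G (fst (snd w) + fst w * s) (snd (snd w))))"
    by (intro integral_continuous_on_param) simp
  then have 1: "continuous_on ({0..} \<times> {0..} \<times> K) (\<lambda>w. window_mean (fst w) G (fst (snd w)) (snd (snd w)))"
    by (simp add: window_mean_def)
  have "continuous_on S (\<lambda>z. (h z, t z, x z))" by (intro continuous_intros c)
  from continuous_on_compose2[OF 1 this] r show ?thesis by auto
qed

lemma window_mean_eq:
  fixes G :: "real \<Rightarrow> 'a \<Rightarrow> 'b::euclidean_space"
  assumes h: "h > 0" and c: "continuous_on {t..t+h} (\<lambda>s. G s x)"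
  shows "window_mean h G t x = (1 / h) *\<^sub>R integral {t..t+h} (\<lambda>s. G s x)"
proof -
  have "((\<lambda>s. h *\<^sub>R G (t + h * s) x) has_integral integral {t + h * 0..t + h * 1} (\<lambda>s. G s x)) {0..1}"
    by (rule has_integral_substitution[where c = t and d = "t + h"])
      (use h c in \<open>auto intro!: derivative_eq_intros mult_left_le\<close>)
  then have "((\<lambda>s. (1 / h) *\<^sub>R (h *\<^sub>R G (t + h * s) x)) has_integral (1 / h) *\<^sub>R integral {t..t+h} (\<lambda>s. G s x)) {0..1}"
    by (intro has_integral_cmul) simp
  then show ?thesis using h by (simp add: window_mean_def integral_unique)
qed

lemma window_mean_has_vector_derivative:
  fixes G :: "real \<Rightarrow> 'a \<Rightarrow> 'b::euclidean_space"
  assumes h: "h > 0" and t: "t > 0" and c: "continuous_on {0..} (\<lambda>s. G s x)"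
  shows "((\<lambda>t. window_mean h G t x) has_vector_derivative (1 / h) *\<^sub>R (G (t + h) x - G t x)) (at t)"
proof -
  \<comment> \<open>The integral over the moving window is a difference of two values of one primitive.\<close>
  define J where "J r = integral {0..r} (\<lambda>s. G s x)" for r
  have J: "(J has_vector_derivative G r x) (at r)" if "r > 0" for r
  proof -
    have "(J has_vector_derivative G r x) (at r within {0..r+1})" unfolding J_def
      by (rule integral_has_vector_derivative) (use that c in \<open>auto intro: continuous_on_subset\<close>)
    moreover have "at r within {0..r+1} = at r" using that by (intro at_within_interior) (auto simp: interior_atLeastAtMost_real)
    ultimately show ?thesis by simp
  qed
  have Jh: "((\<lambda>t. J (t + h)) has_vector_derivative G (t + h) x) (at t)"
  proof -
    have "((\<lambda>t. t + h) has_vector_derivative 1) (at t)" by (auto intro!: derivative_eq_intros)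
    from vector_diff_chain_at[OF this J] h t show ?thesis by (simp add: o_def)
  qed
  have "((\<lambda>t. (1 / h) *\<^sub>R (J (t + h) - J t)) has_vector_derivative (1 / h) *\<^sub>R (G (t + h) x - G t x)) (at t)"
    by (intro bounded_linear.has_vector_derivative[OF bounded_linear_scaleR_right] has_vector_derivative_diff Jh J t)
  then show ?thesis
  proof (rule has_vector_derivative_transform_within_open[of _ _ _ "{0<..}"])
    fix r :: real assume r: "r \<in> {0<..}"
    have "J r + integral {r..r+h} (\<lambda>s. G s x) = J (r + h)" unfolding J_def
      using r h c by (intro Henstock_Kurzweil_Integration.integral_combine integrable_continuous_real) (auto elim: continuous_on_subset)
    then have "J (r + h) - J r = integral {r..r+h} (\<lambda>s. G s x)" by (simp add: algebra_simps)
    then show "(1 / h) *\<^sub>R (J (r + h) - J r) = window_mean h G r x"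
      using r h c by (subst window_mean_eq) (auto elim: continuous_on_subset)
  qed (use t in auto)
qed

lemma integral_tendsto_param:
  fixes \<Phi> :: "real \<Rightarrow> 'c::euclidean_space \<Rightarrow> real"
  assumes K: "compact K" "S \<in> sets borel" "S \<subseteq> K"
    and c: "continuous_on ({0..1} \<times> K) (\<lambda>z. \<Phi> (fst z) (snd z))"
    and h: "\<And>n. h n \<in> {0..1}" "h \<longlonglongrightarrow> 0"
  shows "(\<lambda>n. integral S (\<Phi> (h n))) \<longlonglongrightarrow> integral S (\<Phi> 0)"
proof -
  have "compact ({0..1::real} \<times> K)" using K by (intro compact_Times) auto
  then have "bounded ((\<lambda>z. \<Phi> (fst z) (snd z)) ` ({0..1} \<times> K))"
    using c compact_continuous_image compact_imp_bounded by blast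
  then obtain B where B: "\<And>t x. t \<in> {0..1} \<Longrightarrow> x \<in> K \<Longrightarrow> norm (\<Phi> t x) \<le> B"
    unfolding bounded_iff by force
  have sl: "continuous_on K (\<Phi> t)" if "t \<in> {0..1}" for t
    by (rule continuous_on_slice[OF c]) (use that in auto)
  show ?thesis
  proof (rule dominated_convergence(2)[where h = "\<lambda>_. B"])
    show "\<Phi> (h n) integrable_on S" for n by (rule integrable_on_subset_of_compact(2)[OF K sl]) (rule h)
    show "(\<lambda>_. B) integrable_on S" by (rule integrable_on_subset_of_compact(2)[OF K]) auto
    fix x assume x: "x \<in> S"
    show "norm (\<Phi> (h n) x) \<le> B" for n using B[OF h(1), of x n] x K by auto
    have "continuous_on {0..1} (\<lambda>t. \<Phi> t x)" by (rule continuous_on_slice[OF c]) (use x K in auto)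
    from continuous_on_tendsto_compose[OF this h(2)] h(1) show "(\<lambda>n. \<Phi> (h n) x) \<longlonglongrightarrow> \<Phi> 0 x"
      by auto
  qed
qed

section \<open>The time-integrated wave equation\<close>

text \<open>A solution of \<open>u\<^sub>t\<^sub>t + \<alpha> u\<^sub>t = \<Delta>u - f(u)\<close> with \<open>F' = f\<close>, given together with its derivatives
  \<open>ut\<close>, \<open>gu\<close> (spatial gradient) and \<open>H\<close> (pure second spatial derivatives along a basis vector). The
  first derivatives are continuous up to the boundary, the second ones only in \<open>\<Omega>\<close>.\<close>

locale regular_wave =
  fixes \<Omega> :: "'a::euclidean_space set" and u ut :: "real \<Rightarrow> 'a \<Rightarrow> real" and gu :: "real \<Rightarrow> 'a \<Rightarrow> 'a"
    and H :: "real \<Rightarrow> 'a \<Rightarrow> 'a \<Rightarrow> real" and \<alpha> :: real and f F :: "real \<Rightarrow> real"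
  assumes open_domain: "open \<Omega>"
    and u_cont: "continuous_on ({0..} \<times> closure \<Omega>) (\<lambda>z. u (fst z) (snd z))"
    and ut_cont: "continuous_on ({0..} \<times> closure \<Omega>) (\<lambda>z. ut (fst z) (snd z))"
    and gu_cont: "continuous_on ({0..} \<times> closure \<Omega>) (\<lambda>z. gu (fst z) (snd z))"
    and H_cont: "\<And>b. b \<in> Basis \<Longrightarrow> continuous_on ({0..} \<times> \<Omega>) (\<lambda>z. H (fst z) (snd z) b)"
    and ut: "\<And>t x. t > 0 \<Longrightarrow> x \<in> \<Omega> \<Longrightarrow> ((\<lambda>s. u s x) has_real_derivative ut t x) (at t)"
    and gu: "\<And>t x. t \<ge> 0 \<Longrightarrow> x \<in> \<Omega> \<Longrightarrow> GDERIV (u t) x :> gu t x"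
    and H: "\<And>t x b. t > 0 \<Longrightarrow> x \<in> \<Omega> \<Longrightarrow> b \<in> Basis \<Longrightarrow>
       ((\<lambda>s. gu t (x + s *\<^sub>R b) \<bullet> b) has_real_derivative H t x b) (at 0)"
    and pde: "\<And>t x. t > 0 \<Longrightarrow> x \<in> \<Omega> \<Longrightarrow>
       ((\<lambda>s. ut s x) has_real_derivative (\<Sum>b\<in>Basis. H t x b) - \<alpha> * ut t x - f (u t x)) (at t)"
    and \<alpha>: "\<alpha> \<ge> 0" and f_cont: "continuous_on UNIV f"
    and F: "\<And>s. (F has_real_derivative f s) (at s)" and F_nonneg: "\<And>s. F s \<ge> 0"
begin

text \<open>Green's formula at a fixed time: each \<open>\<partial>\<^sub>b (\<eta> \<partial>\<^sub>b u)\<close> has integral \<open>0\<close>, and the sum over the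
  basis is \<open>\<nabla>\<eta> \<bullet> \<nabla>u + \<eta> \<Delta>u\<close>.\<close>

lemma interior_weak_form:
  assumes C: "test_function C \<eta> Y" "C \<subseteq> \<Omega>" and t: "t > 0"
  shows "((\<lambda>x. gu t x \<bullet> Y x + (\<Sum>b\<in>Basis. H t x b) * \<eta> x) has_integral 0) C"
proof -
  have cC: "compact C" "closed C" and cY: "continuous_on UNIV Y" and Y: "\<And>x. GDERIV \<eta> x :> Y x"
    and out: "\<And>x. x \<notin> C \<Longrightarrow> \<eta> x = 0" "\<And>x. x \<notin> C \<Longrightarrow> Y x = 0"
    using C(1) by (auto simp: test_function_def compact_imp_closed)
  have c\<eta>: "continuous_on S \<eta>" for S using Y GDERIV_imp_continuous_on by blast
  have cY': "continuous_on S Y" for S using cY continuous_on_subset by blast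
  have cg: "continuous_on \<Omega> (gu t)"
    by (rule continuous_on_slice[OF gu_cont]) (use t closure_subset in auto)
  have cH: "continuous_on \<Omega> (\<lambda>x. H t x b)" if "b \<in> Basis" for b
    by (rule continuous_on_slice[OF H_cont[OF that], of \<Omega> "\<lambda>_. t" "\<lambda>x. x"]) (use t in auto)
  have one: "((\<lambda>x. \<eta> x * H t x b + (Y x \<bullet> b) * (gu t x \<bullet> b)) has_integral 0) UNIV" if b: "b \<in> Basis" for b
  proof (rule integral_directional_derivative_eq_0[OF cC(1), where f = "\<lambda>x. \<eta> x * (gu t x \<bullet> b)" and e = b])
    show "((\<lambda>s. \<eta> (x + s *\<^sub>R b) * (gu t (x + s *\<^sub>R b) \<bullet> b)) has_real_derivative
            \<eta> x * H t x b + (Y x \<bullet> b) * (gu t x \<bullet> b)) (at 0)" for x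
    proof (cases "x \<in> \<Omega>")
      case True
      show ?thesis using DERIV_mult[OF GDERIV_imp_directional[of \<eta> x 0 b "Y x"] H[OF t True b]] Y[of x]
        by (simp add: algebra_simps)
    next
      case False
      then have "x \<in> - C" using C by auto
      moreover have "((\<lambda>s. x + s *\<^sub>R b) \<longlongrightarrow> x + 0 *\<^sub>R b) (nhds 0)" by (intro tendsto_intros filterlim_ident)
      ultimately have "\<forall>\<^sub>F s in nhds 0. x + s *\<^sub>R b \<in> - C"
        using cC(2) by (auto dest!: topological_tendstoD[of _ _ _ "- C"])
      then have "\<forall>\<^sub>F s in nhds 0. \<eta> (x + s *\<^sub>R b) * (gu t (x + s *\<^sub>R b) \<bullet> b) = 0"
        by eventually_elim (use out in auto)
      then show ?thesis using out \<open>x \<in> - C\<close>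
        by (subst DERIV_cong_ev[of _ 0 _ "\<lambda>_. 0" _ 0]) auto
    qed
    show "continuous_on UNIV (\<lambda>x. \<eta> x * (gu t x \<bullet> b))"
      by (rule continuous_on_extend_0[OF open_domain cC(2) C(2)]) (use out in \<open>auto intro!: continuous_intros cg c\<eta>\<close>)
    show "continuous_on UNIV (\<lambda>x. \<eta> x * H t x b + (Y x \<bullet> b) * (gu t x \<bullet> b))"
      by (rule continuous_on_extend_0[OF open_domain cC(2) C(2)]) (use out in \<open>auto intro!: continuous_intros cg c\<eta> cY' cH b\<close>)
  qed (use out in auto)
  have "((\<lambda>x. \<Sum>b\<in>Basis. \<eta> x * H t x b + (Y x \<bullet> b) * (gu t x \<bullet> b)) has_integral (\<Sum>b\<in>(Basis::'a set). 0)) UNIV"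
    by (intro has_integral_sum one) auto
  moreover have "(\<Sum>b\<in>Basis. \<eta> x * H t x b + (Y x \<bullet> b) * (gu t x \<bullet> b))
     = (if x \<in> C then gu t x \<bullet> Y x + (\<Sum>b\<in>Basis. H t x b) * \<eta> x else 0)" for x
    using out[of x] by (simp add: sum.distrib euclidean_inner[of "gu t x" "Y x"] sum_distrib_left sum_distrib_right mult.commute)
  ultimately have "((\<lambda>x. if x \<in> C then gu t x \<bullet> Y x + (\<Sum>b\<in>Basis. H t x b) * \<eta> x else 0) has_integral 0) UNIV"
    by simp
  then show ?thesis by (simp only: has_integral_restrict_UNIV)
qed

text \<open>Integration in time turns \<open>\<Delta>u = u\<^sub>t\<^sub>t + \<alpha> u\<^sub>t + f(u)\<close> into an expression in \<open>u\<close> and \<open>u\<^sub>t\<close>, so that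
  no second derivative is left. Interchanging the integrals is harmless, since the integrand is
  continuous on the support of the test function.\<close>

lemma time_integrated_weak_form:
  assumes C: "test_function C \<eta> Y" "C \<subseteq> \<Omega>" and ab: "0 \<le> a" "a \<le> b"
  shows "weak_form \<Omega> (\<lambda>x. integral {a..b} (\<lambda>s. gu s x))
     (\<lambda>x. (ut b x - ut a x) + \<alpha> * (u b x - u a x) + integral {a..b} (\<lambda>s. f (u s x))) \<eta> Y"
proof -
  have cC: "compact C" and cY: "continuous_on UNIV Y" and Y: "\<And>x. GDERIV \<eta> x :> Y x"
    and out: "\<And>x. x \<notin> C \<Longrightarrow> \<eta> x = 0" "\<And>x. x \<notin> C \<Longrightarrow> Y x = 0"
    using C(1) by (auto simp: test_function_def)
  have bC: "C \<in> sets borel" using cC by (rule borel_compact)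
  have c\<eta>: "continuous_on S (\<lambda>x. \<eta> (g x))" if "continuous_on S g" for S :: "(real \<times> 'a) set" and g
    using Y GDERIV_imp_continuous_on[of UNIV \<eta> Y] that by (metis UNIV_I continuous_on_compose2 subset_UNIV)
  have cY': "continuous_on S (\<lambda>x. Y (g x))" if "continuous_on S g" for S :: "(real \<times> 'a) set" and g
    using cY that by (metis continuous_on_compose2 subset_UNIV)
  define G where "G z = gu (fst z) (snd z) \<bullet> Y (snd z) + (\<Sum>b\<in>Basis. H (fst z) (snd z) b) * \<eta> (snd z)" for z
  have cG: "continuous_on ({a..b} \<times> C) G"
    unfolding G_def[abs_def] using ab C(2) closure_subset[of \<Omega>]
    by (intro continuous_intros c\<eta> cY' continuous_on_subset[OF gu_cont] continuous_on_subset[OF H_cont]) auto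
  note swap = integral_Times_swap[OF cC bC order_refl cG]
  have "integral C (\<lambda>x. integral {a..b} (\<lambda>s. G (s, x))) = integral {a..b} (\<lambda>s. integral C (\<lambda>x. G (s, x)))"
    by (rule swap(3))
  also have "\<dots> = integral {a..b} (\<lambda>s. 0)"
  \<comment> \<open>The equation, and with it the interior weak form, is available for positive times only.\<close>
  proof (rule integral_spike[of "{0}"])
    show "0 = integral C (\<lambda>x. G (s, x))" if "s \<in> {a..b} - {0}" for s
      using interior_weak_form[OF C, of s] that ab by (simp add: G_def integral_unique)
  qed simp
  finally have hi: "((\<lambda>x. integral {a..b} (\<lambda>s. G (s, x))) has_integral 0) C"
    using swap(1) by (metis integrable_integral integral_0)
  have eq: "integral {a..b} (\<lambda>s. G (s, x)) = integral {a..b} (\<lambda>s. gu s x) \<bullet> Y x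
     + ((ut b x - ut a x) + \<alpha> * (u b x - u a x) + integral {a..b} (\<lambda>s. f (u s x))) * \<eta> x" if "x \<in> C" for x
  proof -
    have x: "x \<in> \<Omega>" "x \<in> closure \<Omega>" using that C closure_subset by auto
    have c1: "continuous_on {a..b} (\<lambda>s. gu s x)" "continuous_on {a..b} (\<lambda>s. u s x)" "continuous_on {a..b} (\<lambda>s. ut s x)"
      by (rule continuous_on_slice[OF gu_cont] continuous_on_slice[OF u_cont] continuous_on_slice[OF ut_cont]; use ab x in auto)+
    have c2: "continuous_on {a..b} (\<lambda>s. f (u s x))" using f_cont c1(2) by (rule continuous_on_compose2) auto
    have d: "((\<lambda>s. (\<Sum>b\<in>Basis. H s x b) - f (u s x)) has_integral (ut b x + \<alpha> * u b x) - (ut a x + \<alpha> * u a x)) {a..b}"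
    proof (rule fundamental_theorem_of_calculus_interior)
      show "continuous_on {a..b} (\<lambda>s. ut s x + \<alpha> * u s x)" by (intro continuous_intros c1)
      show "((\<lambda>s. ut s x + \<alpha> * u s x) has_vector_derivative (\<Sum>b\<in>Basis. H s x b) - f (u s x)) (at s)" if "s \<in> {a<..<b}" for s
        unfolding has_real_derivative_iff_has_vector_derivative[symmetric]
        using that ab by (auto intro!: derivative_eq_intros pde ut x)
    qed (use ab in auto)
    have "((\<lambda>s. ((\<Sum>b\<in>Basis. H s x b) - f (u s x)) + f (u s x)) has_integral
        ((ut b x + \<alpha> * u b x) - (ut a x + \<alpha> * u a x)) + integral {a..b} (\<lambda>s. f (u s x))) {a..b}"
      using c2 by (intro has_integral_add d integrable_integral integrable_continuous_real)
    then have "((\<lambda>s. (\<Sum>b\<in>Basis. H s x b) * \<eta> x) has_integral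
        (((ut b x + \<alpha> * u b x) - (ut a x + \<alpha> * u a x)) + integral {a..b} (\<lambda>s. f (u s x))) * \<eta> x) {a..b}"
      by (intro has_integral_mult_left) simp
    moreover have "((\<lambda>s. gu s x \<bullet> Y x) has_integral integral {a..b} (\<lambda>s. gu s x) \<bullet> Y x) {a..b}"
      using has_integral_linear[OF integrable_integral[OF integrable_continuous_real[OF c1(1)]] bounded_linear_inner_left[of "Y x"]]
      by (simp add: o_def)
    ultimately show ?thesis unfolding G_def fst_conv snd_conv
      by (subst integral_unique[OF has_integral_add]) (auto simp: algebra_simps)
  qed
  have "((\<lambda>x. integral {a..b} (\<lambda>s. gu s x) \<bullet> Y x
     + ((ut b x - ut a x) + \<alpha> * (u b x - u a x) + integral {a..b} (\<lambda>s. f (u s x))) * \<eta> x) has_integral 0) C"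
    using hi by (rule has_integral_eq[rotated]) (rule eq)
  then show ?thesis unfolding weak_form_def
    by (rule has_integral_on_superset) (use C out in auto)
qed

lemma time_slices:
  assumes "x \<in> closure \<Omega>" "0 \<le> a"
  shows "continuous_on {a..b} (\<lambda>s. u s x)" "continuous_on {a..b} (\<lambda>s. ut s x)"
    "continuous_on {a..b} (\<lambda>s. gu s x)" "continuous_on {a..b} (\<lambda>s. f (u s x))"
proof -
  show 1: "continuous_on {a..b} (\<lambda>s. u s x)" by (rule continuous_on_slice[OF u_cont]) (use assms in auto)
  show "continuous_on {a..b} (\<lambda>s. ut s x)" by (rule continuous_on_slice[OF ut_cont]) (use assms in auto)
  show "continuous_on {a..b} (\<lambda>s. gu s x)" by (rule continuous_on_slice[OF gu_cont]) (use assms in auto)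
  show "continuous_on {a..b} (\<lambda>s. f (u s x))" using f_cont 1 by (rule continuous_on_compose2) auto
qed

lemma fu_cont: "continuous_on ({0..} \<times> closure \<Omega>) (\<lambda>z. f (u (fst z) (snd z)))"
  using f_cont u_cont by (rule continuous_on_compose2) auto

lemma window_mean_ut:
  assumes "h > 0" "t \<ge> 0" "x \<in> \<Omega>"
  shows "window_mean h ut t x = (u (t + h) x - u t x) / h"
proof -
  have x: "x \<in> closure \<Omega>" using assms closure_subset by auto
  have "((\<lambda>s. ut s x) has_integral u (t + h) x - u t x) {t..t+h}"
    by (rule fundamental_theorem_of_calculus_interior)
      (use assms time_slices[OF x] in \<open>auto simp: has_real_derivative_iff_has_vector_derivative[symmetric] intro!: ut\<close>)
  then show ?thesis using assms time_slices[OF x] by (simp add: window_mean_eq integral_unique)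
qed

text \<open>The averaged equation. Every ingredient is continuous up to the boundary, so the extension
  lemmas for weak solutions apply to it.\<close>

lemma weak_solution_window:
  assumes N: "compact N" and h: "h > 0" and t: "t \<ge> 0"
  shows "weak_solution \<Omega> N (window_mean h gu t)
     (\<lambda>x. (ut (t + h) x - ut t x) / h + \<alpha> * ((u (t + h) x - u t x) / h) + window_mean h (\<lambda>s x. f (u s x)) t x)"
proof
  show "open \<Omega>" "compact N" by (fact open_domain N)+
  show "continuous_on (closure \<Omega> \<inter> N) (window_mean h gu t)"
    by (rule window_mean_continuous[OF gu_cont]) (use h t in auto)
  have "continuous_on (closure \<Omega> \<inter> N) (\<lambda>x. window_mean h (\<lambda>s x. f (u s x)) t x)"
    by (rule window_mean_continuous[OF fu_cont]) (use h t in auto)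
  moreover have "continuous_on (closure \<Omega> \<inter> N) (ut r)" "continuous_on (closure \<Omega> \<inter> N) (u r)" if "r \<ge> 0" for r
    by (rule continuous_on_slice[OF ut_cont] continuous_on_slice[OF u_cont]; use that in auto)+
  ultimately show "continuous_on (closure \<Omega> \<inter> N) (\<lambda>x. (ut (t + h) x - ut t x) / h +
      \<alpha> * ((u (t + h) x - u t x) / h) + window_mean h (\<lambda>s x. f (u s x)) t x)"
    using h t by (auto intro!: continuous_intros)
  fix C \<eta> Y assume C: "test_function C \<eta> Y" "C \<subseteq> \<Omega> \<inter> N"
  have "weak_form \<Omega> (\<lambda>x. integral {t..t+h} (\<lambda>s. gu s x))
     (\<lambda>x. (ut (t+h) x - ut t x) + \<alpha> * (u (t+h) x - u t x) + integral {t..t+h} (\<lambda>s. f (u s x))) \<eta> Y"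
    by (rule time_integrated_weak_form) (use C h t in auto)
  from has_integral_mult_right[OF this[unfolded weak_form_def], of "1 / h"]
  have "((\<lambda>x. (1 / h) * (integral {t..t+h} (\<lambda>s. gu s x) \<bullet> Y x +
      ((ut (t+h) x - ut t x) + \<alpha> * (u (t+h) x - u t x) + integral {t..t+h} (\<lambda>s. f (u s x))) * \<eta> x)) has_integral 0) \<Omega>"
    by simp
  then show "weak_form \<Omega> (window_mean h gu t) (\<lambda>x. (ut (t + h) x - ut t x) / h +
      \<alpha> * ((u (t + h) x - u t x) / h) + window_mean h (\<lambda>s x. f (u s x)) t x) \<eta> Y"
    unfolding weak_form_def
  proof (rule has_integral_eq[rotated])
    fix x assume "x \<in> \<Omega>"
    then have x: "x \<in> closure \<Omega>" using closure_subset by auto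
    show "(1 / h) * (integral {t..t+h} (\<lambda>s. gu s x) \<bullet> Y x +
      ((ut (t+h) x - ut t x) + \<alpha> * (u (t+h) x - u t x) + integral {t..t+h} (\<lambda>s. f (u s x))) * \<eta> x) =
      window_mean h gu t x \<bullet> Y x + ((ut (t + h) x - ut t x) / h +
      \<alpha> * ((u (t + h) x - u t x) / h) + window_mean h (\<lambda>s x. f (u s x)) t x) * \<eta> x"
      using window_mean_eq[OF h, of t gu x] time_slices(3)[OF x t] window_mean_eq[OF h, of t "\<lambda>s x. f (u s x)" x] time_slices(4)[OF x t]
      by (simp add: algebra_simps diff_divide_distrib add_divide_distrib)
  qed
qed

end

section \<open>A weight supported in the backward light cone\<close>

definition cone_gap :: "real \<Rightarrow> 'a::euclidean_space \<Rightarrow> real \<Rightarrow> 'a \<Rightarrow> real" where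
  "cone_gap t\<^sub>0 x\<^sub>0 t x = (t\<^sub>0 - t)\<^sup>2 - (x - x\<^sub>0) \<bullet> (x - x\<^sub>0)"

definition cone_weight :: "real \<Rightarrow> 'a::euclidean_space \<Rightarrow> real \<Rightarrow> 'a \<Rightarrow> real" where
  "cone_weight t\<^sub>0 x\<^sub>0 t x = pos_sq (cone_gap t\<^sub>0 x\<^sub>0 t x)"

definition cone_weight_dt :: "real \<Rightarrow> 'a::euclidean_space \<Rightarrow> real \<Rightarrow> 'a \<Rightarrow> real" where
  "cone_weight_dt t\<^sub>0 x\<^sub>0 t x = - (4 * (t\<^sub>0 - t) * max 0 (cone_gap t\<^sub>0 x\<^sub>0 t x))"

definition cone_weight_grad :: "real \<Rightarrow> 'a::euclidean_space \<Rightarrow> real \<Rightarrow> 'a \<Rightarrow> 'a" where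
  "cone_weight_grad t\<^sub>0 x\<^sub>0 t x = (- (4 * max 0 (cone_gap t\<^sub>0 x\<^sub>0 t x))) *\<^sub>R (x - x\<^sub>0)"

lemma cone_weight_DERIV:
  "((\<lambda>s. cone_weight t\<^sub>0 x\<^sub>0 s x) has_real_derivative cone_weight_dt t\<^sub>0 x\<^sub>0 t x) (at t)"
  unfolding cone_weight_def cone_weight_dt_def
  by (rule DERIV_cong[OF DERIV_chain'[OF _ pos_sq_DERIV]])
    (auto intro!: derivative_eq_intros simp: cone_gap_def algebra_simps)

lemma cone_weight_GDERIV:
  "GDERIV (cone_weight t\<^sub>0 x\<^sub>0 t) x :> cone_weight_grad t\<^sub>0 x\<^sub>0 t x"
proof -
  have "GDERIV (cone_gap t\<^sub>0 x\<^sub>0 t) x :> - (2 *\<^sub>R (x - x\<^sub>0))"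
    unfolding gderiv_def cone_gap_def[abs_def]
    by (auto intro!: derivative_eq_intros simp: inner_commute algebra_simps)
  from GDERIV_DERIV_compose[OF this pos_sq_DERIV] show ?thesis
    unfolding cone_weight_def[abs_def] cone_weight_grad_def by simp
qed

lemma cone_weight_continuous [continuous_intros]:
  assumes "continuous_on S a" "continuous_on S b"
  shows "continuous_on S (\<lambda>z. cone_weight t\<^sub>0 x\<^sub>0 (a z) (b z))"
    "continuous_on S (\<lambda>z. cone_weight_dt t\<^sub>0 x\<^sub>0 (a z) (b z))"
    "continuous_on S (\<lambda>z. cone_weight_grad t\<^sub>0 x\<^sub>0 (a z) (b z))"
  unfolding cone_weight_def cone_weight_dt_def cone_weight_grad_def cone_gap_def
  by (intro continuous_intros assms)+

lemma cone_gap_pos_iff: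
  assumes "t \<le> t\<^sub>0" shows "cone_gap t\<^sub>0 x\<^sub>0 t x > 0 \<longleftrightarrow> dist x\<^sub>0 x < t\<^sub>0 - t"
proof -
  have "cone_gap t\<^sub>0 x\<^sub>0 t x > 0 \<longleftrightarrow> (dist x\<^sub>0 x)\<^sup>2 < (t\<^sub>0 - t)\<^sup>2"
    by (simp add: cone_gap_def dist_norm norm_minus_commute power2_norm_eq_inner)
  also have "\<dots> \<longleftrightarrow> dist x\<^sub>0 x < t\<^sub>0 - t"
    using assms by (metis abs_of_nonneg diff_ge_0_iff_ge power2_strict_mono real_sqrt_abs real_sqrt_less_iff zero_le_dist)
  finally show ?thesis .
qed

lemma cone_weight_nonneg: "0 \<le> cone_weight t\<^sub>0 x\<^sub>0 t x"
  by (simp add: cone_weight_def pos_sq_simps)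

lemma cone_weight_outside:
  assumes "t \<le> t\<^sub>0" "t\<^sub>0 - t \<le> dist x\<^sub>0 x"
  shows "cone_weight t\<^sub>0 x\<^sub>0 t x = 0" "cone_weight_grad t\<^sub>0 x\<^sub>0 t x = 0"
  using cone_gap_pos_iff[OF assms(1), of x\<^sub>0 x] assms(2)
  by (auto simp: cone_weight_def cone_weight_grad_def pos_sq_simps)

text \<open>The weight recedes at least at unit speed: on its support \<open>|x - x\<^sub>0| \<le> t\<^sub>0 - t\<close>. This inequality
  is what lets the loss of weight pay for the energy flux.\<close>

lemma cone_weight_eikonal:
  assumes "t \<le> t\<^sub>0"
  shows "norm (cone_weight_grad t\<^sub>0 x\<^sub>0 t x) \<le> - cone_weight_dt t\<^sub>0 x\<^sub>0 t x"
proof (cases "cone_gap t\<^sub>0 x\<^sub>0 t x > 0")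
  case True
  then have "dist x\<^sub>0 x \<le> t\<^sub>0 - t" using cone_gap_pos_iff[OF assms, of x\<^sub>0 x] by simp
  then have "4 * cone_gap t\<^sub>0 x\<^sub>0 t x * norm (x - x\<^sub>0) \<le> 4 * cone_gap t\<^sub>0 x\<^sub>0 t x * (t\<^sub>0 - t)"
    using True by (intro mult_left_mono) (auto simp: dist_norm norm_minus_commute)
  then show ?thesis using True by (simp add: cone_weight_grad_def cone_weight_dt_def mult_ac)
qed (simp add: cone_weight_grad_def cone_weight_dt_def)

section \<open>The energy inequality\<close>

text \<open>The three boundary cases are reduced to two: an empty boundary satisfies the first alternative
  trivially.\<close>

locale cone_problem = regular_wave \<Omega> u ut gu H \<alpha> f F
  for \<Omega> :: "'a::euclidean_space set" and u ut gu H \<alpha> f F +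
  fixes x\<^sub>0 :: 'a and t\<^sub>0 :: real
  assumes t\<^sub>0: "t\<^sub>0 > 0" and x\<^sub>0: "x\<^sub>0 \<in> \<Omega>"
    and boundary: "(\<forall>x\<in>frontier \<Omega>. \<forall>t\<ge>0. u t x = u 0 x) \<or>
       (C1_boundary \<Omega> \<and> (\<forall>t\<ge>0. \<forall>x\<in>frontier \<Omega>. \<forall>\<nu>. outer_unit_normal \<Omega> x \<nu> \<longrightarrow> gu t x \<bullet> \<nu> = 0))"
    and init_u: "\<And>x. x \<in> ball x\<^sub>0 t\<^sub>0 \<inter> \<Omega> \<Longrightarrow> u 0 x = 0"
    and init_ut: "\<And>x. x \<in> ball x\<^sub>0 t\<^sub>0 \<inter> \<Omega> \<Longrightarrow> ut 0 x = 0"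
    and F0: "F 0 = 0"
begin

abbreviation "K \<equiv> closure \<Omega> \<inter> cball x\<^sub>0 t\<^sub>0"
abbreviation "S \<equiv> \<Omega> \<inter> cball x\<^sub>0 t\<^sub>0"
abbreviation "\<phi> \<equiv> cone_weight t\<^sub>0 x\<^sub>0"
abbreviation "fu \<equiv> (\<lambda>s x. f (u s x))"

lemma KS_facts: "compact K" "S \<in> sets borel" "S \<subseteq> K"
  using open_domain closure_subset by (auto simp: Int_commute compact_Int_closed intro: borel_open borel_closed)

text \<open>The energy inequality for the means. With \<open>V = \<partial>\<^sub>t\<langle>u\<rangle>\<close> and \<open>P = \<nabla>\<langle>u\<rangle>\<close>, the time derivative of
  \<open>\<phi> (V\<^sup>2 + |P|\<^sup>2) / 2\<close> is, after subtracting the weak form tested with \<open>\<phi> V\<close>, equal to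
  \<open>\<partial>\<^sub>t\<phi> (V\<^sup>2 + |P|\<^sup>2) / 2 - V P \<bullet> \<nabla>\<phi> - \<alpha> \<phi> V\<^sup>2 - \<phi> V \<langle>f(u)\<rangle>\<close>. The first two terms are together
  nonpositive by the eikonal inequality for the weight, and so is the third. The work of the
  nonlinearity stays on the right: the mean of \<open>f(u)\<close> is not a function of \<open>\<langle>u\<rangle>\<close>, and it becomes an
  exact time derivative only in the limit.\<close>

lemma window_energy_inequality:
  assumes h: "h > 0" and T: "0 \<le> T" "T \<le> t\<^sub>0"
  shows "integral S (\<lambda>x. \<phi> T x * ((window_mean h ut T x)\<^sup>2 + window_mean h gu T x \<bullet> window_mean h gu T x) / 2) -
     integral S (\<lambda>x. \<phi> 0 x * ((window_mean h ut 0 x)\<^sup>2 + window_mean h gu 0 x \<bullet> window_mean h gu 0 x) / 2)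
   \<le> - integral ({0..T} \<times> S) (\<lambda>z. \<phi> (fst z) (snd z) * window_mean h ut (fst z) (snd z) * window_mean h fu (fst z) (snd z))"
proof -
  define V where "V t x = (u (t + h) x - u t x) / h" for t x
  define V' where "V' t x = (ut (t + h) x - ut t x) / h" for t x
  define P where "P = window_mean h gu"
  define P' where "P' t x = (1 / h) *\<^sub>R (gu (t + h) x - gu t x)" for t x
  define Fm where "Fm = window_mean h fu"
  define e where "e t x = \<phi> t x * ((V t x)\<^sup>2 + P t x \<bullet> P t x) / 2" for t x
  define e' where "e' t x = cone_weight_dt t\<^sub>0 x\<^sub>0 t x * ((V t x)\<^sup>2 + P t x \<bullet> P t x) / 2
      + \<phi> t x * (V t x * V' t x + P t x \<bullet> P' t x)" for t x
  define w where "w t x = \<phi> t x * V t x * Fm t x" for t x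
  let ?D = "{0..} \<times> closure \<Omega>"
  have shift: "continuous_on ?D (\<lambda>z. G (fst z + h) (snd z))" if "continuous_on ?D (\<lambda>z. G (fst z) (snd z))"
    for G :: "real \<Rightarrow> 'a \<Rightarrow> 'c::euclidean_space"
    by (rule continuous_on_slice[OF that]) (use h in \<open>auto intro!: continuous_intros\<close>)
  have cV: "continuous_on ?D (\<lambda>z. V (fst z) (snd z))" "continuous_on ?D (\<lambda>z. V' (fst z) (snd z))"
      "continuous_on ?D (\<lambda>z. P' (fst z) (snd z))"
    unfolding V_def V'_def P'_def using h
    by (auto intro!: continuous_intros shift u_cont ut_cont gu_cont)
  have cP: "continuous_on ?D (\<lambda>z. P (fst z) (snd z))" "continuous_on ?D (\<lambda>z. Fm (fst z) (snd z))"
    unfolding P_def Fm_def using h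
    by (auto intro!: window_mean_continuous[OF gu_cont] window_mean_continuous[OF fu_cont] continuous_intros)
  have ce: "continuous_on ?D (\<lambda>z. e (fst z) (snd z))" "continuous_on ?D (\<lambda>z. e' (fst z) (snd z))"
       "continuous_on ?D (\<lambda>z. w (fst z) (snd z))"
    unfolding e_def e'_def w_def by (intro continuous_intros cV cP; simp)+
  have sl: "continuous_on K (G t)" if "continuous_on ?D (\<lambda>z. G (fst z) (snd z))" "t \<ge> 0"
    for G :: "real \<Rightarrow> 'a \<Rightarrow> 'c::euclidean_space" and t
    by (rule continuous_on_slice[OF that(1)]) (use that in auto)
  have slc: "continuous_on (closure \<Omega>) (G t)" if "continuous_on ?D (\<lambda>z. G (fst z) (snd z))" "t \<ge> 0"
    for G :: "real \<Rightarrow> 'a \<Rightarrow> 'c::euclidean_space" and t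
    by (rule continuous_on_slice[OF that(1)]) (use that in auto)
  have int: "G t integrable_on S" if "continuous_on ?D (\<lambda>z. G (fst z) (snd z))" "t \<ge> 0"
    for G :: "real \<Rightarrow> 'a \<Rightarrow> real" and t
    by (rule integrable_on_subset_of_compact(2)[OF KS_facts sl[OF that]])
  have D: "(\<lambda>t. e' t x) integrable_on {0..T}" "integral {0..T} (\<lambda>t. e' t x) = e T x - e 0 x" if "x \<in> S" for x
  proof -
    have x: "x \<in> \<Omega>" "x \<in> closure \<Omega>" using that closure_subset by auto
    have "((\<lambda>t. e' t x) has_integral e T x - e 0 x) {0..T}"
    proof (rule fundamental_theorem_of_calculus_interior)
      show "continuous_on {0..T} (\<lambda>t. e t x)" by (rule continuous_on_slice[OF ce(1)]) (use x in auto)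
      fix t assume t: "t \<in> {0<..<T}"
      have "((\<lambda>t. u (t + h) x) has_real_derivative ut (t + h) x) (at t)"
        using ut[of "t + h" x] t h x by (simp add: DERIV_shift)
      then have dV: "((\<lambda>t. V t x) has_real_derivative V' t x) (at t)"
        unfolding V_def V'_def using h t x by (auto intro!: derivative_eq_intros ut)
      have dP: "((\<lambda>t. P t x) has_vector_derivative P' t x) (at t)"
        unfolding P_def P'_def
        by (rule window_mean_has_vector_derivative[OF h])
          (use t x in \<open>auto intro!: continuous_on_slice[OF gu_cont]\<close>)
      have dPP: "((\<lambda>t. P t x \<bullet> P t x) has_real_derivative P t x \<bullet> P' t x + P' t x \<bullet> P t x) (at t)"
        unfolding has_real_derivative_iff_has_vector_derivative
        by (rule bounded_bilinear.has_vector_derivative[OF bounded_bilinear_inner dP dP])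
      show "((\<lambda>t. e t x) has_vector_derivative e' t x) (at t)"
        unfolding has_real_derivative_iff_has_vector_derivative[symmetric] e_def e'_def
        by (auto intro!: derivative_eq_intros cone_weight_DERIV dV dPP simp: inner_commute field_simps)
    qed (use T in auto)
    then show "(\<lambda>t. e' t x) integrable_on {0..T}" "integral {0..T} (\<lambda>t. e' t x) = e T x - e 0 x"
      by (auto simp: integral_unique has_integral_integrable)
  qed
  \<comment> \<open>The inequality at a fixed time, which is then integrated over \<open>[0, T]\<close>.\<close>
  have slice: "integral S (e' t) \<le> - integral S (w t)" if t: "t \<in> {0..T}" for t
  proof -
    have t: "0 \<le> t" "t \<le> t\<^sub>0" using t T by auto
    define q where "q x = (ut (t + h) x - ut t x) / h + \<alpha> * ((u (t + h) x - u t x) / h) + window_mean h fu t x" for x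
    interpret W: weak_solution \<Omega> "cball x\<^sub>0 t\<^sub>0" "P t" q
      unfolding P_def q_def[abs_def] by (rule weak_solution_window[OF compact_cball h t(1)])
    define \<psi> where "\<psi> x = \<phi> t x * V t x" for x
    define X where "X x = \<phi> t x *\<^sub>R P' t x + V t x *\<^sub>R cone_weight_grad t\<^sub>0 x\<^sub>0 t x" for x
    have out: "\<phi> t x = 0" "cone_weight_grad t\<^sub>0 x\<^sub>0 t x = 0" if "x \<notin> cball x\<^sub>0 t\<^sub>0" for x
      using cone_weight_outside[OF t(2), of x\<^sub>0 x] that t by auto
    have sup: "C1_supported \<Omega> (cball x\<^sub>0 t\<^sub>0) \<psi> X"
      unfolding C1_supported_def
    proof (intro conjI ballI)
      fix x assume x: "x \<in> \<Omega>"
      have "GDERIV (\<lambda>x. (u (t + h) x - u t x) * (1 / h)) x :> (u (t + h) x - u t x) *\<^sub>R 0 + (1 / h) *\<^sub>R (gu (t + h) x - gu t x)"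
        using t h x by (intro GDERIV_mult GDERIV_diff GDERIV_const gu) auto
      then have "GDERIV (V t) x :> P' t x" by (simp add: V_def[abs_def] P'_def)
      from GDERIV_mult[OF cone_weight_GDERIV this] show "GDERIV \<psi> x :> X x"
        by (simp add: \<psi>_def[abs_def] X_def)
    next
      have c: "continuous_on (closure \<Omega>) (V t)" "continuous_on (closure \<Omega>) (P' t)"
        using slc[of V t] slc[of P' t] cV t by auto
      show "continuous_on (closure \<Omega>) \<psi>" "continuous_on (closure \<Omega>) X"
        unfolding \<psi>_def[abs_def] X_def[abs_def]
        by (rule c continuous_on_mult continuous_on_add continuous_on_scaleR cone_weight_continuous continuous_on_const continuous_on_id)+
    qed (use out in \<open>auto simp: \<psi>_def X_def\<close>)
    have "weak_form \<Omega> (P t) q \<psi> X"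
    proof (rule disjE[OF boundary])
      assume bd: "\<forall>x\<in>frontier \<Omega>. \<forall>t\<ge>0. u t x = u 0 x"
      show ?thesis
      proof (rule W.weak_form_dirichlet[OF sup])
        fix x assume "x \<in> frontier \<Omega> \<inter> cball x\<^sub>0 t\<^sub>0"
        then have "u (t + h) x = u 0 x" "u t x = u 0 x" using bd[rule_format, of x "t + h"] bd[rule_format, of x t] t h by auto
        then show "\<psi> x = 0" by (simp add: \<psi>_def V_def)
      qed
    next
      assume bd: "C1_boundary \<Omega> \<and> (\<forall>t\<ge>0. \<forall>x\<in>frontier \<Omega>. \<forall>\<nu>. outer_unit_normal \<Omega> x \<nu> \<longrightarrow> gu t x \<bullet> \<nu> = 0)"
      show ?thesis
      proof (rule W.weak_form_neumann[OF _ _ sup])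
        show "C1_boundary \<Omega>" using bd by blast
        fix x \<nu> assume x: "x \<in> frontier \<Omega> \<inter> cball x\<^sub>0 t\<^sub>0" and \<nu>: "outer_unit_normal \<Omega> x \<nu>"
        then have xc: "x \<in> closure \<Omega>" by (auto simp: frontier_def)
        have "continuous_on {0..1} (\<lambda>s. gu (t + h * s) x)"
          by (rule continuous_on_slice[OF gu_cont]) (use xc t h in \<open>auto intro!: continuous_intros\<close>)
        from has_integral_linear[OF integrable_integral[OF integrable_continuous_real[OF this]] bounded_linear_inner_left[of \<nu>]]
        have "((\<lambda>s. gu (t + h * s) x \<bullet> \<nu>) has_integral P t x \<bullet> \<nu>) {0..1}"
          by (simp add: P_def window_mean_def o_def)
        moreover have "((\<lambda>s. gu (t + h * s) x \<bullet> \<nu>) has_integral 0) {0..1}"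
          by (rule has_integral_is_0) (use bd x \<nu> t h in auto)
        ultimately show "P t x \<bullet> \<nu> = 0" by (rule has_integral_unique)
      qed
    qed
    then have "((\<lambda>x. P t x \<bullet> X x + q x * \<psi> x) has_integral 0) \<Omega>" by (simp add: weak_form_def)
    then have hi0: "((\<lambda>x. P t x \<bullet> X x + q x * \<psi> x) has_integral 0) S"
      by (subst has_integral_restrict_support) (auto simp: \<psi>_def X_def out)
    have "integral S (e' t) - 0 = integral S (\<lambda>x. e' t x - (P t x \<bullet> X x + q x * \<psi> x))"
      using has_integral_diff[OF integrable_integral[OF int[of e', OF ce(2) t(1)]] hi0] by (simp add: integral_unique)
    also have "\<dots> \<le> integral S (\<lambda>x. - w t x)"
    proof (rule integral_le)
      show "(\<lambda>x. e' t x - (P t x \<bullet> X x + q x * \<psi> x)) integrable_on S"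
        using has_integral_diff[OF integrable_integral[OF int[of e', OF ce(2) t(1)]] hi0] by (rule has_integral_integrable)
      show "(\<lambda>x. - w t x) integrable_on S" by (intro integrable_neg int[of w, OF ce(3) t(1)])
      fix x assume "x \<in> S"
      define g where "g = cone_weight_grad t\<^sub>0 x\<^sub>0 t x"
      define d where "d = cone_weight_dt t\<^sub>0 x\<^sub>0 t x"
      have "\<bar>V t x * (P t x \<bullet> g)\<bar> \<le> \<bar>V t x\<bar> * (norm (P t x) * norm g)"
        unfolding abs_mult by (intro mult_left_mono Cauchy_Schwarz_ineq2) auto
      also have "\<dots> = (\<bar>V t x\<bar> * norm (P t x)) * norm g" by simp
      also have "\<dots> \<le> (((V t x)\<^sup>2 + P t x \<bullet> P t x) / 2) * (- d)"
      proof (rule mult_mono)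
        show "\<bar>V t x\<bar> * norm (P t x) \<le> ((V t x)\<^sup>2 + P t x \<bullet> P t x) / 2"
          using sum_squares_bound[of "\<bar>V t x\<bar>" "norm (P t x)"] by (simp add: power2_norm_eq_inner)
        show "norm g \<le> - d" unfolding g_def d_def by (rule cone_weight_eikonal[OF t(2)])
      qed auto
      finally have 1: "d * ((V t x)\<^sup>2 + P t x \<bullet> P t x) / 2 - V t x * (P t x \<bullet> g) \<le> 0" by (simp add: algebra_simps)
      have 2: "0 \<le> \<alpha> * (\<phi> t x * (V t x)\<^sup>2)"
        by (intro mult_nonneg_nonneg \<alpha> cone_weight_nonneg) auto
      have "e' t x - (P t x \<bullet> X x + q x * \<psi> x) =
         d * ((V t x)\<^sup>2 + P t x \<bullet> P t x) / 2 - V t x * (P t x \<bullet> g) - \<alpha> * (\<phi> t x * (V t x)\<^sup>2) - w t x"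
        unfolding e'_def X_def \<psi>_def w_def g_def[symmetric] d_def[symmetric] q_def V_def[symmetric] V'_def[symmetric] Fm_def[symmetric]
        by (simp add: inner_add_right algebra_simps power2_eq_square)
      then show "e' t x - (P t x \<bullet> X x + q x * \<psi> x) \<le> - w t x" using 1 2 by linarith
    qed
    finally show ?thesis by simp
  qed
  have sub: "{0..T} \<times> K \<subseteq> ?D" by auto
  have ce'2: "continuous_on ({0..T} \<times> K) (\<lambda>z. e' (fst z) (snd z))" "continuous_on ({0..T} \<times> K) (\<lambda>z. w (fst z) (snd z))"
    using ce(2,3) sub continuous_on_subset by blast+
  note F1 = integral_Times_swap[OF KS_facts ce'2(1), unfolded fst_conv snd_conv]
  note F2 = integral_Times_swap[OF KS_facts ce'2(2), unfolded fst_conv snd_conv]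
  have eq: "e t x = \<phi> t x * ((window_mean h ut t x)\<^sup>2 + window_mean h gu t x \<bullet> window_mean h gu t x) / 2"
    if "x \<in> S" "t \<ge> 0" for t x
    using window_mean_ut[OF h that(2), of x] that(1) by (simp add: e_def P_def V_def)
  have "integral S (e T) - integral S (e 0) = integral S (\<lambda>x. e T x - e 0 x)"
    using int[of e, OF ce(1)] T by (simp add: integral_diff)
  also have "\<dots> = integral S (\<lambda>x. integral {0..T} (\<lambda>t. e' t x))"
    by (rule integral_cong) (simp add: D)
  also have "\<dots> = integral {0..T} (\<lambda>t. integral S (e' t))" by (rule F1(3))
  also have "\<dots> \<le> integral {0..T} (\<lambda>t. - integral S (w t))"
    by (rule integral_le[OF F1(2) integrable_neg[OF F2(2)]]) (rule slice)
  also have "\<dots> = - integral ({0..T} \<times> S) (\<lambda>z. w (fst z) (snd z))" by (simp add: F2(4))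
  also have "integral ({0..T} \<times> S) (\<lambda>z. w (fst z) (snd z)) = integral ({0..T} \<times> S)
     (\<lambda>z. \<phi> (fst z) (snd z) * window_mean h ut (fst z) (snd z) * window_mean h fu (fst z) (snd z))"
    by (rule integral_cong) (use h in \<open>auto simp: w_def V_def Fm_def window_mean_ut\<close>)
  also have "integral S (e T) = integral S (\<lambda>x. \<phi> T x * ((window_mean h ut T x)\<^sup>2 + window_mean h gu T x \<bullet> window_mean h gu T x) / 2)"
    by (rule integral_cong) (use eq T in auto)
  also have "integral S (e 0) = integral S (\<lambda>x. \<phi> 0 x * ((window_mean h ut 0 x)\<^sup>2 + window_mean h gu 0 x \<bullet> window_mean h gu 0 x) / 2)"
    by (rule integral_cong) (use eq in auto)
  finally show ?thesis .
qed

text \<open>The limit \<open>h \<rightarrow> 0\<close> of the inequality for the means: \<open>window_mean\<close> is jointly continuous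
  down to \<open>h = 0\<close>, hence bounded on compact sets, and dominated convergence applies.\<close>

lemma energy_inequality:
  assumes T: "0 \<le> T" "T \<le> t\<^sub>0"
  shows "integral S (\<lambda>x. \<phi> T x * ((ut T x)\<^sup>2 + gu T x \<bullet> gu T x) / 2) -
     integral S (\<lambda>x. \<phi> 0 x * ((ut 0 x)\<^sup>2 + gu 0 x \<bullet> gu 0 x) / 2)
   \<le> - integral ({0..T} \<times> S) (\<lambda>z. \<phi> (fst z) (snd z) * ut (fst z) (snd z) * f (u (fst z) (snd z)))"
proof -
  define h where "h n = 1 / (real n + 1)" for n
  have h: "h n \<in> {0..1}" "h n > 0" for n by (auto simp: h_def field_simps)
  have h0: "h \<longlonglongrightarrow> 0" unfolding h_def using LIMSEQ_inverse_real_of_nat by (simp add: inverse_eq_divide add.commute)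
  have lim: "(\<lambda>n. integral S (\<lambda>x. \<phi> t x * ((window_mean (h n) ut t x)\<^sup>2 + window_mean (h n) gu t x \<bullet> window_mean (h n) gu t x) / 2))
    \<longlonglongrightarrow> integral S (\<lambda>x. \<phi> t x * ((window_mean 0 ut t x)\<^sup>2 + window_mean 0 gu t x \<bullet> window_mean 0 gu t x) / 2)" if "t \<ge> 0" for t
  proof (rule integral_tendsto_param[OF KS_facts _ h(1) h0])
    show "continuous_on ({0..1} \<times> K) (\<lambda>z. \<phi> t (snd z) * ((window_mean (fst z) ut t (snd z))\<^sup>2 +
        window_mean (fst z) gu t (snd z) \<bullet> window_mean (fst z) gu t (snd z)) / 2)"
      by (intro continuous_intros window_mean_continuous[OF ut_cont] window_mean_continuous[OF gu_cont]) (use that in auto)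
  qed
  have KS': "compact ({0..T} \<times> K)" "{0..T} \<times> S \<in> sets borel" "{0..T} \<times> S \<subseteq> {0..T} \<times> K"
    using KS_facts by (auto intro: compact_Times borel_Times)
  have lim2: "(\<lambda>n. integral ({0..T} \<times> S) (\<lambda>z. \<phi> (fst z) (snd z) * window_mean (h n) ut (fst z) (snd z) * window_mean (h n) fu (fst z) (snd z)))
    \<longlonglongrightarrow> integral ({0..T} \<times> S) (\<lambda>z. \<phi> (fst z) (snd z) * window_mean 0 ut (fst z) (snd z) * window_mean 0 fu (fst z) (snd z))"
  proof (rule integral_tendsto_param[OF KS' _ h(1) h0])
    show "continuous_on ({0..1} \<times> {0..T} \<times> K) (\<lambda>z. \<phi> (fst (snd z)) (snd (snd z)) *
        window_mean (fst z) ut (fst (snd z)) (snd (snd z)) * window_mean (fst z) fu (fst (snd z)) (snd (snd z)))"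
      by (intro continuous_intros window_mean_continuous[OF ut_cont] window_mean_continuous[OF fu_cont]) auto
  qed
  show ?thesis
    using LIMSEQ_le[OF tendsto_diff[OF lim[OF T(1)] lim[OF order_refl]] tendsto_minus[OF lim2]]
      window_energy_inequality[OF h(2) T] by (auto simp: window_mean_0)
qed

text \<open>On the open base of the cone \<open>u(0)\<close> is identically \<open>0\<close>, hence so is its gradient; on the
  bounding sphere the weight vanishes.\<close>

lemma initial_energy_eq_0:
  assumes "x \<in> S"
  shows "\<phi> 0 x * ((ut 0 x)\<^sup>2 + gu 0 x \<bullet> gu 0 x) / 2 = 0" "\<phi> 0 x * F (u 0 x) = 0"
proof -
  have "\<phi> 0 x = 0 \<or> (ut 0 x = 0 \<and> gu 0 x = 0 \<and> u 0 x = 0)"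
  proof (cases "x \<in> ball x\<^sub>0 t\<^sub>0")
    case True
    have x: "x \<in> ball x\<^sub>0 t\<^sub>0 \<inter> \<Omega>" using True assms by auto
    have "GDERIV (u 0) x :> gu 0 x" using gu[of 0 x] assms by auto
    moreover have "GDERIV (u 0) x :> 0"
      by (rule GDERIV_transform_open[OF GDERIV_const[of 0], of "ball x\<^sub>0 t\<^sub>0 \<inter> \<Omega>"])
        (use x init_u open_domain in auto)
    ultimately have "(\<lambda>h. h \<bullet> gu 0 x) = (\<lambda>h. h \<bullet> 0)" unfolding gderiv_def by (rule has_derivative_unique)
    then have "gu 0 x \<bullet> gu 0 x = 0" by (metis inner_zero_right)
    then show ?thesis using init_u[OF x] init_ut[OF x] by simp
  next
    case False
    then show ?thesis using cone_weight_outside(1)[of 0 t\<^sub>0 x\<^sub>0 x] t\<^sub>0 by auto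
  qed
  then show "\<phi> 0 x * ((ut 0 x)\<^sup>2 + gu 0 x \<bullet> gu 0 x) / 2 = 0" "\<phi> 0 x * F (u 0 x) = 0" using F0 by auto
qed

text \<open>For fixed \<open>x\<close>, \<open>\<phi> u\<^sub>t f(u) = \<partial>\<^sub>t (\<phi> F(u)) - \<partial>\<^sub>t\<phi> F(u)\<close>. The second term is nonnegative, as
  \<open>F \<ge> 0\<close> and \<open>\<phi>\<close> decreases in time, and the first integrates to \<open>\<phi>(T) F(u(T)) \<ge> 0\<close>, as
  \<open>\<phi>(0) F(u(0)) = 0\<close>.\<close>

lemma potential_work_nonneg:
  assumes T: "0 \<le> T" "T \<le> t\<^sub>0"
  shows "0 \<le> integral ({0..T} \<times> S) (\<lambda>z. \<phi> (fst z) (snd z) * ut (fst z) (snd z) * f (u (fst z) (snd z)))"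
proof -
  have "continuous_on ({0..T} \<times> K) (\<lambda>z. \<phi> (fst z) (snd z) * ut (fst z) (snd z) * f (u (fst z) (snd z)))"
    by (intro continuous_intros continuous_on_subset[OF ut_cont] continuous_on_subset[OF fu_cont]) auto
  note swap = integral_Times_swap[OF KS_facts this, unfolded fst_conv snd_conv]
  have "0 \<le> integral {0..T} (\<lambda>t. \<phi> t x * ut t x * f (u t x))" if "x \<in> S" for x
  proof -
    have x: "x \<in> \<Omega>" "x \<in> closure \<Omega>" using that closure_subset by auto
    note c = time_slices[OF x(2) order_refl]
    have cF: "continuous_on {0..T} (\<lambda>t. F (u t x))"
      by (rule continuous_on_compose2[OF _ c(1), of UNIV F]) (use F DERIV_continuous_on in blast)+
    have "((\<lambda>t. cone_weight_dt t\<^sub>0 x\<^sub>0 t x * F (u t x) + \<phi> t x * ut t x * f (u t x)) has_integral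
       \<phi> T x * F (u T x) - \<phi> 0 x * F (u 0 x)) {0..T}"
    proof (rule fundamental_theorem_of_calculus_interior)
      show "continuous_on {0..T} (\<lambda>t. \<phi> t x * F (u t x))" by (intro continuous_intros cF)
      fix t assume t: "t \<in> {0<..<T}"
      have "((\<lambda>t. F (u t x)) has_real_derivative f (u t x) * ut t x) (at t)"
        by (rule DERIV_chain'[OF ut F]) (use t x in auto)
      from DERIV_mult[OF cone_weight_DERIV this]
      show "((\<lambda>t. \<phi> t x * F (u t x)) has_vector_derivative cone_weight_dt t\<^sub>0 x\<^sub>0 t x * F (u t x) + \<phi> t x * ut t x * f (u t x)) (at t)"
        by (simp add: has_real_derivative_iff_has_vector_derivative[symmetric] algebra_simps)
    qed (use T in auto)
    moreover have "((\<lambda>t. cone_weight_dt t\<^sub>0 x\<^sub>0 t x * F (u t x)) has_integral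
        integral {0..T} (\<lambda>t. cone_weight_dt t\<^sub>0 x\<^sub>0 t x * F (u t x))) {0..T}"
      by (intro integrable_integral integrable_continuous_real continuous_intros cF)
    ultimately have "((\<lambda>t. \<phi> t x * ut t x * f (u t x)) has_integral \<phi> T x * F (u T x) - \<phi> 0 x * F (u 0 x) -
         integral {0..T} (\<lambda>t. cone_weight_dt t\<^sub>0 x\<^sub>0 t x * F (u t x))) {0..T}"
      by (drule_tac has_integral_diff) auto
    then have eq: "integral {0..T} (\<lambda>t. \<phi> t x * ut t x * f (u t x)) = \<phi> T x * F (u T x) - \<phi> 0 x * F (u 0 x) -
         integral {0..T} (\<lambda>t. cone_weight_dt t\<^sub>0 x\<^sub>0 t x * F (u t x))" by (rule integral_unique)
    have "0 \<le> integral {0..T} (\<lambda>t. - (cone_weight_dt t\<^sub>0 x\<^sub>0 t x * F (u t x)))"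
    proof (rule integral_nonneg)
      show "(\<lambda>t. - (cone_weight_dt t\<^sub>0 x\<^sub>0 t x * F (u t x))) integrable_on {0..T}"
        by (intro integrable_continuous_real continuous_intros cF)
      fix t assume "t \<in> {0..T}"
      then have "cone_weight_dt t\<^sub>0 x\<^sub>0 t x \<le> 0" using T by (auto simp: cone_weight_dt_def)
      then show "0 \<le> - (cone_weight_dt t\<^sub>0 x\<^sub>0 t x * F (u t x))" using F_nonneg[of "u t x"] by (simp add: mult_nonpos_nonneg)
    qed
    moreover have "0 \<le> \<phi> T x * F (u T x)" by (intro mult_nonneg_nonneg cone_weight_nonneg F_nonneg)
    ultimately show ?thesis using eq initial_energy_eq_0(2)[OF that] by simp
  qed
  then have "0 \<le> integral S (\<lambda>x. integral {0..T} (\<lambda>t. \<phi> t x * ut t x * f (u t x)))"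
    by (rule integral_nonneg[OF swap(1)])
  then show ?thesis unfolding swap(4) swap(3)[symmetric] .
qed

text \<open>The weighted energy density at time \<open>T\<close> is continuous and nonnegative with integral \<open>0\<close>, hence
  zero, and the weight is positive on the axis of the cone.\<close>

lemma ut_eq_0_on_axis:
  assumes T: "0 \<le> T" "T < t\<^sub>0"
  shows "ut T x\<^sub>0 = 0"
proof -
  define k where "k x = \<phi> T x * ((ut T x)\<^sup>2 + gu T x \<bullet> gu T x) / 2" for x
  have ck: "continuous_on (closure \<Omega>) k" unfolding k_def[abs_def]
    by (intro continuous_intros continuous_on_slice[OF ut_cont] continuous_on_slice[OF gu_cont]) (use T in auto)
  have k0: "0 \<le> k x" for x unfolding k_def
    by (intro divide_nonneg_nonneg mult_nonneg_nonneg add_nonneg_nonneg cone_weight_nonneg) auto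
  have "integral S (\<lambda>x. \<phi> 0 x * ((ut 0 x)\<^sup>2 + gu 0 x \<bullet> gu 0 x) / 2) = integral S (\<lambda>x. 0)"
    by (rule integral_cong) (rule initial_energy_eq_0(1))
  then have le: "integral S k \<le> 0"
    using energy_inequality[of T] potential_work_nonneg[of T] T by (simp add: k_def[abs_def])
  have "open (\<Omega> \<inter> ball x\<^sub>0 t\<^sub>0)" "x\<^sub>0 \<in> \<Omega> \<inter> ball x\<^sub>0 t\<^sub>0" using open_domain x\<^sub>0 t\<^sub>0 by auto
  then obtain a b where ab: "cbox a b \<subseteq> \<Omega> \<inter> ball x\<^sub>0 t\<^sub>0" "x\<^sub>0 \<in> box a b" by (rule open_contains_cbox)
  then have sub: "cbox a b \<subseteq> S" "S \<subseteq> closure \<Omega>" using closure_subset by auto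
  have ci: "continuous_on (cbox a b) k" by (rule continuous_on_subset[OF ck]) (use sub in auto)
  have "integral (cbox a b) k \<le> integral S k"
  proof (rule integral_subset_le[OF sub(1)])
    show "k integrable_on S" by (rule integrable_on_subset_of_compact(2)[OF KS_facts continuous_on_subset[OF ck]]) auto
  qed (use ci k0 integrable_continuous in auto)
  moreover have "0 \<le> integral (cbox a b) k" by (intro integral_nonneg integrable_continuous ci k0)
  ultimately have "integral (cbox a b) k = 0" using le by linarith
  then have "(k has_integral 0) (cbox a b)" using integrable_integral[OF integrable_continuous[OF ci]] by (simp only:)
  then have "k x\<^sub>0 = 0"
    by (rule has_integral_0_cbox_imp_0[OF ci k0]) (use ab(2) box_subset_cbox[of a b] in auto)
  moreover have "\<phi> T x\<^sub>0 > 0" using cone_gap_pos_iff[of T t\<^sub>0 x\<^sub>0 x\<^sub>0] T by (simp add: cone_weight_def pos_sq_def)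
  ultimately have "(ut T x\<^sub>0)\<^sup>2 + gu T x\<^sub>0 \<bullet> gu T x\<^sub>0 = 0" by (simp add: k_def)
  moreover have "0 \<le> gu T x\<^sub>0 \<bullet> gu T x\<^sub>0" "0 \<le> (ut T x\<^sub>0)\<^sup>2" by simp_all
  ultimately have "(ut T x\<^sub>0)\<^sup>2 = 0" by linarith
  then show ?thesis by simp
qed

lemma vanishes_at_apex: "u t\<^sub>0 x\<^sub>0 = 0"
proof -
  have x: "x\<^sub>0 \<in> closure \<Omega>" using x\<^sub>0 closure_subset by auto
  have "((\<lambda>s. 0) has_integral u t\<^sub>0 x\<^sub>0 - u 0 x\<^sub>0) {0..t\<^sub>0}"
  proof (rule fundamental_theorem_of_calculus_interior)
    show "continuous_on {0..t\<^sub>0} (\<lambda>s. u s x\<^sub>0)" by (rule time_slices[OF x order_refl])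
    show "((\<lambda>s. u s x\<^sub>0) has_vector_derivative 0) (at t)" if "t \<in> {0<..<t\<^sub>0}" for t
      using ut[of t x\<^sub>0] ut_eq_0_on_axis[of t] that x\<^sub>0 by (simp add: has_real_derivative_iff_has_vector_derivative[symmetric])
  qed (use t\<^sub>0 in auto)
  then have "u t\<^sub>0 x\<^sub>0 - u 0 x\<^sub>0 = 0" using has_integral_0 has_integral_unique by blast
  then show ?thesis using init_u[of x\<^sub>0] x\<^sub>0 t\<^sub>0 by simp
qed

end

section \<open>Normal derivatives on the boundary\<close>

text \<open>A local defining function vanishes at \<open>x\<close> and has the positive derivative \<open>|G x|\<close> along
  \<open>\<nu>\<close>.\<close>

lemma outer_normal_points_outward:
  assumes "open \<Omega>" "x \<in> frontier \<Omega>" "outer_unit_normal \<Omega> x \<nu>"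
  obtains d where "d > 0" "\<And>s. 0 < s \<Longrightarrow> s < d \<Longrightarrow> x - s *\<^sub>R \<nu> \<in> \<Omega>"
proof -
  obtain g G where g: "local_defining_function \<Omega> x g G" and \<nu>: "\<nu> = sgn (G x)"
    using assms(3) unfolding outer_unit_normal_def by blast
  then obtain U where U: "open U" "x \<in> U" "\<Omega> \<inter> U = {y \<in> U. g y < 0}"
      "\<And>y. y \<in> U \<Longrightarrow> GDERIV g y :> G y" "\<And>y. y \<in> U \<Longrightarrow> G y \<noteq> 0"
    unfolding local_defining_function_def by blast
  have cg: "continuous_on U g" using U(4) by (rule GDERIV_imp_continuous_on)
  have "x \<notin> \<Omega>" using assms(1,2) by (simp add: frontier_def interior_open)
  have mem: "y \<in> \<Omega> \<longleftrightarrow> g y < 0" if "y \<in> U" for y using U(3) that by blast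
  have "g x \<ge> 0" using mem[OF U(2)] \<open>x \<notin> \<Omega>\<close> by simp
  have "g x \<le> 0"
  proof (rule ccontr)
    assume "\<not> g x \<le> 0"
    then have x: "x \<in> g -` {0<..} \<inter> U" using U(2) by simp
    have "open (g -` {0<..} \<inter> U)" using cg U(1) by (simp add: continuous_on_open_vimage)
    moreover have "x \<in> closure \<Omega>" using assms(2) by (simp add: frontier_def)
    ultimately obtain y where "y \<in> \<Omega>" "y \<in> g -` {0<..} \<inter> U"
      using x open_Int_closure_eq_empty[of "g -` {0<..} \<inter> U" \<Omega>] by blast
    then show False using mem[of y] by simp
  qed
  have "((\<lambda>s. g (x + s *\<^sub>R \<nu>)) has_real_derivative G x \<bullet> \<nu>) (at 0)"
    by (rule GDERIV_imp_directional) (simp add: U(2,4))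
  moreover have "G x \<bullet> \<nu> > 0" using U(2,5) by (simp add: \<nu> sgn_div_norm)
  ultimately obtain d1 where d1: "d1 > 0" "\<And>h. 0 < h \<Longrightarrow> h < d1 \<Longrightarrow> g (x + (0 - h) *\<^sub>R \<nu>) < g (x + 0 *\<^sub>R \<nu>)"
    using DERIV_pos_inc_left[of "\<lambda>s. g (x + s *\<^sub>R \<nu>)" "G x \<bullet> \<nu>" 0] by blast
  obtain d2 where d2: "d2 > 0" "ball x d2 \<subseteq> U" using U(1,2) open_contains_ball by blast
  show ?thesis
  proof (rule that[of "min d1 d2"])
    fix s assume s: "0 < s" "s < min d1 d2"
    have "norm \<nu> = 1" using U(2,5) by (simp add: \<nu> norm_sgn)
    then have "x - s *\<^sub>R \<nu> \<in> U" using d2 s by (auto simp: dist_norm subset_iff)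
    moreover have "g (x - s *\<^sub>R \<nu>) < 0" using d1(2)[of s] s \<open>g x \<le> 0\<close> by simp
    ultimately show "x - s *\<^sub>R \<nu> \<in> \<Omega>" using mem by blast
  qed (use d1 d2 in auto)
qed

text \<open>The normal derivative is defined by difference quotients of boundary and interior values; it
  agrees with the normal component of the continuously extended gradient by the mean value theorem
  on the segments \<open>[x + h n \<nu>, x]\<close>, whose relative interior lies in \<open>\<Omega>\<close>.\<close>

lemma normal_derivative_eq_inner_gradient:
  assumes \<Omega>: "open \<Omega>" "x \<in> frontier \<Omega>" and \<nu>: "outer_unit_normal \<Omega> x \<nu>"
    and D: "has_normal_derivative \<Omega> v x D"
    and cv: "continuous_on (closure \<Omega>) v" and cg: "continuous_on (closure \<Omega>) g"
    and g: "\<And>y. y \<in> \<Omega> \<Longrightarrow> GDERIV v y :> g y"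
  shows "g x \<bullet> \<nu> = D"
proof -
  obtain d where d: "d > 0" "\<And>s. 0 < s \<Longrightarrow> s < d \<Longrightarrow> x - s *\<^sub>R \<nu> \<in> \<Omega>"
    using outer_normal_points_outward[OF \<Omega> \<nu>] by blast
  define k where "k s = v (x + s *\<^sub>R \<nu>)" for s
  have in\<Omega>: "x + s *\<^sub>R \<nu> \<in> \<Omega>" if "- d < s" "s < 0" for s using d(2)[of "- s"] that by simp
  have incl: "x + s *\<^sub>R \<nu> \<in> closure \<Omega>" if "- d < s" "s \<le> 0" for s
    using in\<Omega>[of s] that \<Omega>(2) closure_subset[of \<Omega>] by (cases "s = 0") (auto simp: frontier_def)
  define h where "h n = - (d / 2) * inverse (real (Suc n))" for n
  have h: "- d < h n" "h n < 0" for n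
  proof -
    have "(d / 2) * inverse (real (Suc n)) \<le> (d / 2) * 1"
      using d(1) by (intro mult_left_mono) (auto simp: field_simps)
    moreover have "(d / 2) * inverse (real (Suc n)) > 0" using d(1) by simp
    ultimately show "- d < h n" "h n < 0" unfolding h_def using d(1) by linarith+
  qed
  have h0: "h \<longlonglongrightarrow> 0" unfolding h_def by (rule tendsto_mult_right_zero[OF LIMSEQ_inverse_real_of_nat])
  have "\<exists>z. h n < z \<and> z < 0 \<and> k 0 - k (h n) = (0 - h n) * (g (x + z *\<^sub>R \<nu>) \<bullet> \<nu>)" for n
  proof -
    have "continuous_on {h n..0} k" unfolding k_def
      by (rule continuous_on_compose2[OF cv]) (use incl h[of n] in \<open>auto intro!: continuous_intros\<close>)
    moreover have "(k has_real_derivative g (x + z *\<^sub>R \<nu>) \<bullet> \<nu>) (at z)" if "h n < z" "z < 0" for z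
      unfolding k_def by (rule GDERIV_imp_directional[OF g]) (use in\<Omega> h[of n] that in auto)
    ultimately show ?thesis using h(2)[of n] MVT[of "h n" 0 k]
      by (metis DERIV_unique real_differentiable_def)
  qed
  then obtain z where z: "\<And>n. h n < z n" "\<And>n. z n < 0"
      "\<And>n. k 0 - k (h n) = (0 - h n) * (g (x + z n *\<^sub>R \<nu>) \<bullet> \<nu>)" by metis
  have z0: "z \<longlonglongrightarrow> 0"
    by (rule real_tendsto_sandwich[OF _ _ h0 tendsto_const]) (use z in \<open>auto intro!: always_eventually less_imp_le\<close>)
  have zin: "x + z n *\<^sub>R \<nu> \<in> closure \<Omega>" for n
    using incl[of "z n"] less_trans[OF h(1) z(1)] less_imp_le[OF z(2)] by simp
  have "(\<lambda>n. x + z n *\<^sub>R \<nu>) \<longlonglongrightarrow> x + 0 *\<^sub>R \<nu>" by (intro tendsto_intros z0)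
  then have "(\<lambda>n. g (x + z n *\<^sub>R \<nu>)) \<longlonglongrightarrow> g x"
    by (intro continuous_on_tendsto_compose[OF cg])
      (use \<Omega>(2) zin in \<open>auto simp: frontier_def\<close>)
  then have 1: "(\<lambda>n. g (x + z n *\<^sub>R \<nu>) \<bullet> \<nu>) \<longlonglongrightarrow> g x \<bullet> \<nu>" by (intro tendsto_intros)
  have "(k has_real_derivative D) (at 0 within {..0})"
    using D \<nu> unfolding has_normal_derivative_def k_def by blast
  then have "((\<lambda>s. (k s - k 0) / (s - 0)) \<longlongrightarrow> D) (at 0 within {..0})"
    by (simp add: has_field_derivative_iff)
  moreover have "filterlim h (at 0 within {..0}) sequentially"
    unfolding filterlim_at using h h0 by (auto intro!: always_eventually simp: less_imp_le less_imp_neq)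
  ultimately have "(\<lambda>n. (k (h n) - k 0) / (h n - 0)) \<longlonglongrightarrow> D" by (rule filterlim_compose)
  moreover have "(k (h n) - k 0) / (h n - 0) = g (x + z n *\<^sub>R \<nu>) \<bullet> \<nu>" for n
  proof -
    have "k (h n) - k 0 = h n * (g (x + z n *\<^sub>R \<nu>) \<bullet> \<nu>)" using z(3)[of n] by (simp add: algebra_simps)
    then show ?thesis using h[of n] by simp
  qed
  ultimately show ?thesis using 1 LIMSEQ_unique by simp
qed

section \<open>Finite speed of propagation\<close>

theorem theorem3p3:
  fixes \<alpha> \<epsilon> t\<^sub>0 :: real
    and W :: "real \<Rightarrow> real"
    and B \<Omega> :: "'a::euclidean_space set"
    and u :: "real \<Rightarrow> 'a \<Rightarrow> real"
    and x\<^sub>0 :: 'a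
  assumes "\<alpha> > 0" and "\<epsilon> > 0"
    and "C2_on UNIV W"
    and "\<And>s. W s \<ge> 0"
    and "W \<in> O[at_infinity](\<lambda>s. s\<^sup>2)"
    and "\<And>s. W s = 0 \<longleftrightarrow> s \<in> {0, 1}"
    and "independent B" and "flat_domain B \<Omega>"
    and "\<And>b t x. b \<in> B \<Longrightarrow> t \<ge> 0 \<Longrightarrow> x \<in> closure \<Omega> \<Longrightarrow> u t (x + b) = u t x"
    and "C2_on ({0..} \<times> \<Omega>) (\<lambda>(t, x). u t x)"
    and "C1_up_to_closure ({0..} \<times> \<Omega>) (\<lambda>(t, x). u t x)"
    and "\<And>t x. t > 0 \<Longrightarrow> x \<in> \<Omega> \<Longrightarrow>
           (deriv ^^ 2) (\<lambda>s. u s x) t + \<alpha> * deriv (\<lambda>s. u s x) t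
             = laplacian (u t) x - 1 / \<epsilon>\<^sup>2 * deriv W (u t x)"
    and "static_dirichlet \<Omega> u \<or> homogeneous_neumann \<Omega> u \<or> frontier \<Omega> = {}"
    and "t\<^sub>0 > 0" and "x\<^sub>0 \<in> \<Omega>"
    and "\<And>x. x \<in> flat_ball B x\<^sub>0 t\<^sub>0 \<inter> \<Omega> \<Longrightarrow> u 0 x = 0"
    and "\<And>x. x \<in> flat_ball B x\<^sub>0 t\<^sub>0 \<inter> \<Omega> \<Longrightarrow>
           ((\<lambda>s. u s x) has_real_derivative 0) (at 0 within {0..})"
  shows "u t\<^sub>0 x\<^sub>0 = 0"
proof -
  let ?u = "\<lambda>(t, x). u t x"
  let ?S = "{0::real..} \<times> \<Omega>"
  note pde = assms(12)
  have \<Omega>: "open \<Omega>" using assms(8) by (simp add: flat_domain_def)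
  have clS: "closure ?S = {0..} \<times> closure \<Omega>" unfolding closure_Times by (simp add: closure_closed[OF closed_atLeast])
  obtain D where cu: "continuous_on ({0..} \<times> closure \<Omega>) ?u" and cD: "continuous_on ({0..} \<times> closure \<Omega>) D"
    and D: "\<And>z. z \<in> ?S \<Longrightarrow> (?u has_derivative blinfun_apply (D z)) (at z within ?S)"
    using assms(11) unfolding C1_up_to_closure_def clS by blast
  obtain E F where E: "\<And>z. z \<in> ?S \<Longrightarrow> (?u has_derivative blinfun_apply (E z)) (at z within ?S)"
    and cF: "continuous_on ?S F"
    and F: "\<And>z. z \<in> ?S \<Longrightarrow> (E has_derivative blinfun_apply (F z)) (at z within ?S)"
    using assms(10) unfolding C2_on_def C1_on_def by blast
  have opn: "open ({0::real<..} \<times> \<Omega>)" using \<Omega> by (intro open_Times) auto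
  have at: "at (t, x) within ?S = at (t, x)" if "t > 0" "x \<in> \<Omega>" for t x
    by (rule at_within_open_subset[of _ "{0<..} \<times> \<Omega>"]) (use opn that in auto)
  \<comment> \<open>\<open>D\<close> extends to the closure, \<open>E\<close> is differentiable; they agree at interior points.\<close>
  have DE: "D (t, x) = E (t, x)" if "t > 0" "x \<in> \<Omega>" for t x
    using D[of "(t, x)"] E[of "(t, x)"] that at[OF that]
    by (auto intro!: blinfun_eqI dest: has_derivative_unique fun_cong)
  define ut where "ut t x = blinfun_apply (D (t, x)) (1, 0)" for t x
  define gu where "gu t x = (\<Sum>b\<in>Basis. blinfun_apply (D (t, x)) (0, b) *\<^sub>R b)" for t x
  define H where "H t x b = blinfun_apply (blinfun_apply (F (t, x)) (0, b)) (0, b)" for t x b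
  define f where "f s = 1 / \<epsilon>\<^sup>2 * deriv W s" for s
  have gu_inner: "y \<bullet> gu t x = blinfun_apply (D (t, x)) (0, y)" for t x y
  proof -
    have lin: "linear (\<lambda>y. blinfun_apply (D (t, x)) (0, y))"
    proof (rule linearI)
      show "blinfun_apply (D (t, x)) (0, a + b) = blinfun_apply (D (t, x)) (0, a) + blinfun_apply (D (t, x)) (0, b)" for a b
        using blinfun.add_right[of "D (t, x)" "(0, a)" "(0, b)"] by simp
      show "blinfun_apply (D (t, x)) (0, r *\<^sub>R a) = r *\<^sub>R blinfun_apply (D (t, x)) (0, a)" for r a
        using blinfun.scaleR_right[of "D (t, x)" r "(0, a)"] by simp
    qed
    have "blinfun_apply (D (t, x)) (0, y) = blinfun_apply (D (t, x)) (0, \<Sum>b\<in>Basis. (y \<bullet> b) *\<^sub>R b)"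
      by (simp add: euclidean_representation)
    also have "\<dots> = (\<Sum>b\<in>Basis. blinfun_apply (D (t, x)) (0, (y \<bullet> b) *\<^sub>R b))"
      by (rule linear_sum[OF lin])
    also have "\<dots> = (\<Sum>b\<in>Basis. (y \<bullet> b) * blinfun_apply (D (t, x)) (0, b))"
      using linear_cmul[OF lin] by simp
    finally show ?thesis by (simp add: gu_def inner_sum_right mult.commute)
  qed
  have ut_deriv: "((\<lambda>s. u s x) has_real_derivative ut t x) (at t within {0..})" if "t \<ge> 0" "x \<in> \<Omega>" for t x
  proof -
    have "((\<lambda>s. (s, x)) has_derivative (\<lambda>h. (h, 0))) (at t within {0..})"
      by (auto intro!: derivative_eq_intros)
    then have "((\<lambda>s. ?u (s, x)) has_derivative (\<lambda>h. blinfun_apply (D (t, x)) (h, 0))) (at t within {0..})"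
      by (rule has_derivative_in_compose2[of ?S ?u "\<lambda>z. blinfun_apply (D z)", rotated 3, simplified fst_conv]) (use D that in auto)
    moreover have "blinfun_apply (D (t, x)) (h, 0) = ut t x * h" for h
      using blinfun.scaleR_right[of "D (t, x)" h "(1, 0)"] by (simp add: ut_def)
    ultimately show ?thesis by (simp add: has_field_derivative_def)
  qed
  have ut_deriv': "((\<lambda>s. u s x) has_real_derivative ut t x) (at t)" if "t > 0" "x \<in> \<Omega>" for t x
    using ut_deriv[of t x] that at_within_interior[of t "{0..}"] by simp
  have gu_deriv: "GDERIV (u t) x :> gu t x" if "t \<ge> 0" "x \<in> \<Omega>" for t x
  proof -
    have "((\<lambda>y. (t, y)) has_derivative (\<lambda>h. (0, h))) (at x within \<Omega>)"
      by (auto intro!: derivative_eq_intros)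
    then have "((\<lambda>y. ?u (t, y)) has_derivative (\<lambda>h. blinfun_apply (D (t, x)) (0, h))) (at x within \<Omega>)"
      by (rule has_derivative_in_compose2[of ?S ?u "\<lambda>z. blinfun_apply (D z)", rotated 3, simplified fst_conv]) (use D that in auto)
    then show ?thesis using at_within_open[OF that(2) \<Omega>] by (simp add: gderiv_def gu_inner)
  qed
  \<comment> \<open>Second derivatives along a line in the direction \<open>(\<tau>, b)\<close>; used for time and for each \<open>b\<close>.\<close>
  have E_slice: "((\<lambda>s. blinfun_apply (E (t + s * \<tau>, x + s *\<^sub>R b)) (\<tau>, b)) has_real_derivative
      blinfun_apply (blinfun_apply (F (t, x)) (\<tau>, b)) (\<tau>, b)) (at 0)" if "t > 0" "x \<in> \<Omega>" for t x \<tau> b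
  proof -
    have 1: "((\<lambda>s. (t + s * \<tau>, x + s *\<^sub>R b)) has_derivative (\<lambda>h. h *\<^sub>R (\<tau>, b))) (at 0)"
      by (auto intro!: derivative_eq_intros)
    have "(E has_derivative blinfun_apply (F (t, x))) (at (t, x))"
      using F[of "(t, x)"] at[OF that] that by simp
    then have "((\<lambda>s. E (t + s * \<tau>, x + s *\<^sub>R b)) has_derivative (\<lambda>h. blinfun_apply (F (t, x)) (h *\<^sub>R (\<tau>, b)))) (at 0)"
      using has_derivative_compose[OF 1, of E "blinfun_apply (F (t, x))"] by simp
    then have "((\<lambda>s. blinfun_apply (E (t + s * \<tau>, x + s *\<^sub>R b)) (\<tau>, b)) has_derivative
        (\<lambda>h. blinfun_apply (blinfun_apply (F (t, x)) (h *\<^sub>R (\<tau>, b))) (\<tau>, b))) (at 0)"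
      by (rule bounded_linear.has_derivative[OF blinfun.bounded_linear_left])
    moreover have "blinfun_apply (blinfun_apply (F (t, x)) (h *\<^sub>R (\<tau>, b))) (\<tau>, b) =
        blinfun_apply (blinfun_apply (F (t, x)) (\<tau>, b)) (\<tau>, b) * h" for h
      by (simp only: blinfun.scaleR_right blinfun.scaleR_left) simp
    ultimately show ?thesis by (simp only: has_field_derivative_def)
  qed
  have line: "\<forall>\<^sub>F s in nhds 0. x + s *\<^sub>R b \<in> \<Omega>" if "x \<in> \<Omega>" for x b
  proof -
    have "((\<lambda>s. x + s *\<^sub>R b) \<longlongrightarrow> x + 0 *\<^sub>R b) (nhds 0)" by (intro tendsto_intros filterlim_ident)
    from topological_tendstoD[OF this \<Omega>] that show ?thesis by simp
  qed
  have H_deriv: "((\<lambda>s. gu t (x + s *\<^sub>R b) \<bullet> b) has_real_derivative H t x b) (at 0)" if "t > 0" "x \<in> \<Omega>" for t x b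
  proof -
    have "\<forall>\<^sub>F s in nhds 0. gu t (x + s *\<^sub>R b) \<bullet> b = blinfun_apply (E (t + s * 0, x + s *\<^sub>R b)) (0, b)"
      using line[OF that(2), of b] by eventually_elim (use DE that in \<open>simp add: inner_commute gu_inner\<close>)
    then show ?thesis using E_slice[OF that, of 0 b] unfolding H_def
      by (subst DERIV_cong_ev[OF refl _ refl])
  qed
  have utt: "((\<lambda>s. ut s x) has_real_derivative blinfun_apply (blinfun_apply (F (t, x)) (1, 0)) (1, 0)) (at t)"
    if "t > 0" "x \<in> \<Omega>" for t x
  proof -
    have "\<forall>\<^sub>F s in nhds 0. t + s \<in> {0<..}"
    proof -
      have "((\<lambda>s. t + s) \<longlongrightarrow> t + 0) (nhds 0)" by (intro tendsto_intros filterlim_ident)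
      from topological_tendstoD[OF this, of "{0<..}"] that show ?thesis by simp
    qed
    then have "\<forall>\<^sub>F s in nhds 0. ut (s + t) x = blinfun_apply (E (t + s * 1, x + s *\<^sub>R 0)) (1, 0)"
      by eventually_elim (use DE that in \<open>simp add: ut_def add.commute\<close>)
    then have "((\<lambda>s. ut (s + t) x) has_real_derivative blinfun_apply (blinfun_apply (F (t, x)) (1, 0)) (1, 0)) (at 0)"
      using E_slice[OF that, of 1 0] by (subst DERIV_cong_ev[OF refl _ refl])
    then show ?thesis using DERIV_shift[of "\<lambda>s. ut s x" _ 0 t] by simp
  qed
  have W: "(W has_real_derivative deriv W s) (at s)" "continuous_on UNIV (deriv W)" for s
  proof -
    obtain W' W'' where W': "\<And>z. (W has_derivative blinfun_apply (W' z)) (at z)"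
       and W'': "\<And>z. (W' has_derivative blinfun_apply (W'' z)) (at z)"
      using assms(3) unfolding C2_on_def C1_on_def by auto
    have d: "(W has_real_derivative blinfun_apply (W' z) 1) (at z)" for z
    proof -
      have "blinfun_apply (W' z) h = blinfun_apply (W' z) 1 * h" for h
        using blinfun.scaleR_right[of "W' z" h 1] by simp
      then have "blinfun_apply (W' z) = (*) (blinfun_apply (W' z) 1)" by (rule ext)
      then show ?thesis using W'[of z] by (simp only: has_field_derivative_def)
    qed
    then have eq: "deriv W = (\<lambda>z. blinfun_apply (W' z) 1)" by (auto intro: DERIV_imp_deriv)
    show "(W has_real_derivative deriv W s) (at s)" unfolding eq by (rule d)
    have "continuous_on UNIV W'"
      by (rule has_derivative_continuous_on[of UNIV W' "\<lambda>z. blinfun_apply (W'' z)"]) (use W'' in auto)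
    then show "continuous_on UNIV (deriv W)" unfolding eq by (intro continuous_intros)
  qed
  have ctD: "continuous_on ({0..} \<times> closure \<Omega>) (\<lambda>z. blinfun_apply (D z) y)" for y
    by (intro continuous_intros cD)
  interpret cone_problem \<Omega> u ut gu H \<alpha> f "\<lambda>s. 1 / \<epsilon>\<^sup>2 * W s" x\<^sub>0 t\<^sub>0
  proof
    show "open \<Omega>" "\<alpha> \<ge> 0" "t\<^sub>0 > 0" "x\<^sub>0 \<in> \<Omega>" using \<Omega> assms by auto
    show cu': "continuous_on ({0..} \<times> closure \<Omega>) (\<lambda>z. u (fst z) (snd z))" using cu by (simp add: case_prod_beta)
    show "continuous_on ({0..} \<times> closure \<Omega>) (\<lambda>z. ut (fst z) (snd z))" unfolding ut_def by (simp add: ctD)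
    show cgu: "continuous_on ({0..} \<times> closure \<Omega>) (\<lambda>z. gu (fst z) (snd z))" unfolding gu_def prod.collapse
      by (intro continuous_intros ctD)
    show "continuous_on ({0..} \<times> \<Omega>) (\<lambda>z. H (fst z) (snd z) b)" for b unfolding H_def prod.collapse
      by (intro continuous_intros cF)
    show "((\<lambda>s. u s x) has_real_derivative ut t x) (at t)" if "t > 0" "x \<in> \<Omega>" for t x by (rule ut_deriv'[OF that])
    show "GDERIV (u t) x :> gu t x" if "t \<ge> 0" "x \<in> \<Omega>" for t x by (rule gu_deriv[OF that])
    show "((\<lambda>s. gu t (x + s *\<^sub>R b) \<bullet> b) has_real_derivative H t x b) (at 0)" if "t > 0" "x \<in> \<Omega>" for t x b
      by (rule H_deriv[OF that])
    show "continuous_on UNIV f" unfolding f_def[abs_def] by (intro continuous_intros W)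
    show "((\<lambda>s. 1 / \<epsilon>\<^sup>2 * W s) has_real_derivative f s) (at s)" for s
      unfolding f_def by (intro DERIV_cmult W)
    show "0 \<le> 1 / \<epsilon>\<^sup>2 * W s" for s using assms(4) by simp
    show "1 / \<epsilon>\<^sup>2 * W 0 = 0" using assms(6)[of 0] by simp
    \<comment> \<open>The translate by the zero period.\<close>
    have sub: "ball x\<^sub>0 t\<^sub>0 \<subseteq> flat_ball B x\<^sub>0 t\<^sub>0"
    proof -
      have "0 \<in> period_lattice B" unfolding period_lattice_def by (rule range_eqI[of _ _ "\<lambda>_. 0"]) simp
      then show ?thesis unfolding flat_ball_def by (auto intro!: bexI[of _ 0])
    qed
    then show "u 0 x = 0" if "x \<in> ball x\<^sub>0 t\<^sub>0 \<inter> \<Omega>" for x using that assms(16) by blast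
    show "ut 0 x = 0" if x: "x \<in> ball x\<^sub>0 t\<^sub>0 \<inter> \<Omega>" for x
    proof -
      have "((\<lambda>s. u s x) has_real_derivative 0) (at 0 within {0..})" using assms(17)[of x] sub x by blast
      moreover have "((\<lambda>s. u s x) has_real_derivative ut 0 x) (at 0 within {0..})" using ut_deriv x by auto
      moreover have "at (0::real) within {0..} \<noteq> bot"
        using trivial_limit_at_right_real[of "0::real"] by (simp add: at_within_Ici_at_right)
      ultimately show ?thesis by (metis has_field_derivative_unique)
    qed
    show "((\<lambda>s. ut s x) has_real_derivative (\<Sum>b\<in>Basis. H t x b) - \<alpha> * ut t x - f (u t x)) (at t)"
      if tx: "t > 0" "x \<in> \<Omega>" for t x
    proof -
      have "\<forall>\<^sub>F s in nhds t. s \<in> {0<..}" using tx by (intro eventually_nhds_in_open) auto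
      then have "\<forall>\<^sub>F s in nhds t. deriv (\<lambda>s. u s x) s = ut s x"
        by eventually_elim (use ut_deriv' tx in \<open>auto intro: DERIV_imp_deriv\<close>)
      then have "deriv (deriv (\<lambda>s. u s x)) t = deriv (\<lambda>s. ut s x) t" by (intro deriv_cong_ev) auto
      then have l: "(deriv ^^ 2) (\<lambda>s. u s x) t = blinfun_apply (blinfun_apply (F (t, x)) (1, 0)) (1, 0)"
        using DERIV_imp_deriv[OF utt[OF tx]] by (simp add: numeral_2_eq_2)
      have "(deriv ^^ 2) (\<lambda>s. u t (x + s *\<^sub>R b)) 0 = H t x b" for b
      proof -
        have "\<forall>\<^sub>F s in nhds 0. deriv (\<lambda>s. u t (x + s *\<^sub>R b)) s = gu t (x + s *\<^sub>R b) \<bullet> b"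
          using line[OF tx(2), of b]
          by eventually_elim (use gu_deriv tx in \<open>auto intro!: DERIV_imp_deriv GDERIV_imp_directional\<close>)
        then have "deriv (deriv (\<lambda>s. u t (x + s *\<^sub>R b))) 0 = deriv (\<lambda>s. gu t (x + s *\<^sub>R b) \<bullet> b) 0" by (intro deriv_cong_ev) auto
        then show ?thesis using DERIV_imp_deriv[OF H_deriv[OF tx, of b]] by (simp add: numeral_2_eq_2)
      qed
      then have r: "laplacian (u t) x = (\<Sum>b\<in>Basis. H t x b)" by (simp add: laplacian_def)
      have "deriv (\<lambda>s. u s x) t = ut t x" using ut_deriv'[OF tx] by (rule DERIV_imp_deriv)
      then have "blinfun_apply (blinfun_apply (F (t, x)) (1, 0)) (1, 0) = (\<Sum>b\<in>Basis. H t x b) - \<alpha> * ut t x - f (u t x)"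
        using pde[OF tx] unfolding l r f_def by simp
      then show ?thesis using utt[OF tx] by simp
    qed
    show "(\<forall>x\<in>frontier \<Omega>. \<forall>t\<ge>0. u t x = u 0 x) \<or>
       C1_boundary \<Omega> \<and> (\<forall>t\<ge>0. \<forall>x\<in>frontier \<Omega>. \<forall>\<nu>. outer_unit_normal \<Omega> x \<nu> \<longrightarrow> gu t x \<bullet> \<nu> = 0)"
      using assms(13)
    proof (elim disjE)
      assume d: "static_dirichlet \<Omega> u"
      have "u t x = u 0 x" if "x \<in> frontier \<Omega>" "t \<ge> 0" for t x
      proof (cases "t = 0")
        case False
        have "continuous_on {0..t} (\<lambda>s. u s x)"
          by (rule continuous_on_slice[OF cu']) (use that in \<open>auto simp: frontier_def\<close>)
        moreover have "((\<lambda>s. u s x) has_real_derivative 0) (at s)" if "0 < s" "s < t" for s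
          using d that \<open>x \<in> frontier \<Omega>\<close> unfolding static_dirichlet_def by blast
        ultimately show ?thesis using DERIV_isconst_end[of 0 t "\<lambda>s. u s x"] that False by force
      qed simp
      then show ?thesis by blast
    next
      \<comment> \<open>The condition is imposed for positive times and reaches \<open>t = 0\<close> by continuity of the gradient.\<close>
      assume n: "homogeneous_neumann \<Omega> u"
      have pos: "gu t x \<bullet> \<nu> = 0" if t: "t > 0" and x: "x \<in> frontier \<Omega>" and \<nu>: "outer_unit_normal \<Omega> x \<nu>" for t x \<nu>
      proof (rule normal_derivative_eq_inner_gradient[OF \<Omega> x \<nu>])
        show "has_normal_derivative \<Omega> (u t) x 0" using n t x by (simp add: homogeneous_neumann_def)
        show "continuous_on (closure \<Omega>) (u t)" by (rule continuous_on_slice[OF cu']) (use t in auto)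
        show "continuous_on (closure \<Omega>) (gu t)" by (rule continuous_on_slice[OF cgu]) (use t in auto)
      qed (use gu_deriv t in auto)
      have "gu t x \<bullet> \<nu> = 0" if t: "t \<ge> 0" and x: "x \<in> frontier \<Omega>" and \<nu>: "outer_unit_normal \<Omega> x \<nu>" for t x \<nu>
      proof -
        have "continuous_on {0..} (\<lambda>s. gu s x)"
          by (rule continuous_on_slice[OF cgu]) (use x in \<open>auto simp: frontier_def\<close>)
        then have "continuous_on (closure {0<..}) (\<lambda>s. gu s x \<bullet> \<nu>)" by (auto intro!: continuous_intros)
        then show ?thesis
          by (rule continuous_constant_on_closure[of "{0<..}"]) (use t pos[OF _ x \<nu>] in auto)
      qed
      then show ?thesis using n by (auto simp: homogeneous_neumann_def)
    qed simp
  qed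
  show ?thesis by (rule vanishes_at_apex)
qed

end
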